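(* Let $n\ge 1$ and let $X\subset\mathbb{P}^{2n}$ be an irreducible projective variety of dimension $n$ over $\mathbb{C}$ such that $\operatorname{Tan}(X)=\mathbb{P}^{2n}$. Then $\tau(X)\geq 2$.
   Context: For an irreducible projective variety $X\subset\mathbb{P}^N$ of dimension $n$ over $\mathbb{C}$ with smooth locus $X_{\mathrm{reg}}$, $T_xX\subset\mathbb{P}^N$ denotes the projective (embedded) tangent space at $x\in X_{\mathrm{reg}}$. The tangent variety is $\operatorname{Tan}(X)=\overline{\bigcup_{x\in X_{\mathrm{reg}}}T_xX}\subseteq\mathbb{P}^N$; it is irreducible of dimension at most $\min\{2n,N\}$. The tangent degree $\tau(X)$ is the number of distinct tangent spaces to $X$ at smooth points of $X$ that pass through a general point of $\operatorname{Tan}(X)$ if $\dim\operatorname{Tan}(X)=2n$ (this number is then positive and finite), and $\tau(X)=0$ if $\dim\operatorname{Tan}(X)<2n$. *)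

theory Defs
  imports "HOL-Analysis.Analysis" "HOL-Library.Poly_Mapping"
begin

section \<open>Topological notions\<close>

definition irreducible_space :: "'b topology \<Rightarrow> bool" where
  "irreducible_space T \<longleftrightarrow> topspace T \<noteq> {} \<and>
     (\<forall>A B. closedin T A \<and> closedin T B \<and> A \<union> B = topspace T
        \<longrightarrow> A = topspace T \<or> B = topspace T)"

definition krull_dim :: "'b topology \<Rightarrow> enat" where
  "krull_dim T = Sup {enat k | k Z.
     (\<forall>i\<le>k. closedin T (Z i) \<and> irreducible_space (subtopology T (Z i))) \<and>
     (\<forall>i<k. Z i \<subset> Z (Suc i))}"

section \<open>Complex polynomials\<close>

text \<open>The coordinates are indexed by a finite type \<open>'a\<close>; a monomial is a finitely supported
  exponent vector and a polynomial a finitely supported family of coefficients.\<close>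

type_synonym 'a cpoly = "('a \<Rightarrow>\<^sub>0 nat) \<Rightarrow>\<^sub>0 complex"

definition eval_monom :: "('a::finite \<Rightarrow>\<^sub>0 nat) \<Rightarrow> complex ^ 'a \<Rightarrow> complex" where
  "eval_monom m v = (\<Prod>i\<in>UNIV. v $ i ^ Poly_Mapping.lookup m i)"

definition eval_poly :: "'a::finite cpoly \<Rightarrow> complex ^ 'a \<Rightarrow> complex" where
  "eval_poly f v = (\<Sum>m\<in>Poly_Mapping.keys f. Poly_Mapping.lookup f m * eval_monom m v)"

definition homogeneous :: "'a::finite cpoly \<Rightarrow> bool" where
  "homogeneous f \<longleftrightarrow>
     (\<exists>d. \<forall>m\<in>Poly_Mapping.keys f. (\<Sum>i\<in>UNIV. Poly_Mapping.lookup m i) = d)"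

text \<open>In the formal partial derivative the exponent subtraction is truncated, but the
  coefficient is zero whenever the truncation takes effect.\<close>

definition partial :: "'a \<Rightarrow> 'a::finite cpoly \<Rightarrow> 'a cpoly" where
  "partial i f = (\<Sum>m\<in>Poly_Mapping.keys f.
     Poly_Mapping.single (m - Poly_Mapping.single i 1)
       (of_nat (Poly_Mapping.lookup m i) * Poly_Mapping.lookup f m))"

section \<open>Projective space and its Zariski topology\<close>

text \<open>\<open>'a proj\<close> is the complex projective space of dimension \<open>CARD('a) - 1\<close>; its points are
  the lines through the origin of \<open>complex ^ 'a\<close>.\<close>

typedef (overloaded) 'a proj = "{L :: (complex ^ 'a::finite) set. vec.subspace L \<and> vec.dim L = 1}"
  morphisms line_of Proj
proof -
  have "axis undefined 1 \<noteq> (0 :: complex ^ 'a)"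
    by (simp add: axis_eq_0_iff)
  then have "vec.dim (vec.span {axis undefined 1 :: complex ^ 'a}) = 1"
    by (subst vec.dim_span, subst vec.dim_eq_card_independent) auto
  then show ?thesis
    using vec.subspace_span by blast
qed

definition hcoords :: "'a::finite proj \<Rightarrow> (complex ^ 'a) set" where
  "hcoords p = line_of p - {0}"

definition zero_locus :: "'a::finite cpoly set \<Rightarrow> 'a proj set" where
  "zero_locus S = {p. \<forall>f\<in>S. \<forall>v\<in>hcoords p. eval_poly f v = 0}"

definition zariski_closed :: "'a::finite proj set \<Rightarrow> bool" where
  "zariski_closed Z \<longleftrightarrow> (\<exists>S. (\<forall>f\<in>S. homogeneous f) \<and> Z = zero_locus S)"

definition zariski :: "'a::finite proj topology" where
  "zariski = topology (\<lambda>U. zariski_closed (- U))"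

lemma eval_poly_superset:
  assumes "finite A" "Poly_Mapping.keys f \<subseteq> A"
  shows "eval_poly f v = (\<Sum>m\<in>A. Poly_Mapping.lookup f m * eval_monom m v)"
  unfolding eval_poly_def
  by (rule sum.mono_neutral_left) (use assms in \<open>auto simp: in_keys_iff\<close>)

lemma eval_poly_0 [simp]: "eval_poly 0 v = 0"
  by (simp add: eval_poly_def)

lemma eval_poly_add: "eval_poly (f + g) v = eval_poly f v + eval_poly g v"
proof -
  let ?A = "Poly_Mapping.keys f \<union> Poly_Mapping.keys g"
  have "Poly_Mapping.keys (f + g) \<subseteq> ?A"
    by (rule Poly_Mapping.keys_add)
  then show ?thesis
    by (simp add: eval_poly_superset[of ?A] lookup_add distrib_right sum.distrib)
qed

lemma eval_poly_sum: "eval_poly (sum F A) v = (\<Sum>a\<in>A. eval_poly (F a) v)"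
  by (induction A rule: infinite_finite_induct) (auto simp: eval_poly_add)

lemma eval_poly_single: "eval_poly (Poly_Mapping.single m c) v = c * eval_monom m v"
  by (cases "c = 0") (auto simp: eval_poly_def)

lemma eval_monom_add: "eval_monom (m + m') v = eval_monom m v * eval_monom m' v"
  by (simp add: eval_monom_def lookup_add power_add prod.distrib)

lemma poly_sum_singles:
  "f = (\<Sum>m\<in>Poly_Mapping.keys f. Poly_Mapping.single m (Poly_Mapping.lookup f m))"
  by (rule poly_mapping_eqI)
     (auto simp: lookup_sum lookup_single when_def in_keys_iff)

lemma eval_poly_mult: "eval_poly (f * g) v = eval_poly f v * eval_poly g v"
proof -
  have "f * g = (\<Sum>m\<in>Poly_Mapping.keys f. \<Sum>m'\<in>Poly_Mapping.keys g.
      Poly_Mapping.single (m + m') (Poly_Mapping.lookup f m * Poly_Mapping.lookup g m'))"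
    by (subst (1) poly_sum_singles[of f], subst (1) poly_sum_singles[of g])
       (simp add: sum_product mult_single)
  then show ?thesis
    by (simp add: eval_poly_sum eval_poly_single eval_monom_add)
       (simp add: eval_poly_def sum_product mult_ac)
qed

lemma homogeneous_mult:
  assumes "homogeneous f" "homogeneous g"
  shows "homogeneous (f * g)"
proof -
  obtain d e where
    d: "\<And>m. m \<in> Poly_Mapping.keys f \<Longrightarrow> (\<Sum>i\<in>UNIV. Poly_Mapping.lookup m i) = d" and
    e: "\<And>m. m \<in> Poly_Mapping.keys g \<Longrightarrow> (\<Sum>i\<in>UNIV. Poly_Mapping.lookup m i) = e"
    using assms unfolding homogeneous_def by blast
  have "(\<Sum>i\<in>UNIV. Poly_Mapping.lookup m i) = d + e" if m: "m \<in> Poly_Mapping.keys (f * g)" for m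
  proof -
    from m keys_mult[of f g] obtain a b where
      "a \<in> Poly_Mapping.keys f" "b \<in> Poly_Mapping.keys g" "m = a + b" by blast
    then show ?thesis
      by (simp add: lookup_add sum.distrib d e)
  qed
  then show ?thesis
    unfolding homogeneous_def by blast
qed

lemma eval_poly_scale:
  assumes "\<And>m. m \<in> Poly_Mapping.keys f \<Longrightarrow> (\<Sum>i\<in>UNIV. Poly_Mapping.lookup m i) = d"
  shows "eval_poly f (c *s v) = c ^ d * eval_poly f v"
proof -
  have "eval_monom m (c *s v) = c ^ d * eval_monom m v" if "m \<in> Poly_Mapping.keys f" for m
    using assms[OF that]
    by (simp add: eval_monom_def power_mult_distrib prod.distrib power_sum[symmetric])
  then show ?thesis
    by (simp add: eval_poly_def sum_distrib_left mult_ac)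
qed

lemma hcoords_span:
  assumes "v \<in> hcoords p"
  shows "line_of p = vec.span {v}"
proof -
  have L: "vec.subspace (line_of p)" "vec.dim (line_of p) = 1"
    using line_of[of p] by auto
  have v: "v \<in> line_of p" "v \<noteq> 0"
    using assms by (auto simp: hcoords_def)
  have "vec.independent {v}"
    using v by simp
  then have "line_of p \<subseteq> vec.span {v}"
    using v L(2) by (intro vec.card_ge_dim_independent) auto
  moreover have "vec.span {v} \<subseteq> line_of p"
    using v L(1) by (intro vec.span_minimal) auto
  ultimately show ?thesis by blast
qed

lemma hcoords_scale:
  assumes "v \<in> hcoords p" "w \<in> hcoords p"
  obtains c where "c \<noteq> 0" "w = c *s v"
proof -
  have "w \<in> vec.span {v}" "w \<noteq> 0"
    using assms hcoords_span[OF assms(1)] by (auto simp: hcoords_def)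
  then show thesis
    using that by (auto simp: vec.span_singleton)
qed

lemma hcoords_nonempty: "hcoords (p :: 'a::finite proj) \<noteq> {}"
proof
  assume "hcoords p = {}"
  then have "line_of p \<subseteq> {0}"
    by (auto simp: hcoords_def)
  then have "vec.dim (line_of p) = 0"
    by simp
  moreover have "vec.dim (line_of p) = 1"
    using line_of[of p] by blast
  ultimately show False
    by linarith
qed

lemma homogeneous_vanish_iff:
  assumes "homogeneous f" "v \<in> hcoords p" "w \<in> hcoords p"
  shows "eval_poly f v = 0 \<longleftrightarrow> eval_poly f w = 0"
proof -
  obtain d where "\<And>m. m \<in> Poly_Mapping.keys f \<Longrightarrow> (\<Sum>i\<in>UNIV. Poly_Mapping.lookup m i) = d"
    using assms(1) unfolding homogeneous_def by blast
  moreover obtain c where "c \<noteq> 0" "w = c *s v"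
    using hcoords_scale assms(2,3) by blast
  ultimately show ?thesis
    by (simp add: eval_poly_scale)
qed

lemma zariski_closed_empty: "zariski_closed {}"
proof -
  have "homogeneous (1 :: 'a cpoly)"
    by (simp add: homogeneous_def)
  moreover have "zero_locus {1 :: 'a cpoly} = {}"
    using hcoords_nonempty
    by (auto simp: zero_locus_def eval_poly_def eval_monom_def lookup_one)
  ultimately show ?thesis
    unfolding zariski_closed_def by (intro exI[of _ "{1}"]) auto
qed

lemma zariski_closed_Un:
  assumes "zariski_closed A" "zariski_closed B"
  shows "zariski_closed (A \<union> B)"
proof -
  obtain S T where S: "\<forall>f\<in>S. homogeneous f" "A = zero_locus S"
    and T: "\<forall>f\<in>T. homogeneous f" "B = zero_locus T"
    using assms unfolding zariski_closed_def by blast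
  let ?P = "{f * g | f g. f \<in> S \<and> g \<in> T}"
  have "A \<union> B \<subseteq> zero_locus ?P"
    by (auto simp: S T zero_locus_def eval_poly_mult)
  moreover have "p \<in> A \<union> B" if p: "p \<in> zero_locus ?P" for p
  proof (rule ccontr)
    assume "p \<notin> A \<union> B"
    then obtain f v g w where f: "f \<in> S" "v \<in> hcoords p" "eval_poly f v \<noteq> 0"
      and g: "g \<in> T" "w \<in> hcoords p" "eval_poly g w \<noteq> 0"
      by (auto simp: S T zero_locus_def)
    have "eval_poly g v \<noteq> 0"
      using homogeneous_vanish_iff T(1) f(2) g by blast
    then have "eval_poly (f * g) v \<noteq> 0"
      using f(3) by (simp add: eval_poly_mult)
    then show False
      using p f g by (auto simp: zero_locus_def)
  qed
  moreover have "\<forall>h\<in>?P. homogeneous h"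
    using S T homogeneous_mult by blast
  ultimately show ?thesis
    unfolding zariski_closed_def by blast
qed

lemma zariski_closed_Inter:
  assumes "\<And>A. A \<in> K \<Longrightarrow> zariski_closed A"
  shows "zariski_closed (\<Inter>K)"
proof -
  obtain S where S: "\<And>A. A \<in> K \<Longrightarrow> (\<forall>f\<in>S A. homogeneous f) \<and> A = zero_locus (S A)"
    using assms unfolding zariski_closed_def by metis
  have "\<Inter>K = zero_locus (\<Union>A\<in>K. S A)"
  proof (intro set_eqI iffI)
    fix p assume "p \<in> \<Inter>K"
    then have "p \<in> zero_locus (S A)" if "A \<in> K" for A
      using S[OF that] that by blast
    then show "p \<in> zero_locus (\<Union>A\<in>K. S A)"
      by (auto simp: zero_locus_def)
  next
    fix p assume "p \<in> zero_locus (\<Union>A\<in>K. S A)"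
    then have "p \<in> zero_locus (S A)" if "A \<in> K" for A
      using that by (auto simp: zero_locus_def)
    then show "p \<in> \<Inter>K"
      using S by blast
  qed
  then show ?thesis
    unfolding zariski_closed_def using S by blast
qed

lemma istopology_zariski: "istopology (\<lambda>U. zariski_closed (- U))"
  unfolding istopology_def
proof (intro conjI allI impI)
  fix U V :: "'a proj set"
  assume "zariski_closed (- U)" "zariski_closed (- V)"
  then show "zariski_closed (- (U \<inter> V))"
    using zariski_closed_Un by (simp add: Compl_Int)
next
  fix K :: "'a proj set set"
  assume K: "\<forall>U\<in>K. zariski_closed (- U)"
  have "zariski_closed (\<Inter>(uminus ` K))"
    by (rule zariski_closed_Inter) (use K in auto)
  then show "zariski_closed (- \<Union>K)"
    by (simp add: uminus_Sup)
qed

lemma openin_zariski: "openin zariski U \<longleftrightarrow> zariski_closed (- U)"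
  by (simp add: zariski_def topology_inverse'[OF istopology_zariski])

lemma topspace_zariski [simp]: "topspace zariski = UNIV"
proof -
  have "openin zariski (UNIV :: 'a proj set)"
    using zariski_closed_empty by (simp add: openin_zariski)
  then show ?thesis
    using openin_subset by blast
qed

lemma closedin_zariski: "closedin zariski Z \<longleftrightarrow> zariski_closed Z"
  by (simp add: closedin_def openin_zariski Compl_eq_Diff_UNIV[symmetric])

section \<open>Projective varieties, tangent spaces and the tangent degree\<close>

definition irreducible_variety :: "'a::finite proj set \<Rightarrow> bool" where
  "irreducible_variety X \<longleftrightarrow> closedin zariski X \<and> irreducible_space (subtopology zariski X)"

definition proj_dim :: "'a::finite proj set \<Rightarrow> enat" where
  "proj_dim X = krull_dim (subtopology zariski X)"

definition vanishing_ideal :: "'a::finite proj set \<Rightarrow> 'a cpoly set" where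
  "vanishing_ideal X = {f. \<forall>p\<in>X. \<forall>v\<in>hcoords p. eval_poly f v = 0}"

text \<open>The linear subspace of \<open>complex ^ 'a\<close> whose projectivization is the embedded tangent space;
  its dimension exceeds that of the Zariski tangent space by one.\<close>

definition tangent_cone :: "'a::finite proj set \<Rightarrow> 'a proj \<Rightarrow> (complex ^ 'a) set" where
  "tangent_cone X x = {w. \<forall>f\<in>vanishing_ideal X. homogeneous f \<longrightarrow>
     (\<forall>v\<in>hcoords x. (\<Sum>i\<in>UNIV. eval_poly (partial i f) v * w $ i) = 0)}"

definition tangent_space :: "'a::finite proj set \<Rightarrow> 'a proj \<Rightarrow> 'a proj set" where
  "tangent_space X x = {q. line_of q \<subseteq> tangent_cone X x}"

text \<open>The Jacobian criterion: a point is smooth if the Zariski tangent space there has the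
  dimension of the variety. This is used for irreducible varieties only.\<close>

definition smooth_locus :: "'a::finite proj set \<Rightarrow> 'a proj set" where
  "smooth_locus X = {x \<in> X. enat (vec.dim (tangent_cone X x)) = proj_dim X + 1}"

definition Tan :: "'a::finite proj set \<Rightarrow> 'a proj set" where
  "Tan X = zariski closure_of (\<Union>x\<in>smooth_locus X. tangent_space X x)"

definition tangent_spaces_through :: "'a::finite proj set \<Rightarrow> 'a proj \<Rightarrow> 'a proj set set" where
  "tangent_spaces_through X p = {T. p \<in> T \<and> (\<exists>x\<in>smooth_locus X. T = tangent_space X x)}"

text \<open>``A general point of \<open>Tan X\<close>'' means every point of some nonempty Zariski open subset
  of \<open>Tan X\<close>. As \<open>Tan X\<close> is irreducible for an irreducible variety, two such subsets meet,
  hence at most one \<open>k\<close> satisfies the description. The finiteness condition is needed because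
  \<open>card\<close> of an infinite set is \<open>0\<close>.\<close>

definition tangent_degree :: "'a::finite proj set \<Rightarrow> nat" where
  "tangent_degree X =
     (if proj_dim (Tan X) = 2 * proj_dim X
      then THE k. \<exists>U. openin (subtopology zariski (Tan X)) U \<and> U \<noteq> {} \<and>
             (\<forall>p\<in>U. finite (tangent_spaces_through X p) \<and>
                     card (tangent_spaces_through X p) = k)
      else 0)"

end

theory Submission
  imports Defs "HOL-Complex_Analysis.Conformal_Mappings" "HOL-Library.Numeral_Type"
begin

text \<open>
  Work with affine cones in \<open>V = complex ^ 'a\<close>. Having at least \<open>m\<close> distinct tangent spaces through \<open>p\<close>
  is a first-order condition on \<open>p\<close>, so by quantifier elimination it holds either on a nonempty
  Zariski open set or nowhere on such a set. Sard's theorem, applied to the projection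
  \<open>(y, p) \<mapsto> p\<close> of the incidence variety of the \<open>p\<close> in the tangent space at \<open>y\<close>, makes the fibre over
  almost every \<open>p\<close> countable, hence finite by definability. So the number of tangent spaces through
  a general point is a constant \<open>k\<close>, and \<open>k \<ge> 1\<close> because the tangent spaces are dense.

  To exclude \<open>k = 1\<close>, note that two tangent cones, of dimension \<open>n + 1\<close> in a space of dimension
  \<open>2 * n + 1\<close>, always share a nonzero vector. Take \<open>y0\<close> and a tangent direction \<open>b\<close> at \<open>y0\<close> for which
  the second fundamental form \<open>u \<mapsto> II (u, b)\<close> is injective; such \<open>b\<close> are given by the regular points
  of the projection. Expanding the tangent equations at \<open>v = y0 + s b + \<dots>\<close> to second order shows
  that a common vector of the tangent cones at \<open>y0\<close> and \<open>v\<close> is, up to scaling, \<open>y0 + s w\<close> with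
  \<open>w \<longlonglongrightarrow> b / 2\<close> as \<open>s \<longlonglongrightarrow> 0\<close>. The two tangent spaces differ and, for suitable \<open>b\<close>, this point avoids a
  prescribed hypersurface. So no nonempty Zariski open set consists of points lying on at most one
  tangent space.
\<close>

section \<open>Polynomial functions\<close>

text \<open>Sard's theorem applies because the incidence variety, with points of contact normalized
  by one coordinate equal to 1, has complex dimension n + (n + 1) = 2 n + 1, the dimension of
  \<open>V\<close>. Its charts are cut out by n equations with independent gradients at one smooth
  point, and a priori these define more than the cone near that point. An analytic dichotomy settles
  this: either all equations of the cone hold on the chart, and the tangent cones are the ones given
  by the n chosen equations, or the cone lies in the zero set of a nonzero analytic function and
  contributes only a null set of points p. Measure zero thus takes the place of dimension counts,
  and a nonempty Zariski open set is never null. What is known up to null sets becomes a statement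
  on a Zariski open set through quantifier elimination. Krull dimension is computed only for
  projective space itself. The factor 1 / 2 is the one of a parabola, whose tangents at the
  parameters 0 and s meet above s / 2.\<close>

inductive_set polyfun_on :: "'i set \<Rightarrow> (('i \<Rightarrow> complex) \<Rightarrow> complex) set" for A where
  const: "(\<lambda>_. c) \<in> polyfun_on A"
| var: "i \<in> A \<Longrightarrow> (\<lambda>x. x i) \<in> polyfun_on A"
| add: "f \<in> polyfun_on A \<Longrightarrow> g \<in> polyfun_on A \<Longrightarrow> (\<lambda>x. f x + g x) \<in> polyfun_on A"
| mult: "f \<in> polyfun_on A \<Longrightarrow> g \<in> polyfun_on A \<Longrightarrow> (\<lambda>x. f x * g x) \<in> polyfun_on A"

lemma polyfun_on_mono: "f \<in> polyfun_on A \<Longrightarrow> A \<subseteq> B \<Longrightarrow> f \<in> polyfun_on B"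
  by (induction rule: polyfun_on.induct) (auto intro: polyfun_on.intros)

lemma polyfun_on_uminus: "f \<in> polyfun_on A \<Longrightarrow> (\<lambda>x. - f x) \<in> polyfun_on A"
  using polyfun_on.mult[OF polyfun_on.const[of "-1"]] by fastforce

lemma polyfun_on_diff:
  "f \<in> polyfun_on A \<Longrightarrow> g \<in> polyfun_on A \<Longrightarrow> (\<lambda>x. f x - g x) \<in> polyfun_on A"
  using polyfun_on.add[OF _ polyfun_on_uminus] by fastforce

lemma polyfun_on_sum:
  "(\<And>j. j \<in> J \<Longrightarrow> f j \<in> polyfun_on A) \<Longrightarrow> (\<lambda>x. \<Sum>j\<in>J. f j x) \<in> polyfun_on A"
  by (induction J rule: infinite_finite_induct) (auto intro: polyfun_on.intros)

lemma polyfun_on_prod: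
  "(\<And>j. j \<in> J \<Longrightarrow> f j \<in> polyfun_on A) \<Longrightarrow> (\<lambda>x. \<Prod>j\<in>J. f j x) \<in> polyfun_on A"
  by (induction J rule: infinite_finite_induct) (auto intro: polyfun_on.intros)

lemma polyfun_on_power: "f \<in> polyfun_on A \<Longrightarrow> (\<lambda>x. f x ^ k) \<in> polyfun_on A"
  by (induction k) (auto intro: polyfun_on.intros)

lemmas polyfun_intros = polyfun_on.intros polyfun_on_uminus polyfun_on_diff polyfun_on_sum
  polyfun_on_prod polyfun_on_power

lemma polyfun_on_subst:
  assumes "f \<in> polyfun_on A" "\<And>i. i \<in> A \<Longrightarrow> (\<lambda>x. s x i) \<in> polyfun_on B"
  shows "(\<lambda>x. f (s x)) \<in> polyfun_on B"
  using assms by (induction rule: polyfun_on.induct) (auto intro: polyfun_on.intros)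

lemma polyfun_on_empty: "f \<in> polyfun_on {} \<Longrightarrow> \<exists>c. f = (\<lambda>_. c)"
  by (induction rule: polyfun_on.induct) auto

text \<open>Singling out one variable: the degree bound is uniform in \<open>x\<close> and the
  coefficients avoid \<open>i\<close>, which is what inductions on the variables and on formal
  degrees require.\<close>

lemma polyfun_as_poly:
  assumes "f \<in> polyfun_on A"
  shows "\<exists>P d. (\<forall>x. degree (P x) \<le> d) \<and> (\<forall>j. (\<lambda>x. coeff (P x) j) \<in> polyfun_on (A - {i})) \<and>
           (\<forall>x t. f (x(i := t)) = poly (P x) t)"
  using assms
proof (induction rule: polyfun_on.induct)
  case (const c)
  show ?case
  proof (intro exI conjI allI)
    show "degree [:c:] \<le> 0" by simp
    show "(\<lambda>x. coeff [:c:] j) \<in> polyfun_on (A - {i})" for j by (rule polyfun_on.const)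
    show "c = poly [:c:] t" for t by simp
  qed
next
  case (var k)
  show ?case
  proof (cases "k = i")
    case True
    show ?thesis
    proof (intro exI conjI allI)
      show "degree [:0, 1 :: complex:] \<le> 1" by simp
      show "(\<lambda>x. coeff [:0, 1:] j) \<in> polyfun_on (A - {i})" for j by (rule polyfun_on.const)
      show "(x(i := t)) k = poly [:0, 1:] t" for x :: "'a \<Rightarrow> complex" and t using True by simp
    qed
  next
    case False
    show ?thesis
    proof (intro exI conjI allI)
      show "degree [:x k :: complex:] \<le> 0" for x by simp
      show "(\<lambda>x. coeff [:x k:] j) \<in> polyfun_on (A - {i})" for j
        using False var by (cases j) (auto intro: polyfun_on.intros)
      show "(x(i := t)) k = poly [:x k:] t" for x t using False by simp
    qed
  qed
next
  case (add f g)
  then obtain P d Q e where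
    "\<forall>x. degree (P x) \<le> d" "\<forall>j. (\<lambda>x. coeff (P x) j) \<in> polyfun_on (A - {i})"
    "\<forall>x t. f (x(i := t)) = poly (P x) t"
    "\<forall>x. degree (Q x) \<le> e" "\<forall>j. (\<lambda>x. coeff (Q x) j) \<in> polyfun_on (A - {i})"
    "\<forall>x t. g (x(i := t)) = poly (Q x) t" by metis
  note * = this
  show ?case
  proof (intro exI conjI allI)
    show "degree (P x + Q x) \<le> max d e" for x
      using *(1,4) by (meson degree_add_le max.cobounded1 max.cobounded2 order_trans)
    show "(\<lambda>x. coeff (P x + Q x) j) \<in> polyfun_on (A - {i})" for j
      using * by (auto intro: polyfun_on.intros)
    show "f (x(i := t)) + g (x(i := t)) = poly (P x + Q x) t" for x t using * by simp
  qed
next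
  case (mult f g)
  then obtain P d Q e where
    "\<forall>x. degree (P x) \<le> d" "\<forall>j. (\<lambda>x. coeff (P x) j) \<in> polyfun_on (A - {i})"
    "\<forall>x t. f (x(i := t)) = poly (P x) t"
    "\<forall>x. degree (Q x) \<le> e" "\<forall>j. (\<lambda>x. coeff (Q x) j) \<in> polyfun_on (A - {i})"
    "\<forall>x t. g (x(i := t)) = poly (Q x) t" by metis
  note * = this
  show ?case
  proof (intro exI conjI allI)
    show "degree (P x * Q x) \<le> d + e" for x
      using *(1,4) by (meson degree_mult_le add_mono order_trans)
    show "(\<lambda>x. coeff (P x * Q x) j) \<in> polyfun_on (A - {i})" for j
      using * by (auto simp: coeff_mult intro!: polyfun_intros)
    show "f (x(i := t)) * g (x(i := t)) = poly (P x * Q x) t" for x t using * by simp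
  qed
qed

section \<open>Hilbert's basis theorem\<close>

definition ideal_on :: "'i set \<Rightarrow> (('i \<Rightarrow> complex) \<Rightarrow> complex) set \<Rightarrow> (('i \<Rightarrow> complex) \<Rightarrow> complex) set"
  where "ideal_on A F = {f. \<exists>G h. finite G \<and> G \<subseteq> F \<and> (\<forall>g\<in>G. h g \<in> polyfun_on A) \<and>
     f = (\<lambda>x. \<Sum>g\<in>G. h g x * g x)}"

lemma ideal_on_mono: "F \<subseteq> F' \<Longrightarrow> ideal_on A F \<subseteq> ideal_on A F'"
  unfolding ideal_on_def by blast

lemma ideal_on_base: "F \<subseteq> ideal_on A F"
proof
  fix f assume "f \<in> F"
  then show "f \<in> ideal_on A F"
    unfolding ideal_on_def
    by (intro CollectI exI[of _ "{f}"] exI[of _ "\<lambda>_ _. 1"]) (auto intro: polyfun_on.const)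
qed

lemma ideal_on_0: "(\<lambda>x. 0) \<in> ideal_on A F"
  unfolding ideal_on_def by (intro CollectI exI[of _ "{}"]) auto

lemma ideal_on_add:
  assumes "f \<in> ideal_on A F" "g \<in> ideal_on A F"
  shows "(\<lambda>x. f x + g x) \<in> ideal_on A F"
proof -
  obtain G h G' h' where *: "finite G" "G \<subseteq> F" "\<forall>g\<in>G. h g \<in> polyfun_on A"
    "f = (\<lambda>x. \<Sum>g\<in>G. h g x * g x)" "finite G'" "G' \<subseteq> F" "\<forall>g\<in>G'. h' g \<in> polyfun_on A"
    "g = (\<lambda>x. \<Sum>g\<in>G'. h' g x * g x)"
    using assms unfolding ideal_on_def by blast
  let ?k = "\<lambda>g x. (if g \<in> G then h g x else 0) + (if g \<in> G' then h' g x else 0)"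
  have "(\<Sum>g\<in>G \<union> G'. ?k g x * g x) = f x + g x" for x
  proof -
    have "(\<Sum>g\<in>G \<union> G'. ?k g x * g x)
        = (\<Sum>g\<in>G \<union> G'. (if g \<in> G then h g x else 0) * g x)
        + (\<Sum>g\<in>G \<union> G'. (if g \<in> G' then h' g x else 0) * g x)"
      by (simp only: distrib_right sum.distrib)
    also have "(\<Sum>g\<in>G \<union> G'. (if g \<in> G then h g x else 0) * g x) = f x"
      unfolding * by (rule sum.mono_neutral_cong_right) (use * in auto)
    also have "(\<Sum>g\<in>G \<union> G'. (if g \<in> G' then h' g x else 0) * g x) = g x"
      unfolding * by (rule sum.mono_neutral_cong_right) (use * in auto)
    finally show ?thesis .
  qed
  moreover have "?k g \<in> polyfun_on A" if "g \<in> G \<union> G'" for g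
    using * that by (cases "g \<in> G"; cases "g \<in> G'") (auto intro: polyfun_on.intros)
  ultimately show ?thesis
    unfolding ideal_on_def using * by (intro CollectI exI[of _ "G \<union> G'"] exI[of _ ?k]) auto
qed

lemma ideal_on_mult:
  assumes "f \<in> ideal_on A F" "k \<in> polyfun_on A"
  shows "(\<lambda>x. k x * f x) \<in> ideal_on A F"
proof -
  obtain G h where *: "finite G" "G \<subseteq> F" "\<forall>g\<in>G. h g \<in> polyfun_on A"
    "f = (\<lambda>x. \<Sum>g\<in>G. h g x * g x)"
    using assms unfolding ideal_on_def by blast
  then show ?thesis
    unfolding ideal_on_def using assms(2)
    by (intro CollectI exI[of _ G] exI[of _ "\<lambda>g x. k x * h g x"])
       (auto intro: polyfun_on.intros simp: sum_distrib_left mult_ac)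
qed

lemma ideal_on_sum:
  "(\<And>j. j \<in> J \<Longrightarrow> f j \<in> ideal_on A F) \<Longrightarrow> (\<lambda>x. \<Sum>j\<in>J. f j x) \<in> ideal_on A F"
  by (induction J rule: infinite_finite_induct) (auto intro: ideal_on_0 ideal_on_add)

lemma ideal_on_subset:
  assumes "F \<subseteq> ideal_on A F'"
  shows "ideal_on A F \<subseteq> ideal_on A F'"
proof
  fix f assume "f \<in> ideal_on A F"
  then obtain G h where *: "finite G" "G \<subseteq> F" "\<forall>g\<in>G. h g \<in> polyfun_on A"
    "f = (\<lambda>x. \<Sum>g\<in>G. h g x * g x)"
    unfolding ideal_on_def by blast
  show "f \<in> ideal_on A F'"
    unfolding *(4) by (intro ideal_on_sum ideal_on_mult) (use * assms in auto)
qed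

lemma ideal_on_diff:
  assumes "f \<in> ideal_on A F" "g \<in> ideal_on A F"
  shows "(\<lambda>x. f x - g x) \<in> ideal_on A F"
  using ideal_on_add[OF assms(1) ideal_on_mult[OF assms(2) polyfun_on.const[of "-1"]]] by simp

lemma ideal_on_finite_subset:
  assumes "finite G" "G \<subseteq> ideal_on A F"
  shows "\<exists>F0. finite F0 \<and> F0 \<subseteq> F \<and> G \<subseteq> ideal_on A F0"
  using assms
proof (induction G rule: finite_induct)
  case (insert g G)
  then obtain F0 where F0: "finite F0" "F0 \<subseteq> F" "G \<subseteq> ideal_on A F0" by auto
  from insert obtain F1 where F1: "finite F1" "F1 \<subseteq> F" "g \<in> ideal_on A F1"
    using that by (auto simp: ideal_on_def)
  have "ideal_on A F0 \<subseteq> ideal_on A (F0 \<union> F1)" "ideal_on A F1 \<subseteq> ideal_on A (F0 \<union> F1)"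
    by (auto intro!: ideal_on_mono)
  then show ?case using F0 F1 by (intro exI[of _ "F0 \<union> F1"]) auto
qed auto

lemma ideal_on_image_sum:
  fixes m :: nat
  assumes "f \<in> ideal_on A (g ` {..<m})"
  shows "\<exists>h. (\<forall>k<m. h k \<in> polyfun_on A) \<and> f = (\<lambda>x. \<Sum>k<m. h k x * g k x)"
proof -
  obtain G h where *: "finite G" "G \<subseteq> g ` {..<m}" "\<forall>g\<in>G. h g \<in> polyfun_on A"
    "f = (\<lambda>x. \<Sum>g\<in>G. h g x * g x)"
    using assms unfolding ideal_on_def by blast
  obtain I where I: "I \<subseteq> {..<m}" "inj_on g I" "G = g ` I"
    using *(2) by (meson subset_image_inj)
  let ?h = "\<lambda>k x. if k \<in> I then h (g k) x else 0"
  have "f x = (\<Sum>k<m. ?h k x * g k x)" for x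
  proof -
    have "f x = (\<Sum>k\<in>I. h (g k) x * g k x)"
      by (simp add: * I(3) sum.reindex[OF I(2)])
    also have "\<dots> = (\<Sum>k<m. ?h k x * g k x)"
      by (rule sum.mono_neutral_cong_left) (use I in auto)
    finally show ?thesis .
  qed
  moreover have "?h k \<in> polyfun_on A" for k
    using * I by (cases "k \<in> I") (auto intro: polyfun_on.intros)
  ultimately show ?thesis by (intro exI[of _ ?h]) blast
qed

text \<open>The bound on the degree in \<open>x i\<close> is strict, so that \<open>d = 0\<close>
  leaves only the zero function and \<open>Suc d\<close> has its leading term at
  \<open>x i ^ d\<close>.\<close>

definition bounded_degree :: "'i set \<Rightarrow> 'i \<Rightarrow> nat \<Rightarrow> (('i \<Rightarrow> complex) \<Rightarrow> complex) set" where
  "bounded_degree A i d = {f. \<exists>c. (\<forall>j<d. c j \<in> polyfun_on A) \<and> f = (\<lambda>x. \<Sum>j<d. c j x * x i ^ j)}"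

lemma bounded_degree_Suc:
  assumes "f \<in> bounded_degree A i (Suc d)"
  obtains r a where "r \<in> bounded_degree A i d" "a \<in> polyfun_on A" "f = (\<lambda>x. r x + a x * x i ^ d)"
proof -
  obtain c where c: "\<forall>j<Suc d. c j \<in> polyfun_on A" "f = (\<lambda>x. \<Sum>j<Suc d. c j x * x i ^ j)"
    using assms unfolding bounded_degree_def by blast
  show ?thesis
  proof
    show "(\<lambda>x. \<Sum>j<d. c j x * x i ^ j) \<in> bounded_degree A i d"
      using c(1) unfolding bounded_degree_def by (intro CollectI exI[of _ c]) auto
    show "c d \<in> polyfun_on A" using c(1) by simp
    show "f = (\<lambda>x. (\<Sum>j<d. c j x * x i ^ j) + c d x * x i ^ d)" using c(2) by simp
  qed
qed

lemma bounded_degree_add: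
  assumes "f \<in> bounded_degree A i d" "g \<in> bounded_degree A i d"
  shows "(\<lambda>x. f x + g x) \<in> bounded_degree A i d"
proof -
  obtain c c' where "\<forall>j<d. c j \<in> polyfun_on A" "f = (\<lambda>x. \<Sum>j<d. c j x * x i ^ j)"
    "\<forall>j<d. c' j \<in> polyfun_on A" "g = (\<lambda>x. \<Sum>j<d. c' j x * x i ^ j)"
    using assms unfolding bounded_degree_def by blast
  then show ?thesis unfolding bounded_degree_def
    by (intro CollectI exI[of _ "\<lambda>j x. c j x + c' j x"])
       (auto intro: polyfun_on.intros simp: distrib_right sum.distrib)
qed

lemma bounded_degree_0: "(\<lambda>x. 0) \<in> bounded_degree A i d"
  unfolding bounded_degree_def
  by (intro CollectI exI[of _ "\<lambda>_ _. 0"]) (auto intro: polyfun_on.intros)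

lemma bounded_degree_sum:
  "(\<And>j. j \<in> J \<Longrightarrow> f j \<in> bounded_degree A i d) \<Longrightarrow> (\<lambda>x. \<Sum>j\<in>J. f j x) \<in> bounded_degree A i d"
  by (induction J rule: infinite_finite_induct) (auto intro: bounded_degree_0 bounded_degree_add)

lemma bounded_degree_mult:
  assumes "f \<in> bounded_degree A i d" "a \<in> polyfun_on A"
  shows "(\<lambda>x. a x * x i ^ e * f x) \<in> bounded_degree A i (d + e)"
proof -
  obtain c where c: "\<forall>j<d. c j \<in> polyfun_on A" "f = (\<lambda>x. \<Sum>j<d. c j x * x i ^ j)"
    using assms unfolding bounded_degree_def by blast
  let ?c = "\<lambda>j x. if j < e then 0 else a x * c (j - e) x"
  have "a x * x i ^ e * f x = (\<Sum>j<d + e. ?c j x * x i ^ j)" for x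
  proof -
    have "a x * x i ^ e * f x = (\<Sum>j<d. a x * c j x * x i ^ (j + e))"
      by (simp add: c sum_distrib_left power_add mult_ac)
    also have "\<dots> = (\<Sum>j\<in>{e..<d+e}. a x * c (j - e) x * x i ^ j)"
      by (rule sum.reindex_bij_witness[of _ "\<lambda>j. j - e" "\<lambda>j. j + e"]) auto
    also have "\<dots> = (\<Sum>j<d + e. ?c j x * x i ^ j)"
      by (rule sum.mono_neutral_cong_left) auto
    finally show ?thesis .
  qed
  moreover have "?c j \<in> polyfun_on A" if "j < d + e" for j
    using c(1) assms(2) that by (cases "j < e") (auto intro: polyfun_on.intros)
  ultimately show ?thesis unfolding bounded_degree_def by (intro CollectI exI[of _ ?c]) auto
qed

lemma polyfun_bounded_degree:
  assumes "f \<in> polyfun_on (insert i A)"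
  shows "\<exists>d. f \<in> bounded_degree A i d"
proof -
  obtain P d where P: "\<forall>x. degree (P x) \<le> d"
    "\<forall>j. (\<lambda>x. coeff (P x) j) \<in> polyfun_on (insert i A - {i})"
    "\<forall>x t. f (x(i := t)) = poly (P x) t"
    using polyfun_as_poly[OF assms, of i] by metis
  have "f x = (\<Sum>j<Suc d. coeff (P x) j * x i ^ j)" for x
  proof -
    have "f x = poly (P x) (x i)" using P(3) fun_upd_triv by metis
    also have "\<dots> = (\<Sum>j\<le>degree (P x). coeff (P x) j * x i ^ j)" by (rule poly_altdef)
    also have "\<dots> = (\<Sum>j<Suc d. coeff (P x) j * x i ^ j)"
      by (rule sum.mono_neutral_left) (use P(1)[rule_format, of x] in \<open>auto simp: coeff_eq_0\<close>)
    finally show ?thesis .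
  qed
  moreover have "(\<lambda>x. coeff (P x) j) \<in> polyfun_on A" for j
    using P(2) by (auto intro: polyfun_on_mono[of _ "insert i A - {i}"])
  ultimately show ?thesis
    unfolding bounded_degree_def by (intro exI[of _ "Suc d"] CollectI exI[of _ "\<lambda>j x. coeff (P x) j"]) auto
qed

text \<open>The classical induction on the variables: if the ideal were not finitely generated,
  elements of least degree in \<open>x i\<close>, each outside the ideal of its predecessors, would
  have leading coefficients in a finitely generated ideal, and some leading term could be cancelled
  against earlier ones.\<close>

theorem hilbert_basis:
  assumes "finite A" "F \<subseteq> polyfun_on A"
  shows "\<exists>F0. finite F0 \<and> F0 \<subseteq> F \<and> F \<subseteq> ideal_on A F0"
  using assms
proof (induction A arbitrary: F rule: finite_induct)
  case empty
  show ?case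
  proof (cases "F \<subseteq> {\<lambda>_. 0}")
    case True
    then show ?thesis using ideal_on_0 by (intro exI[of _ "{}"]) auto
  next
    case False
    then obtain f where f: "f \<in> F" "f \<noteq> (\<lambda>_. 0)" by auto
    obtain c where c: "f = (\<lambda>_. c)" using polyfun_on_empty f empty by blast
    have "g \<in> ideal_on {} {f}" if gF: "g \<in> F" for g
    proof -
      obtain b where b: "g = (\<lambda>_. b)" using polyfun_on_empty[of g] gF empty by auto
      have "(\<lambda>x. (b / c) * f x) \<in> ideal_on {} {f}"
        using ideal_on_base by (intro ideal_on_mult polyfun_on.const) auto
      moreover have "c \<noteq> 0" using f(2) c by auto
      ultimately show ?thesis by (simp add: b c)
    qed
    then show ?thesis using f by (intro exI[of _ "{f}"]) auto
  qed
next
  case (insert i A)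
  let ?A = "insert i A"
  define I where "I = ideal_on ?A F"
  \<comment> \<open>The argument runs in the ideal \<open>I\<close>, because the remainder left by a
    cancellation lies in \<open>I\<close> but need not lie in \<open>F\<close>.\<close>
  have "\<exists>G. finite G \<and> G \<subseteq> I \<and> I \<subseteq> ideal_on ?A G"
  proof (rule ccontr)
    assume neg: "\<not> ?thesis"
    define dg where "dg f = (LEAST d. f \<in> bounded_degree A i d)" for f
    have I_poly: "I \<subseteq> polyfun_on ?A"
      using insert.prems by (auto simp: I_def ideal_on_def intro!: polyfun_intros)
    have dg: "f \<in> bounded_degree A i (dg f)" if "f \<in> I" for f
      unfolding dg_def using polyfun_bounded_degree that I_poly by (meson LeastI_ex subsetD)
    have "\<exists>g. g \<in> I - ideal_on ?A G \<and> (\<forall>h \<in> I - ideal_on ?A G. dg g \<le> dg h)"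
      if "finite G" "G \<subseteq> I" for G
    proof -
      have "\<exists>g. g \<in> I - ideal_on ?A G" using neg that by blast
      then show ?thesis using ex_has_least_nat[of "\<lambda>g. g \<in> I - ideal_on ?A G" _ dg] by blast
    qed
    then obtain ch where ch: "\<And>G. finite G \<Longrightarrow> G \<subseteq> I \<Longrightarrow> ch G \<in> I - ideal_on ?A G"
      "\<And>G h. finite G \<Longrightarrow> G \<subseteq> I \<Longrightarrow> h \<in> I - ideal_on ?A G \<Longrightarrow> dg (ch G) \<le> dg h"
      by metis
    define G where "G = rec_nat {} (\<lambda>_ G. insert (ch G) G)"
    have G_simps: "G 0 = {}" "G (Suc k) = insert (ch (G k)) (G k)" for k
      by (simp_all add: G_def)
    define g where "g k = ch (G k)" for k
    have G: "finite (G k)" "G k \<subseteq> I" for k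
      by (induction k) (use ch(1) in \<open>auto simp: G_simps\<close>)
    have G_eq: "G k = g ` {..<k}" for k
      by (induction k) (auto simp: G_simps g_def lessThan_Suc)
    have gI: "g k \<in> I" "g k \<notin> ideal_on ?A (G k)" for k
      using ch(1)[OF G] by (auto simp: g_def)
    have g_le: "dg (g k) \<le> dg h" if "h \<in> I" "h \<notin> ideal_on ?A (G k)" for k h
      using ch(2)[OF G] that by (auto simp: g_def)
    have g_mono: "dg (g k) \<le> dg (g m)" if "k \<le> m" for k m
    proof (rule g_le)
      have "G k \<subseteq> G m" using that by (auto simp: G_eq)
      then show "g m \<notin> ideal_on ?A (G k)" using gI(2) ideal_on_mono by blast
    qed (rule gI)
    have "\<forall>k. \<exists>t. dg (g k) = Suc (fst t) \<and> fst (snd t) \<in> bounded_degree A i (fst t) \<and>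
         snd (snd t) \<in> polyfun_on A \<and> g k = (\<lambda>x. fst (snd t) x + snd (snd t) x * x i ^ fst t)"
    proof
      fix k
      have "dg (g k) \<noteq> 0"
      proof
        assume "dg (g k) = 0"
        then have "g k \<in> bounded_degree A i 0" using dg[OF gI(1)] by metis
        then have "g k = (\<lambda>x. 0)" by (auto simp: bounded_degree_def)
        then show False using gI(2) ideal_on_0 by metis
      qed
      then obtain e where e: "dg (g k) = Suc e" using not0_implies_Suc by blast
      have "g k \<in> bounded_degree A i (Suc e)" using dg[OF gI(1)[of k]] unfolding e .
      from bounded_degree_Suc[OF this] obtain r a where "r \<in> bounded_degree A i e" "a \<in> polyfun_on A"
        "g k = (\<lambda>x. r x + a x * x i ^ e)" by blast
      with e show "\<exists>t. dg (g k) = Suc (fst t) \<and> fst (snd t) \<in> bounded_degree A i (fst t) \<and>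
         snd (snd t) \<in> polyfun_on A \<and> g k = (\<lambda>x. fst (snd t) x + snd (snd t) x * x i ^ fst t)"
        by (intro exI[of _ "(e, r, a)"]) simp
    qed
    from choice[OF this] obtain t where t: "\<And>k. dg (g k) = Suc (fst (t k))"
      "\<And>k. fst (snd (t k)) \<in> bounded_degree A i (fst (t k))" "\<And>k. snd (snd (t k)) \<in> polyfun_on A"
      "\<And>k. g k = (\<lambda>x. fst (snd (t k)) x + snd (snd (t k)) x * x i ^ fst (t k))"
      by blast
    define e r a where "e k = fst (t k)" and "r k = fst (snd (t k))" and "a k = snd (snd (t k))" for k
    note era = t[folded e_def r_def a_def]
    \<comment> \<open>The induction hypothesis for the leading coefficients. The generators have
      indices below some \<open>m\<close>, so \<open>a m\<close> is a combination of its
      predecessors.\<close>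
    obtain F0 where F0: "finite F0" "F0 \<subseteq> range a" "range a \<subseteq> ideal_on A F0"
      using insert.IH[of "range a"] era(3) by auto
    obtain K where K: "finite K" "F0 = a ` K" using F0 finite_subset_image by metis
    obtain m where m: "K \<subseteq> {..<m}" using K finite_nat_iff_bounded by blast
    have "a m \<in> ideal_on A (a ` {..<m})"
      using F0(3) ideal_on_mono[of F0 "a ` {..<m}" A] K m by blast
    then obtain b where b: "\<And>k. k < m \<Longrightarrow> b k \<in> polyfun_on A" "a m = (\<lambda>x. \<Sum>k<m. b k x * a k x)"
      using ideal_on_image_sum[of "a m" A a m] by blast
    \<comment> \<open>The combination has the same leading term as \<open>g m\<close>; the exponents
      \<open>e m - e k\<close> are genuine differences because the degrees increase with the
      index.\<close>
    define h where "h x = g m x - (\<Sum>k<m. (b k x * x i ^ (e m - e k)) * g k x)" for x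
    have b': "b k \<in> polyfun_on ?A" if "k < m" for k using b(1)[OF that] polyfun_on_mono by blast
    have sumI: "(\<lambda>x. \<Sum>k<m. (b k x * x i ^ (e m - e k)) * g k x) \<in> ideal_on ?A (G m)"
    proof (rule ideal_on_sum)
      fix k assume k: "k \<in> {..<m}"
      show "(\<lambda>x. (b k x * x i ^ (e m - e k)) * g k x) \<in> ideal_on ?A (G m)"
        using ideal_on_base[of "G m" ?A] k b' by (intro ideal_on_mult) (auto simp: G_eq intro!: polyfun_intros)
    qed
    have GI: "ideal_on ?A (G m) \<subseteq> I"
      unfolding I_def by (rule ideal_on_subset) (use G in \<open>auto simp: I_def\<close>)
    have hI: "h \<in> I"
      unfolding h_def I_def using gI(1) sumI GI by (intro ideal_on_diff) (auto simp: I_def)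
    have hG: "h \<notin> ideal_on ?A (G m)"
    proof
      assume "h \<in> ideal_on ?A (G m)"
      then have "(\<lambda>x. h x + (\<Sum>k<m. (b k x * x i ^ (e m - e k)) * g k x)) \<in> ideal_on ?A (G m)"
        using sumI by (rule ideal_on_add)
      then show False using gI(2)[of m] by (simp add: h_def)
    qed
    have e_mono: "e k \<le> e m" if "k < m" for k using g_mono[of k m] that era(1) by simp
    have h_eq: "h = (\<lambda>x. r m x + (\<Sum>k<m. (- b k x) * x i ^ (e m - e k) * r k x))"
    proof
      fix x
      have "(\<Sum>k<m. (b k x * x i ^ (e m - e k)) * g k x)
         = (\<Sum>k<m. b k x * x i ^ (e m - e k) * r k x + b k x * a k x * x i ^ e m)"
      proof (rule sum.cong)
        fix k assume "k \<in> {..<m}"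
        then have "e m = (e m - e k) + e k" using e_mono by simp
        then have "x i ^ e m = x i ^ (e m - e k) * x i ^ e k" by (metis power_add)
        then show "(b k x * x i ^ (e m - e k)) * g k x = b k x * x i ^ (e m - e k) * r k x + b k x * a k x * x i ^ e m"
          by (simp add: era(4) algebra_simps)
      qed simp
      also have "\<dots> = (\<Sum>k<m. b k x * x i ^ (e m - e k) * r k x) + a m x * x i ^ e m"
        unfolding sum.distrib by (subst b(2)) (simp add: sum_distrib_right)
      finally show "h x = r m x + (\<Sum>k<m. (- b k x) * x i ^ (e m - e k) * r k x)"
        unfolding h_def by (subst era(4)[of m]) (simp add: sum_negf)
    qed
    have "h \<in> bounded_degree A i (e m)"
      unfolding h_eq
    proof (intro bounded_degree_add era(2) bounded_degree_sum)
      fix k assume k: "k \<in> {..<m}"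
      have "(\<lambda>x. - b k x * x i ^ (e m - e k) * r k x) \<in> bounded_degree A i (e k + (e m - e k))"
        using k b(1) era(2) by (intro bounded_degree_mult) (auto intro!: polyfun_intros)
      then show "(\<lambda>x. - b k x * x i ^ (e m - e k) * r k x) \<in> bounded_degree A i (e m)"
        using e_mono k by simp
    qed
    then have "dg h \<le> e m" unfolding dg_def by (rule Least_le)
    moreover have "dg (g m) \<le> dg h" using g_le hI hG by blast
    ultimately show False using era(1)[of m] by simp
  qed
  then obtain G where G: "finite G" "G \<subseteq> I" "I \<subseteq> ideal_on ?A G" by blast
  obtain F0 where F0: "finite F0" "F0 \<subseteq> F" "G \<subseteq> ideal_on ?A F0"
    using ideal_on_finite_subset G(1,2) unfolding I_def by metis
  have "F \<subseteq> ideal_on ?A F0"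
    using ideal_on_base[of F ?A] G(3) ideal_on_subset[OF F0(3)] unfolding I_def by blast
  then show ?case using F0 by blast
qed

text \<open>The form in which the theorem is used: the vanishing ideal of a variety is infinite,
  while first-order conditions admit only finitely many equations.\<close>

corollary hilbert_basis_zeros:
  assumes "finite A" "F \<subseteq> polyfun_on A"
  shows "\<exists>F0. finite F0 \<and> F0 \<subseteq> F \<and> (\<forall>x. (\<forall>f\<in>F0. f x = 0) \<longrightarrow> (\<forall>f\<in>F. f x = 0))"
proof -
  obtain F0 where F0: "finite F0" "F0 \<subseteq> F" "F \<subseteq> ideal_on A F0" using hilbert_basis[OF assms] by blast
  have "f x = 0" if "\<forall>f\<in>F0. f x = 0" "f \<in> F" for f x
  proof -
    have "f \<in> ideal_on A F0" using F0 that by blast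
    then obtain G h where "G \<subseteq> F0" "f = (\<lambda>x. \<Sum>g\<in>G. h g x * g x)"
      unfolding ideal_on_def by blast
    then show ?thesis using that(1) by (auto intro!: sum.neutral)
  qed
  then show ?thesis using F0 by blast
qed

section \<open>Quantifier elimination\<close>

text \<open>Quantifier-free conditions. Closure under existential quantifiers is the theorem
  \<open>definable_ex\<close> and not a rule, so inductions see only equations and Boolean
  combinations.\<close>

inductive definable :: "(('i \<Rightarrow> complex) \<Rightarrow> bool) \<Rightarrow> bool" where
  zero: "f \<in> polyfun_on UNIV \<Longrightarrow> definable (\<lambda>x. f x = 0)"
| neg: "definable P \<Longrightarrow> definable (\<lambda>x. \<not> P x)"
| conj: "definable P \<Longrightarrow> definable Q \<Longrightarrow> definable (\<lambda>x. P x \<and> Q x)"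

lemma definable_const: "definable (\<lambda>x. b)"
proof (cases b)
  case True
  then show ?thesis using definable.zero[OF polyfun_on.const[of 0]] by simp
next
  case False
  then show ?thesis using definable.zero[OF polyfun_on.const[of 1]] by simp
qed

lemma definable_disj:
  assumes "definable P" "definable Q" shows "definable (\<lambda>x. P x \<or> Q x)"
  using definable.neg[OF definable.conj[OF definable.neg[OF assms(1)] definable.neg[OF assms(2)]]] by simp

lemma definable_imp:
  assumes "definable P" "definable Q" shows "definable (\<lambda>x. P x \<longrightarrow> Q x)"
  unfolding imp_conv_disj by (rule definable_disj[OF definable.neg[OF assms(1)] assms(2)])

lemma definable_iff:
  assumes "definable P" "definable Q" shows "definable (\<lambda>x. P x \<longleftrightarrow> Q x)"
  unfolding iff_conv_conj_imp by (rule definable.conj[OF definable_imp[OF assms] definable_imp[OF assms(2,1)]])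

lemma definable_ball:
  assumes "finite A" "\<And>a. a \<in> A \<Longrightarrow> definable (P a)"
  shows "definable (\<lambda>x. \<forall>a\<in>A. P a x)"
  using assms
proof (induction A rule: finite_induct)
  case empty
  show ?case by (simp add: definable_const)
next
  case (insert a A)
  have "definable (\<lambda>x. P a x \<and> (\<forall>a\<in>A. P a x))"
    by (rule definable.conj) (use insert in auto)
  then show ?case by simp
qed

lemma definable_bex:
  assumes "finite A" "\<And>a. a \<in> A \<Longrightarrow> definable (P a)"
  shows "definable (\<lambda>x. \<exists>a\<in>A. P a x)"
  using assms
proof (induction A rule: finite_induct)
  case empty
  show ?case by (simp add: definable_const)
next
  case (insert a A)
  have "definable (\<lambda>x. P a x \<or> (\<exists>a\<in>A. P a x))"
    by (rule definable_disj) (use insert in auto)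
  then show ?case by simp
qed

lemma definable_all_less:
  assumes "\<And>k. k < (n::nat) \<Longrightarrow> definable (P k)"
  shows "definable (\<lambda>x. \<forall>k<n. P k x)"
  using definable_ball[of "{..<n}" P] assms by (simp add: Ball_def)

lemma definable_eq:
  assumes "f \<in> polyfun_on UNIV" "g \<in> polyfun_on UNIV"
  shows "definable (\<lambda>x. f x = g x)"
  using definable.zero[OF polyfun_on_diff[OF assms]] by simp

text \<open>The degree bound \<open>d\<close> is strict, so \<open>d = 0\<close> forces the zero
  polynomial. For the bound \<open>Suc d\<close> the coefficient of index \<open>d\<close> is the
  formal leading coefficient, which may vanish for some \<open>x\<close>.\<close>

definition poly_family :: "(('i \<Rightarrow> complex) \<Rightarrow> complex poly) \<Rightarrow> nat \<Rightarrow> bool" where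
  "poly_family P d \<longleftrightarrow> (\<forall>x j. j \<ge> d \<longrightarrow> coeff (P x) j = 0) \<and> (\<forall>j. (\<lambda>x. coeff (P x) j) \<in> polyfun_on UNIV)"

lemma poly_family_coeff: "poly_family P d \<Longrightarrow> (\<lambda>x. coeff (P x) j) \<in> polyfun_on UNIV"
  by (simp add: poly_family_def)

lemma poly_family_eq_0_iff: "poly_family P d \<Longrightarrow> P x = 0 \<longleftrightarrow> (\<forall>j<d. coeff (P x) j = 0)"
  by (metis coeff_0 leI leading_coeff_0_iff poly_family_def)

lemma definable_poly_family_eq_0: "poly_family P d \<Longrightarrow> definable (\<lambda>x. P x = 0)"
  by (subst poly_family_eq_0_iff, assumption)
     (intro definable_all_less definable.zero poly_family_coeff)

text \<open>Where the formal leading coefficient vanishes, this changes nothing except the formal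
  bound.\<close>

lemma poly_family_truncate:
  assumes "poly_family P (Suc d)"
  shows "poly_family (\<lambda>x. P x - monom (coeff (P x) d) d) d"
proof -
  have "(\<lambda>x. coeff (P x - monom (coeff (P x) d) d) j) \<in> polyfun_on UNIV" for j
    using assms by (cases "j = d") (auto simp: poly_family_def intro!: polyfun_on.intros)
  moreover have "coeff (P x - monom (coeff (P x) d) d) j = 0" if "d \<le> j" for x j
    using assms that unfolding poly_family_def by (cases "j = d") auto
  ultimately show ?thesis unfolding poly_family_def by blast
qed

text \<open>One step of pseudo-division: cross-multiplication cancels the leading terms without
  dividing, so the coefficients remain polynomial in the parameters.\<close>

lemma poly_family_step:
  assumes P: "poly_family P (Suc d)" and S: "poly_family S (Suc e)" and "d \<le> e"
  shows "poly_family (\<lambda>x. smult (coeff (P x) d) (S x) - smult (coeff (S x) e) (monom 1 (e - d) * P x)) e"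
    (is "poly_family ?R e")
proof -
  have c: "coeff (?R x) j = coeff (P x) d * coeff (S x) j -
      coeff (S x) e * (if j < e - d then 0 else coeff (P x) (j - (e - d)))" for x j
    by (simp add: coeff_monom_mult)
  have "(\<lambda>x. coeff (?R x) j) \<in> polyfun_on UNIV" for j
    unfolding c using poly_family_coeff[OF P] poly_family_coeff[OF S]
    by (cases "j < e - d") (auto intro!: polyfun_intros)
  moreover have "coeff (?R x) j = 0" if "e \<le> j" for x j
  proof (cases "j = e")
    case True
    then show ?thesis unfolding c using \<open>d \<le> e\<close> by simp
  next
    case False
    then have "coeff (S x) j = 0" "coeff (P x) (j - (e - d)) = 0"
      using P S that \<open>d \<le> e\<close> by (auto simp: poly_family_def)
    then show ?thesis unfolding c by simp
  qed
  ultimately show ?thesis unfolding poly_family_def by blast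
qed

lemma poly_family_mult:
  assumes P: "poly_family P d" and S: "poly_family S e"
  shows "poly_family (\<lambda>x. P x * S x) (d + e)"
proof -
  have "coeff (P x * S x) j = 0" if "d + e \<le> j" for x j
  proof -
    have "coeff (P x) i * coeff (S x) (j - i) = 0" for i
      using P S that by (cases "i \<ge> d") (auto simp: poly_family_def)
    then show ?thesis unfolding coeff_mult by (intro sum.neutral) blast
  qed
  moreover have "(\<lambda>x. coeff (P x * S x) j) \<in> polyfun_on UNIV" for j
    using poly_family_coeff[OF P] poly_family_coeff[OF S] by (auto simp: coeff_mult intro!: polyfun_intros)
  ultimately show ?thesis unfolding poly_family_def by blast
qed

lemma poly_family_power:
  assumes P: "poly_family P d"
  shows "\<exists>e. poly_family (\<lambda>x. P x ^ k) e"
proof (induction k)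
  case 0
  show ?case by (intro exI[of _ 1]) (auto simp: poly_family_def intro!: polyfun_on.const)
next
  case (Suc k)
  then show ?case using poly_family_mult[OF P] by auto
qed

text \<open>Pseudo-division lowers the formal degree of \<open>S\<close> and preserves divisibility,
  since the leading coefficient of \<open>P x\<close> is a unit where the guard holds. The guard
  also fixes the degree of \<open>P x\<close> to be \<open>d\<close>.\<close>

lemma definable_dvd:
  assumes P: "poly_family P (Suc d)" and S: "poly_family S e"
  shows "definable (\<lambda>x. coeff (P x) d \<noteq> 0 \<and> P x dvd S x)"
  using S
proof (induction e arbitrary: S)
  case 0
  then have "S x = 0" for x by (simp add: poly_family_eq_0_iff)
  then show ?case using poly_family_coeff[OF P] by (auto intro!: definable.intros)
next
  case (Suc e)
  have deg: "degree (P x) = d" if "coeff (P x) d \<noteq> 0" for x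
  proof (rule antisym)
    show "degree (P x) \<le> d" using P by (intro degree_le) (auto simp: poly_family_def)
  qed (use that le_degree in blast)
  show ?case
  proof (cases "d \<le> e")
    case True
    let ?R = "\<lambda>x. smult (coeff (P x) d) (S x) - smult (coeff (S x) e) (monom 1 (e - d) * P x)"
    have "definable (\<lambda>x. coeff (P x) d \<noteq> 0 \<and> P x dvd ?R x)"
      by (rule Suc.IH, rule poly_family_step[OF P Suc.prems True])
    moreover have "P x dvd ?R x \<longleftrightarrow> P x dvd S x" if "coeff (P x) d \<noteq> 0" for x
    proof -
      have "P x dvd smult (coeff (S x) e) (monom 1 (e - d) * P x)"
        by (simp add: dvd_smult)
      then have "P x dvd ?R x \<longleftrightarrow> P x dvd smult (coeff (P x) d) (S x)"
        by (metis (no_types, lifting) diff_add_cancel dvd_add_left_iff)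
      then show ?thesis using that by (simp add: dvd_smult_iff)
    qed
    ultimately have "(\<lambda>x. coeff (P x) d \<noteq> 0 \<and> P x dvd S x) = (\<lambda>x. coeff (P x) d \<noteq> 0 \<and> P x dvd ?R x)"
      by (intro ext) blast
    then show ?thesis using \<open>definable (\<lambda>x. coeff (P x) d \<noteq> 0 \<and> P x dvd ?R x)\<close> by simp
  next
    case False
    have "P x dvd S x \<longleftrightarrow> S x = 0" if "coeff (P x) d \<noteq> 0" for x
    proof
      assume "P x dvd S x"
      show "S x = 0"
      proof (rule ccontr)
        assume "S x \<noteq> 0"
        then have "d \<le> degree (S x)" using \<open>P x dvd S x\<close> deg[OF that] dvd_imp_degree_le by metis
        moreover have "degree (S x) \<le> e"
          using Suc.prems by (intro degree_le) (auto simp: poly_family_def)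
        ultimately show False using False by simp
      qed
    qed simp
    then have "(\<lambda>x. coeff (P x) d \<noteq> 0 \<and> P x dvd S x) = (\<lambda>x. coeff (P x) d \<noteq> 0 \<and> S x = 0)" by auto
    then show ?thesis
      using definable_poly_family_eq_0[OF Suc.prems] poly_family_coeff[OF P] by (auto intro!: definable.intros)
  qed
qed

text \<open>If every root of \<open>p\<close> is a root of \<open>q\<close>, each has multiplicity
  at most \<open>d\<close> in \<open>p\<close>, so \<open>q ^ d\<close> contains all linear factors
  of \<open>p\<close>. This replaces a quantifier over roots by divisibility.\<close>

lemma common_root_iff_dvd_power:
  fixes p q :: "complex poly"
  assumes "degree p = d" "p \<noteq> 0"
  shows "(\<exists>t. poly p t = 0 \<and> poly q t \<noteq> 0) \<longleftrightarrow> \<not> p dvd q ^ d"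
proof -
  have "p dvd q ^ d" if "\<And>t. poly p t = 0 \<Longrightarrow> poly q t = 0"
    using assms that
  proof (induction d arbitrary: p)
    case 0
    then show ?case by (metis is_unit_iff_degree unit_imp_dvd)
  next
    case (Suc d)
    obtain t where t: "poly p t = 0"
    proof -
      have "\<exists>i\<in>{1..degree p}. coeff p i \<noteq> 0"
        using Suc.prems leading_coeff_neq_0[of p] by (intro bexI[of _ "degree p"]) auto
      then obtain t where "(\<Sum>i\<le>degree p. coeff p i * t ^ i) = 0"
        using fundamental_theorem_of_algebra[of "coeff p" "degree p"] by blast
      then show thesis using that by (simp add: poly_altdef)
    qed
    obtain p1 where p1: "p = [:-t, 1:] * p1" using t poly_eq_0_iff_dvd by blast
    obtain q1 where q1: "q = [:-t, 1:] * q1" using Suc.prems(3)[OF t] poly_eq_0_iff_dvd by blast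
    have nz: "p1 \<noteq> 0" using p1 Suc.prems(2) by auto
    have "degree p = 1 + degree p1" unfolding p1 using nz by (subst degree_mult_eq) auto
    then have "p1 dvd q ^ d"
      using Suc.prems(1,3) nz by (intro Suc.IH) (auto simp: p1)
    then have "[:-t, 1:] * p1 dvd [:-t, 1:] * q1 * q ^ d" by (metis mult_dvd_mono dvd_triv_left)
    then show ?case using p1 q1 by simp
  qed
  moreover have "poly q t = 0" if "p dvd q ^ d" "poly p t = 0" for t
  proof -
    have "poly (q ^ d) t = 0" using that poly_eq_0_iff_dvd dvd_trans by blast
    then show ?thesis by (simp add: poly_power)
  qed
  ultimately show ?thesis by blast
qed

text \<open>Euclid's algorithm with parameters. Each step branches on a formal leading coefficient:
  where it vanishes the polynomial is truncated, elsewhere it reduces a second equation. When one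
  equation is left, \<open>common_root_iff_dvd_power\<close> removes the quantifier.\<close>

lemma definable_ex_root:
  assumes "\<forall>(P, d)\<in>set Ps. poly_family P d" "poly_family Q e"
  shows "definable (\<lambda>x. \<exists>t. (\<forall>(P, d)\<in>set Ps. poly (P x) t = 0) \<and> poly (Q x) t \<noteq> 0)"
  using assms(1)
\<comment> \<open>With \<open>Suc d\<close> in place of \<open>d\<close>, dropping an equation with
  bound 0 also decreases the measure.\<close>
proof (induction "\<Sum>(P, d)\<leftarrow>Ps. Suc d" arbitrary: Ps rule: less_induct)
  case less
  note Q = assms(2)
  consider "Ps = []" | P d where "Ps = [(P, Suc d)]" | P Rs where "Ps = (P, 0) # Rs"
    | P d R Rs where "Ps = (P, Suc d) # (R, 0) # Rs"
    | P d R e' Rs where "Ps = (P, Suc d) # (R, Suc e') # Rs"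
  proof (cases Ps)
    case (Cons p Rs)
    obtain P k where p: "p = (P, k)" by fastforce
    show ?thesis
    proof (cases k)
      case (Suc d)
      show ?thesis
      proof (cases Rs)
        case Nil
        then show ?thesis using that(2) Cons p Suc by simp
      next
        case (Cons r Rs')
        obtain R m where "r = (R, m)" by fastforce
        then show ?thesis using that(4,5) \<open>Ps = p # Rs\<close> p Suc Cons by (cases m) auto
      qed
    qed (use that(3) Cons p in simp)
  qed (use that(1) in simp)
  then show ?case
  proof cases
    case 1
    have "(\<exists>t. poly (Q x) t \<noteq> 0) \<longleftrightarrow> Q x \<noteq> 0" for x
      using poly_all_0_iff_0 by blast
    then show ?thesis using 1 definable_poly_family_eq_0[OF Q] by (auto intro: definable.intros)
  next
    case (2 P d)
    then have P: "poly_family P (Suc d)" using less.prems by auto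
    obtain k where k: "poly_family (\<lambda>x. Q x ^ d) k" using poly_family_power[OF Q] by blast
    let ?P = "\<lambda>x. P x - monom (coeff (P x) d) d"
    have "definable (\<lambda>x. \<exists>t. (\<forall>(P, d)\<in>set [(?P, d)]. poly (P x) t = 0) \<and> poly (Q x) t \<noteq> 0)"
      by (rule less.hyps) (use poly_family_truncate[OF P] 2 in auto)
    then have D1: "definable (\<lambda>x. \<exists>t. poly (?P x) t = 0 \<and> poly (Q x) t \<noteq> 0)" by simp
    have D2: "definable (\<lambda>x. coeff (P x) d \<noteq> 0 \<and> P x dvd Q x ^ d)"
      by (rule definable_dvd[OF P k])
    have eq: "(\<exists>t. poly (P x) t = 0 \<and> poly (Q x) t \<noteq> 0) \<longleftrightarrow>
       (coeff (P x) d = 0 \<and> (\<exists>t. poly (?P x) t = 0 \<and> poly (Q x) t \<noteq> 0)) \<or>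
       (coeff (P x) d \<noteq> 0 \<and> \<not> (coeff (P x) d \<noteq> 0 \<and> P x dvd Q x ^ d))" for x
    proof (cases "coeff (P x) d = 0")
      case False
      have "degree (P x) \<le> d" using P by (intro degree_le) (auto simp: poly_family_def)
      then have "degree (P x) = d" using le_degree[OF False] by simp
      moreover have "P x \<noteq> 0" using False by auto
      ultimately show ?thesis using common_root_iff_dvd_power[of "P x" d "Q x"] False by blast
    qed simp
    show ?thesis
      unfolding 2 list.set ball_simps prod.case simp_thms eq
      by (rule definable_disj[OF definable.conj[OF definable.zero D1] definable.conj[OF definable.neg[OF definable.zero] definable.neg[OF D2]]])
         (rule poly_family_coeff[OF P])+
  next
    case (3 P Rs)
    have "poly_family P 0" using less.prems 3 by simp
    then have "P x = 0" for x by (simp add: poly_family_eq_0_iff)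
    then have "(\<lambda>x. \<exists>t. (\<forall>(P, d)\<in>set Ps. poly (P x) t = 0) \<and> poly (Q x) t \<noteq> 0)
        = (\<lambda>x. \<exists>t. (\<forall>(P, d)\<in>set Rs. poly (P x) t = 0) \<and> poly (Q x) t \<noteq> 0)"
      using 3 by auto
    moreover have "definable (\<lambda>x. \<exists>t. (\<forall>(P, d)\<in>set Rs. poly (P x) t = 0) \<and> poly (Q x) t \<noteq> 0)"
      by (rule less.hyps) (use less.prems 3 in auto)
    ultimately show ?thesis by simp
  next
    case (4 P d R Rs)
    have "poly_family R 0" using less.prems 4 by simp
    then have "R x = 0" for x by (simp add: poly_family_eq_0_iff)
    then have "(\<lambda>x. \<exists>t. (\<forall>(P, d)\<in>set Ps. poly (P x) t = 0) \<and> poly (Q x) t \<noteq> 0)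
        = (\<lambda>x. \<exists>t. (\<forall>(P, d)\<in>set ((P, Suc d) # Rs). poly (P x) t = 0) \<and> poly (Q x) t \<noteq> 0)"
      using 4 by auto
    moreover have "definable (\<lambda>x. \<exists>t. (\<forall>(P, d)\<in>set ((P, Suc d) # Rs). poly (P x) t = 0) \<and> poly (Q x) t \<noteq> 0)"
      by (rule less.hyps) (use less.prems 4 in auto)
    ultimately show ?thesis by simp
  next
    case (5 P0 d0 R0 e0 Rs)
    \<comment> \<open>The two equations are ordered so that the one with the smaller bound reduces
      the other.\<close>
    obtain P d R e where PR: "poly_family P (Suc d)" "poly_family R (Suc e)" "d \<le> e"
      "d + e = d0 + e0" "set Ps = set ((P, Suc d) # (R, Suc e) # Rs)"
    proof (cases "d0 \<le> e0")
      case True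
      then show ?thesis using that[of P0 d0 R0 e0] less.prems 5 by auto
    next
      case False
      then show ?thesis using that[of R0 e0 P0 d0] less.prems 5 by (auto simp: insert_commute)
    qed
    let ?P = "\<lambda>x. P x - monom (coeff (P x) d) d"
    let ?R = "\<lambda>x. smult (coeff (P x) d) (R x) - smult (coeff (R x) e) (monom 1 (e - d) * P x)"
    have D1: "definable (\<lambda>x. \<exists>t. (\<forall>(P, d)\<in>set ((?P, d) # (R, Suc e) # Rs). poly (P x) t = 0) \<and> poly (Q x) t \<noteq> 0)"
      by (rule less.hyps) (use poly_family_truncate[OF PR(1)] PR less.prems 5 in auto)
    have D2: "definable (\<lambda>x. \<exists>t. (\<forall>(P, d)\<in>set ((P, Suc d) # (?R, e) # Rs). poly (P x) t = 0) \<and> poly (Q x) t \<noteq> 0)"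
      by (rule less.hyps) (use poly_family_step[OF PR(1-3)] PR less.prems 5 in auto)
    have eq: "(\<exists>t. (\<forall>(P, d)\<in>set Ps. poly (P x) t = 0) \<and> poly (Q x) t \<noteq> 0) \<longleftrightarrow>
       (coeff (P x) d = 0 \<and> (\<exists>t. (\<forall>(P, d)\<in>set ((?P, d) # (R, Suc e) # Rs). poly (P x) t = 0) \<and> poly (Q x) t \<noteq> 0)) \<or>
       (coeff (P x) d \<noteq> 0 \<and> (\<exists>t. (\<forall>(P, d)\<in>set ((P, Suc d) # (?R, e) # Rs). poly (P x) t = 0) \<and> poly (Q x) t \<noteq> 0))" for x
    proof (cases "coeff (P x) d = 0")
      case True
      then show ?thesis unfolding PR(5) by simp
    next
      case False
      have "poly (P x) t = 0 \<Longrightarrow> poly (R x) t = 0 \<longleftrightarrow> poly (?R x) t = 0" for t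
        using False by simp
      then have "(\<forall>(P, d)\<in>set Ps. poly (P x) t = 0) \<longleftrightarrow>
         (\<forall>(P, d)\<in>set ((P, Suc d) # (?R, e) # Rs). poly (P x) t = 0)" for t
        unfolding PR(5) by (simp only: list.set ball_simps prod.case) blast
      then show ?thesis using False by simp
    qed
    show ?thesis
      unfolding eq
      by (rule definable_disj[OF definable.conj[OF definable.zero D1] definable.conj[OF definable.neg[OF definable.zero] D2]])
         (rule poly_family_coeff[OF PR(1)])+
  qed
qed

text \<open>One inequation per clause is enough, since finitely many of them merge into their
  product.\<close>

type_synonym 'i clause = "(('i \<Rightarrow> complex) \<Rightarrow> complex) list \<times> (('i \<Rightarrow> complex) \<Rightarrow> complex)"

definition sat :: "'i clause \<Rightarrow> ('i \<Rightarrow> complex) \<Rightarrow> bool" where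
  "sat c x \<longleftrightarrow> (\<forall>p\<in>set (fst c). p x = 0) \<and> snd c x \<noteq> 0"

definition dnf :: "'i clause list \<Rightarrow> ('i \<Rightarrow> complex) \<Rightarrow> bool" where
  "dnf L x \<longleftrightarrow> (\<exists>c\<in>set L. sat c x)"

definition dnf_ok :: "'i clause list \<Rightarrow> bool" where
  "dnf_ok L \<longleftrightarrow> (\<forall>c\<in>set L. set (fst c) \<subseteq> polyfun_on UNIV \<and> snd c \<in> polyfun_on UNIV)"

definition clause_conj :: "'i clause \<Rightarrow> 'i clause \<Rightarrow> 'i clause" where
  "clause_conj c d = (fst c @ fst d, \<lambda>x. snd c x * snd d x)"

lemma sat_conj: "sat (clause_conj c d) x \<longleftrightarrow> sat c x \<and> sat d x"
proof -
  have 1: "set (fst (clause_conj c d)) = set (fst c) \<union> set (fst d)" by (simp add: clause_conj_def)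
  have 2: "snd (clause_conj c d) x = snd c x * snd d x" by (simp add: clause_conj_def)
  have "sat (clause_conj c d) x \<longleftrightarrow> (\<forall>p\<in>set (fst (clause_conj c d)). p x = 0) \<and> snd (clause_conj c d) x \<noteq> 0"
    by (rule sat_def)
  also have "\<dots> \<longleftrightarrow> (\<forall>p\<in>set (fst c) \<union> set (fst d). p x = 0) \<and> snd c x * snd d x \<noteq> 0"
    by (subst 1, subst 2, rule refl)
  also have "\<dots> \<longleftrightarrow> ((\<forall>p\<in>set (fst c). p x = 0) \<and> (\<forall>p\<in>set (fst d). p x = 0)) \<and> (snd c x \<noteq> 0 \<and> snd d x \<noteq> 0)"
    by (subst ball_Un) (subst mult_eq_0_iff, subst de_Morgan_disj, rule refl)
  also have "\<dots> \<longleftrightarrow> sat c x \<and> sat d x"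
    by (subst (1 2) sat_def) (rule iffI; elim conjE; intro conjI; assumption)
  finally show ?thesis .
qed

lemma dnf_conj:
  assumes "dnf_ok L" "dnf_ok L'"
  shows "\<exists>L''. dnf_ok L'' \<and> (\<forall>x. dnf L'' x \<longleftrightarrow> dnf L x \<and> dnf L' x)"
proof -
  let ?L = "map (\<lambda>(c, d). clause_conj c d) (List.product L L')"
  have "set (fst (clause_conj c d)) \<subseteq> polyfun_on UNIV \<and> snd (clause_conj c d) \<in> polyfun_on UNIV"
    if "c \<in> set L" "d \<in> set L'" for c d
    using assms that unfolding dnf_ok_def clause_conj_def by (auto intro: polyfun_on.mult)
  then have "dnf_ok ?L" unfolding dnf_ok_def by auto
  moreover have "dnf ?L x \<longleftrightarrow> dnf L x \<and> dnf L' x" for x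
    unfolding dnf_def by (auto simp: sat_conj)
  ultimately show ?thesis by blast
qed

lemma dnf_neg:
  assumes "dnf_ok L"
  shows "\<exists>L'. dnf_ok L' \<and> (\<forall>x. dnf L' x \<longleftrightarrow> \<not> dnf L x)"
  using assms
proof (induction L)
  case Nil
  show ?case
    by (intro exI[of _ "[([], \<lambda>_. 1)]"]) (auto simp: dnf_def sat_def dnf_ok_def intro: polyfun_on.const)
next
  case (Cons c L)
  obtain Ps Q where c: "c = (Ps, Q)" by fastforce
  from Cons obtain L' where L': "dnf_ok L'" "\<And>x. dnf L' x \<longleftrightarrow> \<not> dnf L x"
    by (auto simp: dnf_ok_def)
  let ?C = "([Q], \<lambda>_. 1) # map (\<lambda>p. ([], p)) Ps"
  have "dnf_ok ?C" using Cons.prems c by (auto simp: dnf_ok_def intro: polyfun_on.const)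
  then obtain L'' where "dnf_ok L''" "\<forall>x. dnf L'' x \<longleftrightarrow> dnf ?C x \<and> dnf L' x"
    using dnf_conj L'(1) by blast
  moreover have "dnf ?C x \<and> dnf L' x \<longleftrightarrow> \<not> dnf (c # L) x" for x
    unfolding L'(2) by (auto simp: dnf_def sat_def c)
  ultimately show ?case by blast
qed

lemma definable_imp_dnf: "definable P \<Longrightarrow> \<exists>L. dnf_ok L \<and> (\<forall>x. P x \<longleftrightarrow> dnf L x)"
proof (induction rule: definable.induct)
  case (zero f)
  then show ?case
    by (intro exI[of _ "[([f], \<lambda>_. 1)]"]) (auto simp: dnf_def sat_def dnf_ok_def intro: polyfun_on.const)
next
  case (neg P)
  then show ?case using dnf_neg by metis
next
  case (conj P Q)
  then show ?case using dnf_conj by metis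
qed

text \<open>A disjunctive normal form moves the quantifier to single clauses, and a clause is a
  system in the one variable \<open>x i\<close> as treated by
  \<open>definable_ex_root\<close>.\<close>

theorem definable_ex:
  assumes "definable P"
  shows "definable (\<lambda>x. \<exists>t. P (x(i := t)))"
proof -
  obtain L where L: "dnf_ok L" "\<And>x. P x \<longleftrightarrow> dnf L x" using definable_imp_dnf[OF assms] by blast
  have fam: "\<exists>F d. poly_family F d \<and> (\<forall>x t. f (x(i := t)) = poly (F x) t)" if f: "f \<in> polyfun_on UNIV" for f
  proof -
    obtain F d where F: "\<forall>x. degree (F x) \<le> d" "\<forall>j. (\<lambda>x. coeff (F x) j) \<in> polyfun_on (UNIV - {i})"
      "\<forall>x t. f (x(i := t)) = poly (F x) t" using polyfun_as_poly[OF f, of i] by blast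
    have "poly_family F (Suc d)"
      unfolding poly_family_def
    proof (intro conjI allI impI)
      fix x j assume "Suc d \<le> j"
      then show "coeff (F x) j = 0" using F(1)[rule_format, of x] by (intro coeff_eq_0) simp
    next
      fix j show "(\<lambda>x. coeff (F x) j) \<in> polyfun_on UNIV" using F(2) polyfun_on_mono by blast
    qed
    then show ?thesis using F(3) by blast
  qed
  have clause: "definable (\<lambda>x. \<exists>t. (\<forall>p\<in>set Ps. p (x(i := t)) = 0) \<and> Q (x(i := t)) \<noteq> 0)"
    if ok: "set Ps \<subseteq> polyfun_on UNIV" "Q \<in> polyfun_on UNIV" for Ps Q
  proof -
    obtain F d where F: "\<And>f. f \<in> polyfun_on UNIV \<Longrightarrow> poly_family (F f) (d f) \<and> (\<forall>x t. f (x(i := t)) = poly (F f x) t)"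
    proof -
      from fam have "\<forall>f. \<exists>p. f \<in> polyfun_on UNIV \<longrightarrow> poly_family (fst p) (snd p) \<and> (\<forall>x t. f (x(i := t)) = poly (fst p x) t)"
        by (metis fst_conv snd_conv)
      from choice[OF this] obtain p where p: "\<forall>f. f \<in> polyfun_on UNIV \<longrightarrow> poly_family (fst (p f)) (snd (p f)) \<and> (\<forall>x t. f (x(i := t)) = poly (fst (p f) x) t)"
        by blast
      show thesis by (rule that[of "\<lambda>f. fst (p f)" "\<lambda>f. snd (p f)"]) (use p in blast)
    qed
    have "definable (\<lambda>x. \<exists>t. (\<forall>(P, d)\<in>set (map (\<lambda>p. (F p, d p)) Ps). poly (P x) t = 0) \<and> poly (F Q x) t \<noteq> 0)"
      by (rule definable_ex_root) (use F ok in auto)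
    moreover have "(\<forall>(P, d)\<in>set (map (\<lambda>p. (F p, d p)) Ps). poly (P x) t = 0) \<and> poly (F Q x) t \<noteq> 0 \<longleftrightarrow>
        (\<forall>p\<in>set Ps. p (x(i := t)) = 0) \<and> Q (x(i := t)) \<noteq> 0" for x t
      using F ok by (auto simp del: fun_upd_apply simp: subset_iff)
    ultimately show ?thesis by (simp del: fun_upd_apply)
  qed
  have "(\<exists>t. P (x(i := t))) \<longleftrightarrow> (\<exists>c\<in>set L. \<exists>t. (\<forall>p\<in>set (fst c). p (x(i := t)) = 0) \<and> snd c (x(i := t)) \<noteq> 0)" for x
    unfolding L(2) dnf_def sat_def by blast
  moreover have "definable (\<lambda>x. \<exists>c\<in>set L. \<exists>t. (\<forall>p\<in>set (fst c). p (x(i := t)) = 0) \<and> snd c (x(i := t)) \<noteq> 0)"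
    by (intro definable_bex clause) (use L(1) in \<open>fastforce simp: dnf_ok_def\<close>)+
  ultimately show ?thesis by (simp del: fun_upd_apply)
qed

lemma definable_ex_finite:
  assumes "definable P" "finite A"
  shows "definable (\<lambda>x. \<exists>y. P (\<lambda>i. if i \<in> A then y i else x i))"
  using assms(2)
proof (induction A rule: finite_induct)
  case empty
  then show ?case using assms by simp
next
  case (insert a A)
  have "(\<exists>y. P (\<lambda>i. if i \<in> insert a A then y i else x i)) \<longleftrightarrow>
     (\<exists>t y. P (\<lambda>i. if i \<in> A then y i else (x(a := t)) i))" for x
  proof
    assume "\<exists>y. P (\<lambda>i. if i \<in> insert a A then y i else x i)"
    then obtain y where y: "P (\<lambda>i. if i \<in> insert a A then y i else x i)" by blast
    have "(\<lambda>i. if i \<in> insert a A then y i else x i) = (\<lambda>i. if i \<in> A then y i else (x(a := y a)) i)"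
      using insert by auto
    then show "\<exists>t y. P (\<lambda>i. if i \<in> A then y i else (x(a := t)) i)" using y by metis
  next
    assume "\<exists>t y. P (\<lambda>i. if i \<in> A then y i else (x(a := t)) i)"
    then obtain t y where y: "P (\<lambda>i. if i \<in> A then y i else (x(a := t)) i)" by blast
    have "(\<lambda>i. if i \<in> A then y i else (x(a := t)) i) = (\<lambda>i. if i \<in> insert a A then (y(a := t)) i else x i)"
      using insert by auto
    then show "\<exists>y. P (\<lambda>i. if i \<in> insert a A then y i else x i)" using y by metis
  qed
  then show ?case using definable_ex[OF insert.IH, of a] by (simp del: fun_upd_apply)
qed

text \<open>Strong minimality of the complex field: on a line an equation holds everywhere or at
  finitely many points, and Boolean combinations keep this alternative.\<close>

lemma definable_line_finite_or_cofinite: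
  assumes "definable P"
  shows "finite {t. P (x(i := t))} \<or> finite {t. \<not> P (x(i := t))}"
  using assms
proof (induction rule: definable.induct)
  case (zero f)
  obtain F where F: "\<And>t. f (x(i := t)) = poly F t"
    using polyfun_as_poly[OF zero, of i] by blast
  show ?case
  proof (cases "F = 0")
    case True
    then show ?thesis by (simp add: F del: fun_upd_apply)
  next
    case False
    then show ?thesis using poly_roots_finite[OF False] by (simp add: F del: fun_upd_apply)
  qed
next
  case (conj P Q)
  have "{t. P (x(i := t)) \<and> Q (x(i := t))} = {t. P (x(i := t))} \<inter> {t. Q (x(i := t))}"
    "{t. \<not> (P (x(i := t)) \<and> Q (x(i := t)))} = {t. \<not> P (x(i := t))} \<union> {t. \<not> Q (x(i := t))}" by auto
  then show ?case using conj.IH by (metis finite_Int finite_UnI)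
next
  case (neg P)
  then show ?case by (simp only: not_not) (erule disj_commute[THEN iffD1])
qed

text \<open>On the line through \<open>a\<close> and \<open>b\<close> both functions restrict to
  nonzero univariate polynomials, whose product is nonzero.\<close>

lemma polyfun_eq_0_or_mult:
  assumes "f \<in> polyfun_on UNIV" "g \<in> polyfun_on UNIV" "f a \<noteq> 0" "g b \<noteq> 0"
  shows "\<exists>x. f x \<noteq> 0 \<and> g x \<noteq> 0"
proof -
  let ?l = "\<lambda>s :: unit \<Rightarrow> complex. \<lambda>i. a i + s () * (b i - a i)"
  have l: "(\<lambda>s. ?l s i) \<in> polyfun_on UNIV" for i by (intro polyfun_intros) auto
  obtain F where F: "\<And>t. f (?l ((\<lambda>_. 0)(() := t))) = poly F t"
    using polyfun_as_poly[OF polyfun_on_subst[OF assms(1), of ?l UNIV, OF l], of "()"] by blast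
  obtain G where G: "\<And>t. g (?l ((\<lambda>_. 0)(() := t))) = poly G t"
    using polyfun_as_poly[OF polyfun_on_subst[OF assms(2), of ?l UNIV, OF l], of "()"] by blast
  have "poly F 0 \<noteq> 0" "poly G 1 \<noteq> 0"
    using assms(3,4) F[of 0] G[of 1] by auto
  then have "F * G \<noteq> 0" by auto
  then obtain t where "poly (F * G) t \<noteq> 0" using poly_all_0_iff_0 by blast
  then show ?thesis using F G by (metis mult_eq_0_iff poly_mult)
qed

text \<open>An equation holds identically or fails off its own zero set; for a conjunction the
  product of the two exceptional functions is still not identically zero.\<close>

theorem definable_generic:
  assumes "definable P"
  shows "\<exists>f a. f \<in> polyfun_on UNIV \<and> f a \<noteq> 0 \<and> ((\<forall>x. f x \<noteq> 0 \<longrightarrow> P x) \<or> (\<forall>x. f x \<noteq> 0 \<longrightarrow> \<not> P x))"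
  using assms
proof (induction rule: definable.induct)
  case (zero f)
  show ?case
  proof (cases "\<exists>a. f a \<noteq> 0")
    case True
    then show ?thesis using zero by blast
  next
    case False
    then show ?thesis using polyfun_on.const[of 1] by (intro exI[of _ "\<lambda>_. 1"]) auto
  qed
next
  case (neg P)
  then show ?case by metis
next
  case (conj P Q)
  from conj.IH(1) obtain f a where 1: "f \<in> polyfun_on UNIV" "f a \<noteq> 0"
     "(\<forall>x. f x \<noteq> 0 \<longrightarrow> P x) \<or> (\<forall>x. f x \<noteq> 0 \<longrightarrow> \<not> P x)" by blast
  from conj.IH(2) obtain g b where 2: "g \<in> polyfun_on UNIV" "g b \<noteq> 0"
     "(\<forall>x. g x \<noteq> 0 \<longrightarrow> Q x) \<or> (\<forall>x. g x \<noteq> 0 \<longrightarrow> \<not> Q x)" by blast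
  note * = 1 2
  obtain c where "f c \<noteq> 0" "g c \<noteq> 0" using polyfun_eq_0_or_mult *(1,2,4,5) by blast
  then show ?case
    using * by (intro exI[of _ "\<lambda>x. f x * g x"] exI[of _ c]) (auto intro: polyfun_on.mult)
qed

section \<open>Derivatives of homogeneous polynomials\<close>

lemma polyfun_on_eval_poly:
  assumes "\<And>j. (\<lambda>x. w x $ j) \<in> polyfun_on A"
  shows "(\<lambda>x. eval_poly f (w x)) \<in> polyfun_on A"
  unfolding eval_poly_def eval_monom_def by (intro polyfun_intros assms)

lemma const_in_range_eval_poly: "(\<lambda>v. c) \<in> range eval_poly"
proof -
  have "eval_poly (Poly_Mapping.single 0 c) = (\<lambda>v :: complex ^ 'a. c)"
    by (auto simp: eval_poly_single eval_monom_def)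
  then show ?thesis by (metis rangeI)
qed

lemma coord_in_range_eval_poly: "(\<lambda>v. v $ i) \<in> range eval_poly"
proof -
  have "(\<Prod>j\<in>UNIV. v $ j ^ Poly_Mapping.lookup (Poly_Mapping.single i 1) j) = v $ i" for v :: "complex ^ 'a"
    by (subst prod.remove[of _ i]) (auto simp: lookup_single intro!: prod.neutral)
  then have "eval_poly (Poly_Mapping.single (Poly_Mapping.single i 1) 1) = (\<lambda>v :: complex ^ 'a. v $ i)"
    by (auto simp: eval_poly_single eval_monom_def)
  then show ?thesis by (metis rangeI)
qed

lemma add_in_range_eval_poly:
  assumes "f \<in> range eval_poly" "g \<in> range eval_poly"
  shows "(\<lambda>v. f v + g v) \<in> range eval_poly"
proof -
  obtain F G where "f = eval_poly F" "g = eval_poly G" using assms by blast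
  then have "(\<lambda>v. f v + g v) = eval_poly (F + G)" by (auto simp: eval_poly_add)
  then show ?thesis by blast
qed

lemma mult_in_range_eval_poly:
  assumes "f \<in> range eval_poly" "g \<in> range eval_poly"
  shows "(\<lambda>v. f v * g v) \<in> range eval_poly"
proof -
  obtain F G where "f = eval_poly F" "g = eval_poly G" using assms by blast
  then have "(\<lambda>v. f v * g v) = eval_poly (F * G)" by (auto simp: eval_poly_mult)
  then show ?thesis by blast
qed

lemma polyfun_in_range_eval_poly:
  assumes "f \<in> polyfun_on A" "\<And>i. (\<lambda>v. s v i) \<in> range eval_poly"
  shows "(\<lambda>v. f (s v)) \<in> range eval_poly"
  using assms
  by (induction rule: polyfun_on.induct)
     (auto intro: const_in_range_eval_poly add_in_range_eval_poly mult_in_range_eval_poly)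

text \<open>The degree is explicit because the scaling and Euler formulas contain it; the zero
  polynomial has every degree.\<close>

definition hom_deg :: "'a::finite cpoly \<Rightarrow> nat \<Rightarrow> bool" where
  "hom_deg f d \<longleftrightarrow> (\<forall>m\<in>Poly_Mapping.keys f. (\<Sum>i\<in>UNIV. Poly_Mapping.lookup m i) = d)"

lemma homogeneous_iff_hom_deg: "homogeneous f \<longleftrightarrow> (\<exists>d. hom_deg f d)"
  by (simp add: homogeneous_def hom_deg_def)

lemma hom_deg_scale: "hom_deg f d \<Longrightarrow> eval_poly f (c *s v) = c ^ d * eval_poly f v"
  by (rule eval_poly_scale) (simp add: hom_deg_def)

definition hom_component :: "nat \<Rightarrow> 'a::finite cpoly \<Rightarrow> 'a cpoly" where
  "hom_component d f = (\<Sum>m\<in>{m\<in>Poly_Mapping.keys f. (\<Sum>i\<in>UNIV. Poly_Mapping.lookup m i) = d}.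
     Poly_Mapping.single m (Poly_Mapping.lookup f m))"

lemma keys_sum_single:
  assumes "finite A"
  shows "Poly_Mapping.keys (\<Sum>m\<in>A. Poly_Mapping.single (h m) (c m)) \<subseteq> {h m |m. m \<in> A \<and> c m \<noteq> 0}"
  using assms
proof (induction A rule: finite_induct)
  case (insert a A)
  then show ?case
    using Poly_Mapping.keys_add[of "Poly_Mapping.single (h a) (c a)" "\<Sum>m\<in>A. Poly_Mapping.single (h m) (c m)"]
    by (auto split: if_splits)
qed simp

lemma hom_deg_component: "hom_deg (hom_component d f) d"
  unfolding hom_deg_def hom_component_def
  using keys_sum_single[of "{m\<in>Poly_Mapping.keys f. (\<Sum>i\<in>UNIV. Poly_Mapping.lookup m i) = d}" "\<lambda>m. m"]
  by fastforce

lemma eval_poly_scale_components: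
  "\<exists>N. \<forall>c v. eval_poly f (c *s v) = (\<Sum>d<N. c ^ d * eval_poly (hom_component d f) v)"
proof -
  let ?deg = "\<lambda>m. \<Sum>i\<in>UNIV. Poly_Mapping.lookup m i"
  obtain N where N: "\<And>m. m \<in> Poly_Mapping.keys f \<Longrightarrow> ?deg m < N"
    using finite_nat_set_iff_bounded[of "?deg ` Poly_Mapping.keys f"] by auto
  have "eval_poly f (c *s v) = (\<Sum>d<N. c ^ d * eval_poly (hom_component d f) v)" for c v
  proof -
    have "f = (\<Sum>m\<in>Poly_Mapping.keys f. Poly_Mapping.single m (Poly_Mapping.lookup f m))"
      by (rule poly_sum_singles)
    also have "\<dots> = (\<Sum>d<N. hom_component d f)"
      unfolding hom_component_def
      by (subst sum.group) (use N in auto)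
    finally have "eval_poly f (c *s v) = eval_poly (\<Sum>d<N. hom_component d f) (c *s v)" by simp
    also have "\<dots> = (\<Sum>d<N. c ^ d * eval_poly (hom_component d f) v)"
      by (simp add: eval_poly_sum hom_deg_scale[OF hom_deg_component])
    finally show ?thesis .
  qed
  then show ?thesis by blast
qed

lemma partial_superset:
  assumes "finite A" "Poly_Mapping.keys f \<subseteq> A"
  shows "partial i f = (\<Sum>m\<in>A. Poly_Mapping.single (m - Poly_Mapping.single i 1)
       (of_nat (Poly_Mapping.lookup m i) * Poly_Mapping.lookup f m))"
  unfolding partial_def
  by (rule sum.mono_neutral_left) (use assms in \<open>auto simp: in_keys_iff\<close>)

lemma partial_add: "partial i (f + g) = partial i f + partial i g"
proof -
  let ?A = "Poly_Mapping.keys f \<union> Poly_Mapping.keys g"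
  have "Poly_Mapping.keys (f + g) \<subseteq> ?A" by (rule Poly_Mapping.keys_add)
  then show ?thesis
    by (simp add: partial_superset[of ?A] lookup_add distrib_left single_add sum.distrib)
qed

lemma partial_sum: "partial i (sum F A) = (\<Sum>a\<in>A. partial i (F a))"
  by (induction A rule: infinite_finite_induct) (auto simp: partial_add, auto simp: partial_def)

lemma partial_single:
  "partial i (Poly_Mapping.single m c) =
     Poly_Mapping.single (m - Poly_Mapping.single i 1) (of_nat (Poly_Mapping.lookup m i) * c)"
  by (cases "c = 0") (auto simp: partial_def)

lemma partial_commute: "partial i (partial j f) = partial j (partial i f)"
proof (cases "i = j")
  case False
  have "partial i (partial j (Poly_Mapping.single m c)) = partial j (partial i (Poly_Mapping.single m c))"
    for m and c :: complex
    using False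
    by (simp add: partial_single lookup_minus lookup_single diff_diff_add add.commute mult_ac)
  then have "partial i (partial j (\<Sum>m\<in>A. Poly_Mapping.single m (c m)))
      = partial j (partial i (\<Sum>m\<in>A. Poly_Mapping.single m (c m)))" for A and c :: "_ \<Rightarrow> complex"
    by (simp add: partial_sum)
  then show ?thesis using poly_sum_singles[of f] by metis
qed simp

definition D1 :: "'a::finite cpoly \<Rightarrow> complex ^ 'a \<Rightarrow> complex ^ 'a \<Rightarrow> complex" where
  "D1 f v w = (\<Sum>i\<in>UNIV. eval_poly (partial i f) v * w $ i)"

text \<open>The Hessian as a bilinear form. On tangent vectors of a cone, the Hessians of its
  equations form the second fundamental form.\<close>

definition D2 :: "'a::finite cpoly \<Rightarrow> complex ^ 'a \<Rightarrow> complex ^ 'a \<Rightarrow> complex ^ 'a \<Rightarrow> complex" where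
  "D2 f v u w = (\<Sum>i\<in>UNIV. D1 (partial i f) v u * w $ i)"

lemma D1_add: "D1 f v (w + w') = D1 f v w + D1 f v w'"
  by (simp add: D1_def distrib_left sum.distrib)

lemma D1_scale: "D1 f v (c *s w) = c * D1 f v w"
  by (simp add: D1_def sum_distrib_left mult_ac)

lemma D1_diff: "D1 f v (w - w') = D1 f v w - D1 f v w'"
  by (simp add: D1_def right_diff_distrib sum_subtractf)

lemma D1_0 [simp]: "D1 f v 0 = 0"
  by (simp add: D1_def)

lemma D2_sym: "D2 f v u w = D2 f v w u"
  unfolding D2_def D1_def sum_distrib_right
  by (subst sum.swap) (simp add: partial_commute mult_ac)

lemma D2_add_right: "D2 f v u (w + w') = D2 f v u w + D2 f v u w'"
  by (simp add: D2_def distrib_left sum.distrib)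

lemma D2_scale_right: "D2 f v u (c *s w) = c * D2 f v u w"
  by (simp add: D2_def sum_distrib_left mult_ac)

lemma D2_add_left: "D2 f v (u + u') w = D2 f v u w + D2 f v u' w"
  by (simp add: D2_sym[of _ _ _ w] D2_add_right)

lemma D2_scale_left: "D2 f v (c *s u) w = c * D2 f v u w"
  by (simp add: D2_sym[of _ _ _ w] D2_scale_right)

lemma has_derivative_eval_monom:
  "(eval_monom m has_derivative
     (\<lambda>w. \<Sum>i\<in>UNIV. of_nat (Poly_Mapping.lookup m i) * eval_monom (m - Poly_Mapping.single i 1) v * w $ i)) (at v)"
proof -
  let ?m = "Poly_Mapping.lookup m"
  have 1: "((\<lambda>v. v $ i ^ ?m i) has_derivative (\<lambda>w. of_nat (?m i) * w $ i * v $ i ^ (?m i - 1))) (at v)" for i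
    by (rule has_derivative_power) (rule bounded_linear_imp_has_derivative, rule bounded_linear_vec_nth)
  have 2: "(eval_monom m has_derivative
     (\<lambda>w. \<Sum>i\<in>UNIV. of_nat (?m i) * w $ i * v $ i ^ (?m i - 1) * (\<Prod>j\<in>UNIV - {i}. v $ j ^ ?m j))) (at v)"
    unfolding eval_monom_def[abs_def] by (rule has_derivative_prod) (rule 1)
  have 3: "of_nat (?m i) * w $ i * v $ i ^ (?m i - 1) * (\<Prod>j\<in>UNIV - {i}. v $ j ^ ?m j)
      = of_nat (?m i) * eval_monom (m - Poly_Mapping.single i 1) v * w $ i" for w i
  proof -
    have "eval_monom (m - Poly_Mapping.single i 1) v = v $ i ^ (?m i - 1) * (\<Prod>j\<in>UNIV - {i}. v $ j ^ ?m j)"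
      unfolding eval_monom_def
      by (subst prod.remove[of _ i]) (auto simp: lookup_minus lookup_single intro!: prod.cong)
    then show ?thesis by simp
  qed
  from 2 show ?thesis unfolding 3 .
qed

lemma eval_poly_partial:
  "eval_poly (partial i f) v = (\<Sum>m\<in>Poly_Mapping.keys f.
     of_nat (Poly_Mapping.lookup m i) * Poly_Mapping.lookup f m * eval_monom (m - Poly_Mapping.single i 1) v)"
  unfolding partial_def by (simp add: eval_poly_sum eval_poly_single)

lemma has_derivative_eval_poly: "(eval_poly f has_derivative D1 f v) (at v)"
proof -
  have "(eval_poly f has_derivative (\<lambda>w. \<Sum>m\<in>Poly_Mapping.keys f. Poly_Mapping.lookup f m *
     (\<Sum>i\<in>UNIV. of_nat (Poly_Mapping.lookup m i) * eval_monom (m - Poly_Mapping.single i 1) v * w $ i))) (at v)"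
    unfolding eval_poly_def[abs_def]
    by (rule has_derivative_sum, rule has_derivative_mult_right, rule has_derivative_eval_monom)
  moreover have "(\<Sum>m\<in>Poly_Mapping.keys f. Poly_Mapping.lookup f m *
     (\<Sum>i\<in>UNIV. of_nat (Poly_Mapping.lookup m i) * eval_monom (m - Poly_Mapping.single i 1) v * w $ i)) = D1 f v w" for w
    unfolding D1_def eval_poly_partial sum_distrib_right sum_distrib_left
    by (subst sum.swap) (simp add: mult_ac)
  ultimately show ?thesis by simp
qed

lemma continuous_on_eval_poly [continuous_intros]:
  "continuous_on S g \<Longrightarrow> continuous_on S (\<lambda>x. eval_poly f (g x))"
  unfolding eval_poly_def eval_monom_def by (intro continuous_intros)

lemma euler_monom:
  "of_nat (Poly_Mapping.lookup m i) * eval_monom (m - Poly_Mapping.single i 1) v * v $ i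
     = of_nat (Poly_Mapping.lookup m i) * eval_monom m v"
proof (cases "Poly_Mapping.lookup m i = 0")
  case False
  have "eval_monom (m - Poly_Mapping.single i 1) v * v $ i = eval_monom m v"
    unfolding eval_monom_def using False
    by (subst (1 2) prod.remove[of _ i])
       (auto simp: lookup_minus lookup_single power_eq_if mult_ac intro!: prod.cong)
  then show ?thesis by (simp add: mult.assoc)
qed simp

lemma euler:
  assumes "hom_deg f d"
  shows "D1 f v v = of_nat d * eval_poly f v"
proof -
  have "D1 f v v = (\<Sum>i\<in>UNIV. \<Sum>m\<in>Poly_Mapping.keys f. Poly_Mapping.lookup f m *
      (of_nat (Poly_Mapping.lookup m i) * eval_monom (m - Poly_Mapping.single i 1) v * v $ i))"
    unfolding D1_def eval_poly_partial sum_distrib_right by (simp add: mult_ac)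
  also have "\<dots> = (\<Sum>m\<in>Poly_Mapping.keys f. \<Sum>i\<in>UNIV. Poly_Mapping.lookup f m * (of_nat (Poly_Mapping.lookup m i) * eval_monom m v))"
    unfolding euler_monom by (rule sum.swap)
  also have "\<dots> = (\<Sum>m\<in>Poly_Mapping.keys f. Poly_Mapping.lookup f m * eval_monom m v * of_nat (\<Sum>i\<in>UNIV. Poly_Mapping.lookup m i))"
    by (simp add: sum_distrib_left mult_ac)
  also have "\<dots> = (\<Sum>m\<in>Poly_Mapping.keys f. Poly_Mapping.lookup f m * eval_monom m v * of_nat d)"
    using assms unfolding hom_deg_def by (intro sum.cong) auto
  finally show ?thesis by (simp add: eval_poly_def sum_distrib_left mult_ac)
qed

lemma hom_deg_partial:
  assumes "hom_deg f d"
  shows "hom_deg (partial i f) (d - 1)"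
  unfolding hom_deg_def
proof
  fix k assume "k \<in> Poly_Mapping.keys (partial i f)"
  then obtain m where m: "m \<in> Poly_Mapping.keys f" "Poly_Mapping.lookup m i \<noteq> 0"
    "k = m - Poly_Mapping.single i 1"
    unfolding partial_def
    using keys_sum_single[of "Poly_Mapping.keys f" "\<lambda>m. m - Poly_Mapping.single i 1"
        "\<lambda>m. of_nat (Poly_Mapping.lookup m i) * Poly_Mapping.lookup f m"] by auto
  have "(\<Sum>j\<in>UNIV. Poly_Mapping.lookup m j) = d" using assms m(1) by (simp add: hom_deg_def)
  moreover have "(\<Sum>j\<in>UNIV. Poly_Mapping.lookup m j) = Poly_Mapping.lookup m i + (\<Sum>j\<in>UNIV - {i}. Poly_Mapping.lookup m j)"
    by (rule sum.remove) auto
  moreover have "(\<Sum>j\<in>UNIV. Poly_Mapping.lookup k j) = Poly_Mapping.lookup m i - 1 + (\<Sum>j\<in>UNIV - {i}. Poly_Mapping.lookup m j)"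
    unfolding m(3) by (subst sum.remove[of _ i]) (auto simp: lookup_minus lookup_single intro!: sum.cong)
  ultimately show "(\<Sum>j\<in>UNIV. Poly_Mapping.lookup k j) = d - 1" using m(2) by simp
qed

lemma D1_hom_scale: "hom_deg f d \<Longrightarrow> D1 f (c *s v) w = c ^ (d - 1) * D1 f v w"
  unfolding D1_def by (simp add: hom_deg_scale[OF hom_deg_partial] sum_distrib_left mult_ac)

text \<open>Euler's formula for the partial derivatives. It makes the radial direction
  \<open>v\<close> invisible to the Hessian paired with vectors \<open>u\<close> in the kernel of
  the differential.\<close>

lemma D2_euler:
  assumes "hom_deg f d"
  shows "D2 f v u v = of_nat (d - 1) * D1 f v u"
proof -
  have "D2 f v u v = D2 f v v u" by (rule D2_sym)
  also have "\<dots> = of_nat (d - 1) * D1 f v u"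
    unfolding D2_def euler[OF hom_deg_partial[OF assms]] unfolding D1_def
    by (simp add: sum_distrib_left mult.assoc)
  finally show ?thesis .
qed

lemma continuous_on_polyfun:
  assumes "f \<in> polyfun_on A" "\<And>i. continuous_on S (\<lambda>z. s z i)"
  shows "continuous_on S (\<lambda>z. f (s z))"
  using assms by (induction rule: polyfun_on.induct) (auto intro: continuous_intros)

text \<open>The coefficients are jointly continuous in the base point and the direction, so limits
  can be taken along directions that vary with the step.\<close>

lemma eval_poly_line:
  obtains P d where "\<And>v w. degree (P v w) \<le> d"
    "\<And>j. continuous_on UNIV (\<lambda>z. coeff (P (fst z) (snd z)) j)"
    "\<And>v w t. eval_poly f (v + t *s w) = poly (P v w) t"
proof -
  let ?e = "\<lambda>x :: ('a + 'a) option \<Rightarrow> complex. eval_poly f (\<chi> j. x (Some (Inl j)) + x None * x (Some (Inr j)))"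
  have "?e \<in> polyfun_on UNIV"
    by (rule polyfun_on_eval_poly) (auto intro!: polyfun_on.intros)
  from polyfun_as_poly[OF this, of None] obtain P d where
    P: "\<forall>x. degree (P x) \<le> d" "\<forall>j. (\<lambda>x. coeff (P x) j) \<in> polyfun_on (UNIV - {None})"
       "\<forall>x t. ?e (x(None := t)) = poly (P x) t" by blast
  define s where "s v w = (\<lambda>i. case i of None \<Rightarrow> 0 | Some (Inl j) \<Rightarrow> v $ j | Some (Inr j) \<Rightarrow> w $ j)"
    for v w :: "complex ^ 'a"
  show thesis
  proof
    show "degree (P (s v w)) \<le> d" for v w using P(1) by blast
    show "continuous_on UNIV (\<lambda>z. coeff (P (s (fst z) (snd z))) j)" for j
    proof (rule continuous_on_polyfun[of "\<lambda>x. coeff (P x) j" "UNIV - {None}"])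
      show "(\<lambda>x. coeff (P x) j) \<in> polyfun_on (UNIV - {None})" using P(2) by blast
      show "continuous_on UNIV (\<lambda>z. s (fst z) (snd z) i)" for i
        unfolding s_def
      proof (cases i)
        case (Some a)
        then show "continuous_on UNIV (\<lambda>z. case i of None \<Rightarrow> 0 | Some (Inl j) \<Rightarrow> fst z $ j | Some (Inr j) \<Rightarrow> snd z $ j)"
          by (cases a) (auto intro!: continuous_intros)
      qed auto
    qed
    show "eval_poly f (v + t *s w) = poly (P (s v w)) t" for v w t
    proof -
      have "(\<chi> j. v $ j + t * w $ j) = v + t *s w" by (simp add: vec_eq_iff)
      then show ?thesis using P(3)[rule_format, of "s v w" t] by (simp add: s_def)
    qed
  qed
qed

section \<open>The affine cone and its tangent spaces\<close>

definition cone_of :: "'a::finite cpoly set \<Rightarrow> (complex ^ 'a) set" where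
  "cone_of F = {v. \<forall>f\<in>F. eval_poly f v = 0}"

definition tan_of :: "'a::finite cpoly set \<Rightarrow> complex ^ 'a \<Rightarrow> (complex ^ 'a) set" where
  "tan_of F v = {w. \<forall>f\<in>F. D1 f v w = 0}"

definition smooth_of :: "'a::finite cpoly set \<Rightarrow> nat \<Rightarrow> (complex ^ 'a) set" where
  "smooth_of F n = {v. v \<noteq> 0 \<and> v \<in> cone_of F \<and> vec.dim (tan_of F v) = n + 1}"

lemma subspace_tan_of: "vec.subspace (tan_of F v)"
  unfolding tan_of_def by (auto intro!: vec.subspaceI simp: D1_add D1_scale)

lemma tan_of_scale:
  assumes "\<And>f. f \<in> F \<Longrightarrow> homogeneous f" "c \<noteq> 0"
  shows "tan_of F (c *s v) = tan_of F v"
proof -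
  have "D1 f (c *s v) w = 0 \<longleftrightarrow> D1 f v w = 0" if f: "f \<in> F" for f w
  proof -
    obtain d where "hom_deg f d" using assms(1)[OF f] by (auto simp: homogeneous_iff_hom_deg)
    then show ?thesis using assms(2) by (simp add: D1_hom_scale)
  qed
  then show ?thesis by (auto simp: tan_of_def)
qed

lemma cone_of_scale:
  assumes "\<And>f. f \<in> F \<Longrightarrow> homogeneous f" "c \<noteq> 0"
  shows "c *s v \<in> cone_of F \<longleftrightarrow> v \<in> cone_of F"
proof -
  have "eval_poly f (c *s v) = 0 \<longleftrightarrow> eval_poly f v = 0" if f: "f \<in> F" for f
  proof -
    obtain d where "hom_deg f d" using assms(1)[OF f] by (auto simp: homogeneous_iff_hom_deg)
    then show ?thesis using assms(2) by (simp add: hom_deg_scale)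
  qed
  then show ?thesis by (auto simp: cone_of_def)
qed

lemma smooth_of_scale:
  assumes "\<And>f. f \<in> F \<Longrightarrow> homogeneous f" "c \<noteq> 0"
  shows "c *s v \<in> smooth_of F n \<longleftrightarrow> v \<in> smooth_of F n"
  using assms by (simp add: smooth_of_def cone_of_scale tan_of_scale)

lemma self_in_tan_of:
  assumes "\<And>f. f \<in> F \<Longrightarrow> homogeneous f" "v \<in> cone_of F"
  shows "v \<in> tan_of F v"
proof -
  have "D1 f v v = 0" if f: "f \<in> F" for f
  proof -
    obtain d where "hom_deg f d" using assms(1)[OF f] by (auto simp: homogeneous_iff_hom_deg)
    then show ?thesis using assms(2) f by (simp add: euler cone_of_def)
  qed
  then show ?thesis by (simp add: tan_of_def)
qed

text \<open>The basis theorem is applied to the equations and to their differentials together, as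
  functions of a pair \<open>(v, w)\<close>. One finite set \<open>F\<close> then gives both the
  cone and all its tangent cones, although the latter are defined by the full vanishing
  ideal.\<close>

lemma finite_tangent_equations:
  fixes X :: "'a::finite proj set"
  assumes "zariski_closed X"
  obtains F where "finite F" "\<And>f. f \<in> F \<Longrightarrow> homogeneous f"
    "\<And>p v. v \<in> hcoords p \<Longrightarrow> p \<in> X \<longleftrightarrow> v \<in> cone_of F"
    "\<And>p v. p \<in> X \<Longrightarrow> v \<in> hcoords p \<Longrightarrow> tangent_cone X p = tan_of F v"
proof -
  define I where "I = {f \<in> vanishing_ideal X. homogeneous f}"
  define e where "e f = (\<lambda>x :: 'a + 'a \<Rightarrow> complex. eval_poly f (\<chi> j. x (Inl j)))" for f
  define d where "d f = (\<lambda>x :: 'a + 'a \<Rightarrow> complex. D1 f (\<chi> j. x (Inl j)) (\<chi> j. x (Inr j)))" for f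
  have "e f \<in> polyfun_on UNIV" "d f \<in> polyfun_on UNIV" for f
    unfolding e_def d_def D1_def by (auto intro!: polyfun_on_eval_poly polyfun_intros)
  then have "e ` I \<union> d ` I \<subseteq> polyfun_on UNIV" by blast
  from hilbert_basis_zeros[OF finite this] obtain G where G: "finite G" "G \<subseteq> e ` I \<union> d ` I"
    "\<forall>x. (\<forall>g\<in>G. g x = 0) \<longrightarrow> (\<forall>g\<in>e ` I \<union> d ` I. g x = 0)" by blast
  obtain A where A: "finite A" "A \<subseteq> I" "G \<inter> e ` I = e ` A"
    using finite_subset_image[of "G \<inter> e ` I" e I] G(1) by auto
  obtain B where B: "finite B" "B \<subseteq> I" "G \<inter> d ` I = d ` B"
    using finite_subset_image[of "G \<inter> d ` I" d I] G(1) by auto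
  let ?F = "A \<union> B"
  have key: "(\<forall>f\<in>I. eval_poly f v = 0) \<and> (\<forall>f\<in>I. D1 f v w = 0)"
    if vw: "v \<in> cone_of ?F" "w \<in> tan_of ?F v" for v w
  proof -
    define x where "x = (\<lambda>i. case i of Inl j \<Rightarrow> v $ j | Inr j \<Rightarrow> w $ j)"
    have x: "e f x = eval_poly f v" "d f x = D1 f v w" for f
      by (simp_all add: e_def d_def x_def)
    have 1: "g x = 0" if "g \<in> e ` A" for g using that vw(1) x(1) by (auto simp: cone_of_def)
    have 2: "g x = 0" if "g \<in> d ` B" for g using that vw(2) x(2) by (auto simp: tan_of_def)
    have "g x = 0" if "g \<in> G" for g
    proof -
      from that G(2) consider "g \<in> G \<inter> e ` I" | "g \<in> G \<inter> d ` I" by blast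
      then show ?thesis by cases (use 1 2 A(3) B(3) in simp_all)
    qed
    then have 3: "\<forall>g\<in>e ` I \<union> d ` I. g x = 0" by (rule G(3)[THEN spec, THEN mp, OF ballI])
    have "e f x = 0" "d f x = 0" if "f \<in> I" for f
      by (rule bspec[OF 3], use that in blast)+
    then show ?thesis unfolding x by blast
  qed
  \<comment> \<open>Taking \<open>w = 0\<close> makes the tangency hypothesis of \<open>key\<close>
    automatic.\<close>
  have cone: "v \<in> cone_of ?F \<longleftrightarrow> v \<in> cone_of I" for v
  proof
    assume "v \<in> cone_of ?F"
    moreover have "0 \<in> tan_of ?F v" by (simp add: tan_of_def)
    ultimately show "v \<in> cone_of I" using key unfolding cone_of_def by blast
  qed (use A(2) B(2) in \<open>auto simp: cone_of_def\<close>)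
  show thesis
  proof
    show "finite ?F" using A B by simp
    show hom: "homogeneous f" if "f \<in> ?F" for f using that A B I_def by auto
    show X: "p \<in> X \<longleftrightarrow> v \<in> cone_of ?F" if v: "v \<in> hcoords p" for p v
    proof
      assume "p \<in> X"
      then show "v \<in> cone_of ?F" unfolding cone using v by (auto simp: cone_of_def I_def vanishing_ideal_def)
    next
      assume "v \<in> cone_of ?F"
      then have v0: "\<forall>f\<in>I. eval_poly f v = 0" unfolding cone by (simp add: cone_of_def)
      obtain S where S: "\<forall>f\<in>S. homogeneous f" "X = zero_locus S"
        using assms unfolding zariski_closed_def by blast
      have "S \<subseteq> I" using S by (auto simp: I_def vanishing_ideal_def zero_locus_def)
      then have "\<forall>f\<in>S. \<forall>w\<in>hcoords p. eval_poly f w = 0"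
        using v0 S(1) homogeneous_vanish_iff[OF _ v] by blast
      then show "p \<in> X" unfolding S(2) zero_locus_def by blast
    qed
    show "tangent_cone X p = tan_of ?F v" if p: "p \<in> X" and v: "v \<in> hcoords p" for p v
    proof -
      have homI: "\<And>f. f \<in> I \<Longrightarrow> homogeneous f" by (simp add: I_def)
      have "tangent_cone X p = (\<Inter>u\<in>hcoords p. tan_of I u)"
        by (auto simp: tangent_cone_def tan_of_def D1_def I_def)
      also have "\<dots> = tan_of I v"
      proof -
        have "tan_of I u = tan_of I v" if u: "u \<in> hcoords p" for u
        proof -
          obtain c where "c \<noteq> 0" "u = c *s v" using hcoords_scale[OF v u] by blast
          then show ?thesis using tan_of_scale[OF homI] by simp
        qed
        then have "(\<Inter>u\<in>hcoords p. tan_of I u) = (\<Inter>u\<in>hcoords p. tan_of I v)" by (rule INF_cong[OF refl])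
        then show ?thesis using v by blast
      qed
      also have "\<dots> = tan_of ?F v"
      proof
        show "tan_of I v \<subseteq> tan_of ?F v" using A(2) B(2) unfolding tan_of_def by blast
        have "v \<in> cone_of ?F" using X[OF v] p by blast
        then show "tan_of ?F v \<subseteq> tan_of I v" using key unfolding tan_of_def by blast
      qed
      finally show ?thesis .
    qed
  qed
qed

section \<open>Definable conditions on tuples of vectors\<close>

text \<open>Variables are arranged in rows, one row for each vector. Parameters occupy the low rows
  and quantified vectors are placed in fresh higher rows.\<close>

definition slot :: "nat \<Rightarrow> (nat \<times> 'a \<Rightarrow> complex) \<Rightarrow> complex ^ 'a::finite" where
  "slot k x = (\<chi> j. x (k, j))"

lemma slot_nth_polyfun: "(\<lambda>x. slot k x $ j) \<in> polyfun_on UNIV"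
  by (simp add: slot_def polyfun_on.var)

text \<open>The bound vectors are stored in the slots \<open>k\<close> to \<open>k + m - 1\<close>.
  The second hypothesis makes this harmless: \<open>Q\<close> reads only \<open>m\<close> of the
  vectors and only slots below \<open>k\<close>.\<close>

lemma definable_ex_vecs:
  assumes "definable (\<lambda>x. Q (\<lambda>i. slot (k + i) x) x)"
    and Q: "\<And>W W' x x'. (\<And>i. i < m \<Longrightarrow> W i = W' i) \<Longrightarrow> (\<And>l. l < k \<Longrightarrow> slot l x = slot l x') \<Longrightarrow> Q W x \<longleftrightarrow> Q W' x'"
  shows "definable (\<lambda>x. \<exists>W :: nat \<Rightarrow> complex ^ 'a::finite. Q W x)"
proof -
  let ?A = "{k..<k + m} \<times> (UNIV :: 'a set)"
  have "(\<exists>W. Q W x) \<longleftrightarrow> (\<exists>y. Q (\<lambda>i. slot (k + i) (\<lambda>i. if i \<in> ?A then y i else x i)) (\<lambda>i. if i \<in> ?A then y i else x i))"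
    (is "?L \<longleftrightarrow> ?R") for x
  proof
    assume ?L
    then obtain W where W: "Q W x" by blast
    let ?y = "\<lambda>(l, j). W (l - k) $ j"
    have "Q W x \<longleftrightarrow> Q (\<lambda>i. slot (k + i) (\<lambda>i. if i \<in> ?A then ?y i else x i)) (\<lambda>i. if i \<in> ?A then ?y i else x i)"
      by (rule Q) (auto simp: slot_def vec_eq_iff)
    then show ?R using W by blast
  next
    assume ?R
    then obtain y where y: "Q (\<lambda>i. slot (k + i) (\<lambda>i. if i \<in> ?A then y i else x i)) (\<lambda>i. if i \<in> ?A then y i else x i)" by blast
    have "Q (\<lambda>i. slot (k + i) (\<lambda>i. if i \<in> ?A then y i else x i)) (\<lambda>i. if i \<in> ?A then y i else x i) \<longleftrightarrow>
       Q (\<lambda>i. slot (k + i) (\<lambda>i. if i \<in> ?A then y i else x i)) x"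
      by (rule Q) (auto simp: slot_def vec_eq_iff)
    then show ?L using y by blast
  qed
  moreover have "definable (\<lambda>x. \<exists>y. Q (\<lambda>i. slot (k + i) (\<lambda>i. if i \<in> ?A then y i else x i)) (\<lambda>i. if i \<in> ?A then y i else x i))"
    by (rule definable_ex_finite[OF assms(1)]) auto
  ultimately show ?thesis by simp
qed

lemma definable_all_vecs:
  assumes "definable (\<lambda>x. Q (\<lambda>i. slot (k + i) x) x)"
    and Q: "\<And>W W' x x'. (\<And>i. i < m \<Longrightarrow> W i = W' i) \<Longrightarrow> (\<And>l. l < k \<Longrightarrow> slot l x = slot l x') \<Longrightarrow> Q W x \<longleftrightarrow> Q W' x'"
  shows "definable (\<lambda>x. \<forall>W :: nat \<Rightarrow> complex ^ 'a::finite. Q W x)"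
proof -
  have "definable (\<lambda>x. \<exists>W :: nat \<Rightarrow> complex ^ 'a. \<not> Q W x)"
  proof (rule definable_ex_vecs[where k = k and m = m])
    show "\<not> Q W x \<longleftrightarrow> \<not> Q W' x'"
      if "\<And>i. i < m \<Longrightarrow> W i = W' i" "\<And>l. l < k \<Longrightarrow> slot l x = slot l x'" for W W' x x'
      by (subst Q[OF that]) (assumption | rule refl)+
  qed (rule definable.neg[OF assms(1)])
  from definable.neg[OF this] show ?thesis by simp
qed

lemma definable_ex_vec:
  assumes "definable (\<lambda>x. Q (slot k x) x)"
    and Q: "\<And>w x x'. (\<And>l. l < k \<Longrightarrow> slot l x = slot l x') \<Longrightarrow> Q w x \<longleftrightarrow> Q w x'"
  shows "definable (\<lambda>x. \<exists>w :: complex ^ 'a::finite. Q w x)"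
proof -
  have "definable (\<lambda>x. \<exists>W :: nat \<Rightarrow> complex ^ 'a. Q (W 0) x)"
  proof (rule definable_ex_vecs[where k = k and m = 1])
    show "Q (W 0) x \<longleftrightarrow> Q (W' 0) x'"
      if "\<And>i. i < 1 \<Longrightarrow> W i = W' i" "\<And>l. l < k \<Longrightarrow> slot l x = slot l x'"
      for W W' :: "nat \<Rightarrow> complex ^ 'a" and x x'
    proof -
      have "W 0 = W' 0" by (rule that(1)) simp
      then show ?thesis using Q[OF that(2), of "W 0"] by simp
    qed
  qed (use assms(1) in simp)
  moreover have "(\<exists>W :: nat \<Rightarrow> complex ^ 'a. Q (W 0) x) \<longleftrightarrow> (\<exists>w. Q w x)" for x
  proof
    assume "\<exists>w. Q w x"
    then obtain w where "Q w x" by blast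
    then show "\<exists>W :: nat \<Rightarrow> complex ^ 'a. Q (W 0) x" by (intro exI[of _ "\<lambda>_. w"])
  qed blast
  ultimately show ?thesis by simp
qed

lemma definable_all_vec:
  assumes "definable (\<lambda>x. Q (slot k x) x)"
    and Q: "\<And>w x x'. (\<And>l. l < k \<Longrightarrow> slot l x = slot l x') \<Longrightarrow> Q w x \<longleftrightarrow> Q w x'"
  shows "definable (\<lambda>x. \<forall>w :: complex ^ 'a::finite. Q w x)"
proof -
  have "definable (\<lambda>x. \<exists>w :: complex ^ 'a. \<not> Q w x)"
  proof (rule definable_ex_vec[where k = k])
    show "\<not> Q w x \<longleftrightarrow> \<not> Q w x'" if "\<And>l. l < k \<Longrightarrow> slot l x = slot l x'" for w x x'
      by (subst Q[OF that]) (assumption | rule refl)+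
  qed (rule definable.neg[OF assms(1)])
  from definable.neg[OF this] show ?thesis by simp
qed

lemma definable_slot_eq_0: "definable (\<lambda>x. slot k x = (0 :: complex ^ 'a::finite))"
proof -
  have "definable (\<lambda>x. \<forall>j\<in>UNIV. (slot k x :: complex ^ 'a) $ j = 0)"
    by (intro definable_ball definable.zero slot_nth_polyfun) auto
  then show ?thesis by (simp add: vec_eq_iff)
qed

lemma definable_cone_of: "finite F \<Longrightarrow> definable (\<lambda>x. slot k x \<in> cone_of F)"
  unfolding cone_of_def mem_Collect_eq
  by (intro definable_ball definable.zero polyfun_on_eval_poly slot_nth_polyfun)

lemma definable_tan_of: "finite F \<Longrightarrow> definable (\<lambda>x. slot l x \<in> tan_of F (slot k x))"
  unfolding tan_of_def mem_Collect_eq D1_def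
  by (intro definable_ball definable.zero polyfun_intros polyfun_on_eval_poly slot_nth_polyfun)

lemma definable_tan_of_eq:
  assumes "finite F"
  shows "definable (\<lambda>x. tan_of F (slot k x) = tan_of F (slot l x))"
proof -
  have "definable (\<lambda>x. \<forall>w. w \<in> tan_of F (slot k x) \<longleftrightarrow> w \<in> tan_of F (slot l x))"
    by (rule definable_all_vec[where k = "max k l + 1"])
       (auto intro!: definable_iff definable_tan_of assms simp: less_Suc_eq_le)
  then show ?thesis by (simp add: set_eq_iff)
qed

text \<open>Turns dimension into a first-order condition; the independent vectors form a numbered
  family so that they fit into slots.\<close>

lemma dim_ge_iff:
  fixes S :: "(complex ^ 'a::finite) set"
  assumes "vec.subspace S"
  shows "m \<le> vec.dim S \<longleftrightarrow>
     (\<exists>W. (\<forall>i<m. W i \<in> S) \<and> (\<forall>c. (\<Sum>i<m. c i *s W i) = 0 \<longrightarrow> (\<forall>i<m. c i = 0)))"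
    (is "?L \<longleftrightarrow> ?R")
proof
  assume ?L
  obtain B where B: "B \<subseteq> S" "vec.independent B" "card B = vec.dim S"
    by (rule vec.basis_exists[of S])
  obtain T where T: "T \<subseteq> B" "card T = m" "finite T"
    using obtain_subset_with_card_n[of m B] \<open>?L\<close> B(3) by auto
  obtain W where W: "bij_betw W {0..<m} T" using ex_bij_betw_nat_finite[OF T(3)] T(2) by auto
  have "c i = 0" if c: "(\<Sum>i<m. c i *s W i) = 0" and i: "i < m" for c i
  proof -
    let ?h = "the_inv_into {0..<m} W"
    have "(\<Sum>i<m. c i *s W i) = (\<Sum>i\<in>{0..<m}. c (?h (W i)) *s W i)"
      using W by (intro sum.cong) (auto simp: bij_betw_def the_inv_into_f_f)
    also have "\<dots> = (\<Sum>w\<in>T. c (?h w) *s w)" by (rule sum.reindex_bij_betw[OF W])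
    finally have "(\<Sum>w\<in>T. c (?h w) *s w) = 0" using c by simp
    then have "c (?h (W i)) = 0"
      using vec.independentD[OF B(2) T(3,1), of "\<lambda>w. c (?h w)" "W i"]
        bij_betwE[OF W, rule_format, of i] i by simp
    then show ?thesis using W i by (simp add: bij_betw_def the_inv_into_f_f)
  qed
  moreover have "W i \<in> S" if "i < m" for i using bij_betwE[OF W, rule_format, of i] T(1) B(1) that by auto
  ultimately show ?R by blast
next
  assume ?R
  then obtain W where W: "\<And>i. i < m \<Longrightarrow> W i \<in> S"
    "\<And>c i. (\<Sum>i<m. c i *s W i) = 0 \<Longrightarrow> i < m \<Longrightarrow> c i = 0" by blast
  have inj: "inj_on W {..<m}"
  proof (rule inj_onI, rule ccontr)
    fix i j assume ij: "i \<in> {..<m}" "j \<in> {..<m}" "W i = W j" "i \<noteq> j"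
    let ?c = "\<lambda>k. (if k = i then 1 else 0) - (if k = j then 1 else (0 :: complex))"
    have "(\<Sum>k<m. ?c k *s W k) = (\<Sum>k<m. if k = i then W k else 0) - (\<Sum>k<m. if k = j then W k else 0)"
      unfolding sum_subtractf[symmetric] by (intro sum.cong) (auto simp: vector_sub_rdistrib)
    also have "\<dots> = 0" using ij by simp
    finally have "?c i = 0" using W(2)[of ?c i] ij by simp
    then show False using ij by simp
  qed
  have "vec.independent (W ` {..<m})"
  proof (rule vec.independent_if_scalars_zero)
    fix f w assume f: "(\<Sum>w\<in>W ` {..<m}. f w *s w) = 0" and w: "w \<in> W ` {..<m}"
    then have "(\<Sum>i<m. f (W i) *s W i) = 0" by (simp add: sum.reindex[OF inj])
    then show "f w = 0" using W(2)[of "\<lambda>i. f (W i)"] w by auto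
  qed simp
  moreover have "W ` {..<m} \<subseteq> S" using W(1) by auto
  ultimately have "card (W ` {..<m}) \<le> vec.dim S" by (metis vec.independent_card_le_dim)
  then show ?L using inj by (simp add: card_image)
qed

lemma definable_independent:
  "definable (\<lambda>x. \<forall>c. (\<Sum>i<m. c i *s (slot (k + i) x :: complex ^ 'a::finite)) = 0 \<longrightarrow> (\<forall>i<m. c i = 0))"
proof -
  \<comment> \<open>The quantifier lemmas range over vectors, so each scalar \<open>c i\<close> is
    carried by one fixed component of a vector.\<close>
  define j0 :: 'a where "j0 = undefined"
  have "definable (\<lambda>x. \<forall>C :: nat \<Rightarrow> complex ^ 'a. (\<forall>j\<in>UNIV. (\<Sum>i<m. C i $ j0 * (slot (k + i) x :: complex ^ 'a) $ j) = 0)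
          \<longrightarrow> (\<forall>i<m. C i $ j0 = 0))"
  proof (rule definable_all_vecs[where k = "k + m" and m = m])
    show "definable (\<lambda>x. (\<forall>j\<in>UNIV. (\<Sum>i<m. (slot (k + m + i) x :: complex ^ 'a) $ j0 * (slot (k + i) x :: complex ^ 'a) $ j) = 0)
          \<longrightarrow> (\<forall>i<m. (slot (k + m + i) x :: complex ^ 'a) $ j0 = 0))"
      by (intro definable_imp definable_ball definable_all_less definable.zero polyfun_intros slot_nth_polyfun) auto
    show "((\<forall>j\<in>UNIV. (\<Sum>i<m. C i $ j0 * (slot (k + i) x :: complex ^ 'a) $ j) = 0) \<longrightarrow> (\<forall>i<m. C i $ j0 = 0)) \<longleftrightarrow>
       ((\<forall>j\<in>UNIV. (\<Sum>i<m. C' i $ j0 * (slot (k + i) x' :: complex ^ 'a) $ j) = 0) \<longrightarrow> (\<forall>i<m. C' i $ j0 = 0))"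
      if "\<And>i. i < m \<Longrightarrow> C i = C' i" "\<And>l. l < k + m \<Longrightarrow> slot l x = slot l x'" for C C' :: "nat \<Rightarrow> complex ^ 'a" and x x'
    proof -
      have "(\<Sum>i<m. C i $ j0 * (slot (k + i) x :: complex ^ 'a) $ j) = (\<Sum>i<m. C' i $ j0 * (slot (k + i) x' :: complex ^ 'a) $ j)" for j
        by (rule sum.cong) (use that in auto)
      moreover have "(\<forall>i<m. C i $ j0 = 0) \<longleftrightarrow> (\<forall>i<m. C' i $ j0 = 0)" using that(1) by auto
      ultimately show ?thesis by simp
    qed
  qed
  moreover have "(\<forall>C :: nat \<Rightarrow> complex ^ 'a. (\<forall>j\<in>UNIV. (\<Sum>i<m. C i $ j0 * V i $ j) = 0) \<longrightarrow> (\<forall>i<m. C i $ j0 = 0))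
     \<longleftrightarrow> (\<forall>c. (\<Sum>i<m. c i *s V i) = 0 \<longrightarrow> (\<forall>i<m. c i = 0))" (is "?L \<longleftrightarrow> ?R") for V :: "nat \<Rightarrow> complex ^ 'a"
  proof
    assume ?L
    show ?R
    proof (intro allI impI)
      fix c i assume "(\<Sum>i<m. c i *s V i) = 0" "i < m"
      then show "c i = 0"
        using \<open>?L\<close>[rule_format, of "\<lambda>i. \<chi> j. c i" i] by (simp add: vec_eq_iff)
    qed
  next
    assume ?R
    show ?L
    proof (intro allI impI)
      fix C :: "nat \<Rightarrow> complex ^ 'a" and i assume "\<forall>j\<in>UNIV. (\<Sum>i<m. C i $ j0 * V i $ j) = 0" "i < m"
      then show "C i $ j0 = 0"
        using \<open>?R\<close>[rule_format, of "\<lambda>i. C i $ j0" i] by (simp add: vec_eq_iff)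
    qed
  qed
  ultimately show ?thesis by simp
qed

lemma definable_dim_tan_ge:
  assumes "finite F"
  shows "definable (\<lambda>x. m \<le> vec.dim (tan_of F (slot k x :: complex ^ 'a::finite)))"
  unfolding dim_ge_iff[OF subspace_tan_of]
proof (rule definable_ex_vecs[where k = "k + 1" and m = m])
  show "definable (\<lambda>x. (\<forall>i<m. slot (k + 1 + i) x \<in> tan_of F (slot k x)) \<and>
      (\<forall>c. (\<Sum>i<m. c i *s (slot (k + 1 + i) x :: complex ^ 'a)) = 0 \<longrightarrow> (\<forall>i<m. c i = 0)))"
    by (intro definable.conj definable_all_less definable_tan_of definable_independent assms)
  show "((\<forall>i<m. W i \<in> tan_of F (slot k x)) \<and> (\<forall>c. (\<Sum>i<m. c i *s W i) = 0 \<longrightarrow> (\<forall>i<m. c i = 0))) \<longleftrightarrow>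
      ((\<forall>i<m. W' i \<in> tan_of F (slot k x')) \<and> (\<forall>c. (\<Sum>i<m. c i *s W' i) = 0 \<longrightarrow> (\<forall>i<m. c i = 0)))"
    if "\<And>i. i < m \<Longrightarrow> W i = W' i" "\<And>l. l < k + 1 \<Longrightarrow> slot l x = slot l x'"
    for W W' :: "nat \<Rightarrow> complex ^ 'a" and x x'
  proof -
    have "(\<Sum>i<m. c i *s W i) = (\<Sum>i<m. c i *s W' i)" for c by (rule sum.cong) (use that in auto)
    moreover have "slot k x = slot k x'" using that(2) by simp
    moreover have "(\<forall>i<m. W i \<in> tan_of F (slot k x)) \<longleftrightarrow> (\<forall>i<m. W' i \<in> tan_of F (slot k x))" using that(1) by auto
    ultimately show ?thesis by simp
  qed
qed

lemma definable_smooth_of: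
  assumes "finite F"
  shows "definable (\<lambda>x. slot k x \<in> smooth_of F n)"
proof -
  have "definable (\<lambda>x. \<not> slot k x = 0 \<and> slot k x \<in> cone_of F \<and> n + 1 \<le> vec.dim (tan_of F (slot k x))
       \<and> \<not> n + 2 \<le> vec.dim (tan_of F (slot k x)))"
    by (intro definable.conj definable.neg definable_slot_eq_0 definable_cone_of definable_dim_tan_ge assms)
  moreover have "d = n + 1 \<longleftrightarrow> n + 1 \<le> d \<and> \<not> n + 2 \<le> d" for d :: nat by auto
  ultimately show ?thesis by (simp add: smooth_of_def)
qed

text \<open>Distinct tangent cones are counted and not distinct points of contact, in agreement with
  \<open>tangent_degree\<close>.\<close>

definition many_tangents :: "'a::finite cpoly set \<Rightarrow> nat \<Rightarrow> nat \<Rightarrow> complex ^ 'a \<Rightarrow> bool" where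
  "many_tangents F n m p \<longleftrightarrow> (\<exists>W. (\<forall>i<m. W i \<in> smooth_of F n \<and> p \<in> tan_of F (W i)) \<and>
     (\<forall>i<m. \<forall>j<m. i \<noteq> j \<longrightarrow> tan_of F (W i) \<noteq> tan_of F (W j)))"

lemma definable_many_tangents:
  assumes "finite F"
  shows "definable (\<lambda>x. many_tangents F n m (slot 0 x))"
  unfolding many_tangents_def
proof (rule definable_ex_vecs[where k = 1 and m = m])
  have "definable (\<lambda>x. i \<noteq> j \<longrightarrow> tan_of F (slot (1 + i) x) \<noteq> tan_of F (slot (1 + j) x))" for i j
    by (intro definable_imp definable_const definable.neg definable_tan_of_eq assms)
  then show "definable (\<lambda>x. (\<forall>i<m. slot (1 + i) x \<in> smooth_of F n \<and> slot 0 x \<in> tan_of F (slot (1 + i) x)) \<and>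
     (\<forall>i<m. \<forall>j<m. i \<noteq> j \<longrightarrow> tan_of F (slot (1 + i) x) \<noteq> tan_of F (slot (1 + j) x)))"
    by (intro definable.conj definable_all_less definable_tan_of definable_smooth_of assms)
qed simp

lemma many_tangents_scale:
  assumes "c \<noteq> 0"
  shows "many_tangents F n m (c *s p) \<longleftrightarrow> many_tangents F n m p"
proof -
  have "c *s p \<in> tan_of F v \<longleftrightarrow> p \<in> tan_of F v" for v
    using assms by (simp add: tan_of_def D1_scale)
  then show ?thesis by (simp add: many_tangents_def)
qed

text \<open>A nonzero homogeneous component of the exceptional polynomial serves as
  \<open>g\<close>: where it does not vanish, the exceptional polynomial is nonzero at some nonzero
  multiple of \<open>v\<close>, and \<open>Q\<close> does not distinguish \<open>v\<close> from its
  multiples.\<close>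

lemma definable_homogeneous_generic:
  fixes Q :: "complex ^ 'a::finite \<Rightarrow> bool"
  assumes "definable (\<lambda>x. Q (slot 0 x))" and scale: "\<And>c v. c \<noteq> 0 \<Longrightarrow> Q (c *s v) \<longleftrightarrow> Q v"
  shows "\<exists>g. homogeneous g \<and> (\<exists>v. eval_poly g v \<noteq> 0) \<and>
    ((\<forall>v. eval_poly g v \<noteq> 0 \<longrightarrow> Q v) \<or> (\<forall>v. eval_poly g v \<noteq> 0 \<longrightarrow> \<not> Q v))"
proof -
  from definable_generic[OF assms(1)] obtain f a where f: "f \<in> polyfun_on UNIV" "f a \<noteq> 0"
    "(\<forall>x. f x \<noteq> 0 \<longrightarrow> Q (slot 0 x)) \<or> (\<forall>x. f x \<noteq> 0 \<longrightarrow> \<not> Q (slot 0 x))" by blast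
  \<comment> \<open>The slots other than 0 are frozen at the values of a point \<open>a\<close>
    where \<open>f\<close> does not vanish.\<close>
  define s where "s v = (\<lambda>(k, j). if k = 0 then v $ j else a (k, j))" for v :: "complex ^ 'a"
  have "(\<lambda>v. f (s v)) \<in> range eval_poly"
  proof (rule polyfun_in_range_eval_poly[OF f(1)])
    fix i show "(\<lambda>v. s v i) \<in> range eval_poly"
      by (cases i; cases "fst i = 0") (auto simp: s_def coord_in_range_eval_poly const_in_range_eval_poly)
  qed
  then obtain G where G: "\<And>v. f (s v) = eval_poly G v" by (metis (no_types, lifting) rangeE)
  have s: "slot 0 (s v) = v" for v by (simp add: slot_def s_def vec_eq_iff)
  have "s (slot 0 a) = a" by (auto simp: s_def slot_def)
  then have G0: "eval_poly G (slot 0 a) \<noteq> 0" using G f(2) by metis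
  obtain N where N: "\<And>c v. eval_poly G (c *s v) = (\<Sum>d<N. c ^ d * eval_poly (hom_component d G) v)"
    using eval_poly_scale_components by blast
  have "\<exists>d<N. eval_poly (hom_component d G) (slot 0 a) \<noteq> 0"
  proof (rule ccontr)
    assume "\<not> ?thesis"
    then have "eval_poly G (1 *s slot 0 a) = 0" unfolding N by (intro sum.neutral) auto
    then show False using G0 by simp
  qed
  then obtain d where d: "d < N" "eval_poly (hom_component d G) (slot 0 a) \<noteq> 0" by blast
  let ?g = "hom_component d G"
  have key: "\<exists>c. c \<noteq> 0 \<and> eval_poly G (c *s v) \<noteq> 0" if v: "eval_poly ?g v \<noteq> 0" for v
  proof -
    let ?p = "\<Sum>d<N. monom (eval_poly (hom_component d G) v) d"
    have "coeff ?p d = (\<Sum>e<N. if e = d then eval_poly (hom_component e G) v else 0)"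
      unfolding coeff_sum by (intro sum.cong) auto
    then have "coeff ?p d \<noteq> 0" using v d(1) by simp
    then have "?p \<noteq> 0" by (metis coeff_0)
    then have "finite (insert 0 {c. poly ?p c = 0})" using poly_roots_finite by simp
    then obtain c where "c \<notin> insert 0 {c. poly ?p c = 0}"
      using ex_new_if_finite[OF infinite_UNIV_char_0] by blast
    then have "c \<noteq> 0" "poly ?p c \<noteq> 0" by auto
    then show ?thesis by (intro exI[of _ c]) (simp add: N poly_sum poly_monom mult.commute)
  qed
  have "homogeneous ?g" using hom_deg_component homogeneous_iff_hom_deg by blast
  moreover have "(\<forall>v. eval_poly ?g v \<noteq> 0 \<longrightarrow> Q v) \<or> (\<forall>v. eval_poly ?g v \<noteq> 0 \<longrightarrow> \<not> Q v)"
  proof -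
    have "Q v" if "\<forall>x. f x \<noteq> 0 \<longrightarrow> Q (slot 0 x)" "eval_poly ?g v \<noteq> 0" for v
      using key[OF that(2)] that(1)[rule_format, of "s _"] s G scale by metis
    moreover have "\<not> Q v" if "\<forall>x. f x \<noteq> 0 \<longrightarrow> \<not> Q (slot 0 x)" "eval_poly ?g v \<noteq> 0" for v
      using key[OF that(2)] that(1)[rule_format, of "s _"] s G scale by metis
    ultimately show ?thesis using f(3) by blast
  qed
  ultimately show ?thesis using d(2) by blast
qed

text \<open>The values of one coordinate on the solution set form a definable set of complex
  numbers, finite or cofinite, and a cofinite one is uncountable. Slot 1 carries this value, beside
  slot 0 for \<open>p\<close> and slot 2 for the bound vector.\<close>

lemma definable_countable_imp_finite:
  fixes R :: "complex ^ 'a::finite \<Rightarrow> complex ^ 'a \<Rightarrow> bool"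
  assumes R: "definable (\<lambda>x. R (slot 2 x) (slot 0 x))" and c: "countable {w. R w p}"
  shows "finite {w. R w p}"
proof -
  have fin: "finite ((\<lambda>w. w $ j) ` {w. R w p})" for j
  proof -
    have "definable (\<lambda>x. \<exists>w :: complex ^ 'a. w $ j = (slot 1 x :: complex ^ 'a) $ j \<and> R w (slot 0 x))"
      by (rule definable_ex_vec[where k = 2]) (auto intro!: definable.conj definable_eq slot_nth_polyfun R)
    note * = definable_line_finite_or_cofinite[OF this, of "\<lambda>(k, j). p $ j" "(1, j)"]
    let ?x = "\<lambda>t. (\<lambda>(k, j). p $ j)((1 :: nat, j) := t)"
    have "slot 0 (?x t) = p" "(slot 1 (?x t) :: complex ^ 'a) $ j = t" for t
      by (auto simp: slot_def vec_eq_iff)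
    then have eq: "{t. \<exists>w :: complex ^ 'a. w $ j = (slot 1 (?x t) :: complex ^ 'a) $ j \<and> R w (slot 0 (?x t))}
        = (\<lambda>w. w $ j) ` {w. R w p}" by auto
    show ?thesis
    proof (rule ccontr)
      assume inf: "infinite ((\<lambda>w. w $ j) ` {w. R w p})"
      then have "finite (- ((\<lambda>w. w $ j) ` {w. R w p}))"
        using *[unfolded Collect_neg_eq eq] by blast
      moreover have "countable ((\<lambda>w. w $ j) ` {w. R w p})" using c by simp
      ultimately have "countable ((\<lambda>w. w $ j) ` {w. R w p} \<union> - ((\<lambda>w. w $ j) ` {w. R w p}))"
        by (metis countable_Un countable_finite)
      then show False using uncountable_UNIV_complex by simp
    qed
  qed
  have "{w. R w p} \<subseteq> (\<lambda>f. \<chi> j. f j) ` (PiE UNIV (\<lambda>j. (\<lambda>w. w $ j) ` {w. R w p}))"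
  proof
    fix w assume "w \<in> {w. R w p}"
    then have "(\<lambda>j. w $ j) \<in> PiE UNIV (\<lambda>j. (\<lambda>w. w $ j) ` {w. R w p})" by auto
    moreover have "w = (\<chi> j. w $ j)" by simp
    ultimately show "w \<in> (\<lambda>f. \<chi> j. f j) ` (PiE UNIV (\<lambda>j. (\<lambda>w. w $ j) ` {w. R w p}))" by blast
  qed
  moreover have "finite (PiE UNIV (\<lambda>j :: 'a. (\<lambda>w. w $ j) ` {w. R w p}))"
    by (intro finite_PiE fin) auto
  ultimately show ?thesis using finite_surj by blast
qed

section \<open>The dimension of projective space\<close>

lemma ex_proj_point:
  assumes "u \<noteq> (0 :: complex ^ 'a::finite)"
  shows "\<exists>p. u \<in> hcoords p"
proof -
  have "vec.independent {u}" using assms by simp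
  then have "vec.dim (vec.span {u}) = 1"
    by (subst vec.dim_span, subst vec.dim_eq_card_independent) auto
  then have "line_of (Proj (vec.span {u})) = vec.span {u}"
    by (intro Proj_inverse) (simp add: vec.subspace_span)
  then have "u \<in> hcoords (Proj (vec.span {u}))"
    using assms vec.span_base[of u "{u}"] by (simp add: hcoords_def)
  then show ?thesis by blast
qed

lemma eval_poly_line_nonzero:
  assumes "eval_poly f v \<noteq> 0" "eval_poly g w \<noteq> 0"
  shows "\<exists>t. eval_poly f (v + t *s (w - v)) \<noteq> 0 \<and> eval_poly g (v + t *s (w - v)) \<noteq> 0"
proof -
  obtain P where P: "\<And>t. eval_poly f (v + t *s (w - v)) = poly P t" using eval_poly_line[of f] by metis
  obtain Q where Q: "\<And>t. eval_poly g (v + t *s (w - v)) = poly Q t" using eval_poly_line[of g] by metis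
  have "poly P 0 \<noteq> 0" using P[of 0] assms(1) by simp
  moreover have "poly Q 1 \<noteq> 0" using Q[of 1] assms(2) by simp
  ultimately have "P * Q \<noteq> 0" by auto
  then obtain t where "poly (P * Q) t \<noteq> 0" using poly_all_0_iff_0 by blast
  then show ?thesis using P Q by auto
qed

definition coord_poly :: "'a \<Rightarrow> 'a::finite cpoly" where
  "coord_poly j = Poly_Mapping.single (Poly_Mapping.single j 1) 1"

lemma eval_coord_poly: "eval_poly (coord_poly j) v = v $ j"
proof -
  have "(\<Prod>i\<in>UNIV. v $ i ^ Poly_Mapping.lookup (Poly_Mapping.single j 1) i) = v $ j"
    by (subst prod.remove[of _ j]) (auto simp: lookup_single intro!: prod.neutral)
  then show ?thesis by (simp add: coord_poly_def eval_poly_single eval_monom_def)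
qed

lemma hom_deg_coord_poly: "hom_deg (coord_poly j) 1"
proof -
  have "(\<Sum>i\<in>UNIV. Poly_Mapping.lookup (Poly_Mapping.single j (1::nat)) i) = 1"
    by (subst sum.remove[of _ j]) (auto simp: lookup_single intro!: sum.neutral)
  then show ?thesis by (simp add: hom_deg_def coord_poly_def)
qed

text \<open>A point outside \<open>A\<close> and a point outside \<open>B\<close> span a line in the
  linear subspace, and two polynomials that are each nonzero somewhere on it have a common point of
  nonvanishing.\<close>

lemma irreducible_linear:
  fixes J :: "'a::finite set"
  defines "Z \<equiv> {p. \<forall>v\<in>hcoords p. \<forall>j\<in>J. v $ j = 0}"
  assumes "J \<noteq> UNIV"
  shows "closedin zariski Z" "irreducible_space (subtopology zariski Z)"
proof -
  have "Z = zero_locus (coord_poly ` J)"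
    by (auto simp: Z_def zero_locus_def eval_coord_poly)
  moreover have "\<forall>f\<in>coord_poly ` J. homogeneous f"
    using hom_deg_coord_poly homogeneous_iff_hom_deg by blast
  ultimately show "closedin zariski Z"
    unfolding closedin_zariski zariski_closed_def by blast
  have inZ: "p \<in> Z" if "u \<in> hcoords p" "\<forall>j\<in>J. u $ j = 0" for p u
  proof -
    have "w $ j = 0" if w: "w \<in> hcoords p" and "j \<in> J" for w j
    proof -
      obtain c where "w = c *s u" using hcoords_scale[OF \<open>u \<in> hcoords p\<close> w] by blast
      then show ?thesis using that \<open>\<forall>j\<in>J. u $ j = 0\<close> by simp
    qed
    then show ?thesis unfolding Z_def by blast
  qed
  show "irreducible_space (subtopology zariski Z)"
    unfolding irreducible_space_def
  proof (intro conjI allI impI)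
    obtain j where j: "j \<notin> J" using assms(2) by blast
    have "axis j 1 \<noteq> (0 :: complex ^ 'a)" by (simp add: axis_eq_0_iff)
    then obtain p where "axis j (1 :: complex) \<in> hcoords p" using ex_proj_point by blast
    then have "p \<in> Z" using j by (intro inZ) (auto simp: axis_def)
    then show "topspace (subtopology zariski Z) \<noteq> {}" by auto
  next
    fix A B assume AB: "closedin (subtopology zariski Z) A \<and> closedin (subtopology zariski Z) B \<and>
       A \<union> B = topspace (subtopology zariski Z)"
    then obtain S T where S: "\<forall>f\<in>S. homogeneous f" "A = zero_locus S \<inter> Z"
      and T: "\<forall>f\<in>T. homogeneous f" "B = zero_locus T \<inter> Z" and un: "A \<union> B = Z"
      unfolding closedin_subtopology closedin_zariski zariski_closed_def by auto
    show "A = topspace (subtopology zariski Z) \<or> B = topspace (subtopology zariski Z)"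
    proof (rule ccontr)
      assume "\<not> ?thesis"
      then have "A \<noteq> Z" "B \<noteq> Z" by auto
      then obtain p q where "p \<in> Z" "p \<notin> zero_locus S" "q \<in> Z" "q \<notin> zero_locus T" using S T by blast
      then obtain f v g w where f: "f \<in> S" "v \<in> hcoords p" "eval_poly f v \<noteq> 0"
        and g: "g \<in> T" "w \<in> hcoords q" "eval_poly g w \<noteq> 0"
        unfolding zero_locus_def by blast
      have "v \<noteq> 0" using f(2) by (simp add: hcoords_def)
      then obtain j where "v $ j \<noteq> 0" by (auto simp: vec_eq_iff)
      \<comment> \<open>The extra coordinate factor keeps the point found on the affine line away
        from the zero vector, so that it represents a projective point.\<close>
      then have "eval_poly (f * coord_poly j) v \<noteq> 0" using f(3) by (simp add: eval_poly_mult eval_coord_poly)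
      then obtain t where t: "eval_poly (f * coord_poly j) (v + t *s (w - v)) \<noteq> 0" "eval_poly g (v + t *s (w - v)) \<noteq> 0"
        using eval_poly_line_nonzero g(3) by blast
      define u where "u = v + t *s (w - v)"
      have u: "eval_poly f u \<noteq> 0" "eval_poly g u \<noteq> 0" "u $ j \<noteq> 0"
        using t by (auto simp: u_def eval_poly_mult eval_coord_poly)
      then have "u \<noteq> 0" by auto
      then obtain r where r: "u \<in> hcoords r" using ex_proj_point by blast
      have "\<forall>j\<in>J. v $ j = 0" "\<forall>j\<in>J. w $ j = 0"
        using \<open>p \<in> Z\<close> \<open>q \<in> Z\<close> f(2) g(2) by (auto simp: Z_def)
      then have "r \<in> Z" by (intro inZ[OF r]) (simp add: u_def)
      moreover have "r \<notin> zero_locus S" "r \<notin> zero_locus T"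
        using u r f(1) g(1) unfolding zero_locus_def by blast+
      ultimately show False using un S(2) T(2) by blast
    qed
  qed
qed

text \<open>The coordinate flag: on \<open>Z i\<close> only the coordinates numbered 0 to
  \<open>i\<close> survive.\<close>

lemma krull_dim_zariski_ge: "enat (CARD('a::finite) - 1) \<le> krull_dim (zariski :: 'a proj topology)"
proof -
  obtain b :: "'a \<Rightarrow> nat" where b: "bij_betw b UNIV {0..<CARD('a)}"
    using ex_bij_betw_finite_nat[of "UNIV :: 'a set"] by auto
  define Z :: "nat \<Rightarrow> 'a proj set" where "Z i = {p. \<forall>v\<in>hcoords p. \<forall>j\<in>{j. i < b j}. v $ j = 0}" for i
  have ne: "{j. i < b j} \<noteq> UNIV" for i
  proof -
    have "0 \<in> b ` UNIV" using b by (auto simp: bij_betw_def)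
    then obtain j where "b j = 0" by (metis imageE)
    then show ?thesis by (metis UNIV_I less_nat_zero_code mem_Collect_eq)
  qed
  have "Z i \<subset> Z (Suc i)" if i: "i < CARD('a) - 1" for i
  proof -
    have "Suc i \<in> b ` UNIV" using b i by (auto simp: bij_betw_def)
    then obtain j where j: "b j = Suc i" by (metis imageE)
    have "axis j 1 \<noteq> (0 :: complex ^ 'a)" by (simp add: axis_eq_0_iff)
    then obtain p where p: "axis j (1 :: complex) \<in> hcoords p" using ex_proj_point by blast
    have "p \<notin> Z i"
    proof
      assume "p \<in> Z i"
      then have "\<forall>l\<in>{l. i < b l}. axis j (1 :: complex) $ l = 0" using p unfolding Z_def by blast
      then have "axis j (1 :: complex) $ j = 0" by (rule bspec) (use j in simp)
      then show False by (simp add: axis_def)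
    qed
    moreover have "p \<in> Z (Suc i)"
      unfolding Z_def
    proof (intro CollectI ballI)
      fix v l assume v: "v \<in> hcoords p" and l: "l \<in> {j. Suc i < b j}"
      obtain c where "v = c *s axis j 1" using hcoords_scale[OF p v] by blast
      moreover have "l \<noteq> j" using l j by auto
      ultimately show "v $ l = 0" by (simp add: axis_def)
    qed
    moreover have "Z i \<subseteq> Z (Suc i)" unfolding Z_def by auto
    ultimately show ?thesis by blast
  qed
  moreover have "closedin zariski (Z i) \<and> irreducible_space (subtopology zariski (Z i))" for i
    unfolding Z_def using irreducible_linear[OF ne] by blast
  ultimately show ?thesis unfolding krull_dim_def by (intro Sup_upper) blast
qed

section \<open>Upper bound for the Krull dimension by counting independent polynomials\<close>

definition vanishes_on :: "'a::finite cpoly \<Rightarrow> 'a proj set \<Rightarrow> bool" where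
  "vanishes_on f Z \<longleftrightarrow> (\<forall>p\<in>Z. \<forall>v\<in>hcoords p. eval_poly f v = 0)"

lemma irreducible_homogeneous_cancel:
  assumes Z: "irreducible_space (subtopology zariski Z)"
    and f: "homogeneous f" and g: "homogeneous g" and fg: "vanishes_on (f * g) Z"
  shows "vanishes_on f Z \<or> vanishes_on g Z"
proof -
  let ?A = "zero_locus {f} \<inter> Z" and ?B = "zero_locus {g} \<inter> Z"
  have cl: "closedin (subtopology zariski Z) (zero_locus {h} \<inter> Z)" if "homogeneous h" for h
  proof -
    have "closedin zariski (zero_locus {h})"
      unfolding closedin_zariski zariski_closed_def by (intro exI[of _ "{h}"]) (simp add: that)
    then show ?thesis unfolding closedin_subtopology by blast
  qed
  have "p \<in> ?A \<union> ?B" if p: "p \<in> Z" for p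
  proof -
    obtain v where v: "v \<in> hcoords p" using hcoords_nonempty by blast
    then have "eval_poly f v = 0 \<or> eval_poly g v = 0"
      using fg p by (auto simp: vanishes_on_def eval_poly_mult)
    then show ?thesis
      using p homogeneous_vanish_iff[OF f v] homogeneous_vanish_iff[OF g v] by (auto simp: zero_locus_def)
  qed
  then have "?A \<union> ?B = topspace (subtopology zariski Z)" by auto
  then have "?A = Z \<or> ?B = Z"
    using Z cl[OF f] cl[OF g] unfolding irreducible_space_def by auto
  then show ?thesis unfolding vanishes_on_def zero_locus_def by blast
qed

lemma poly_sum_coeffs_zero:
  fixes a :: "nat \<Rightarrow> complex"
  assumes "\<And>s. s \<noteq> 0 \<Longrightarrow> (\<Sum>q<n. a q * s ^ q) = 0" "q < n"
  shows "a q = 0"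
proof -
  let ?p = "\<Sum>q<n. monom (a q) q"
  have root: "poly ?p s = 0" if "s \<noteq> 0" for s
    using assms(1)[OF that] by (simp add: poly_sum poly_monom)
  have "?p = 0"
  proof (rule ccontr)
    assume "?p \<noteq> 0"
    then have "finite (insert 0 {s. poly ?p s = 0})" using poly_roots_finite by simp
    then obtain s where "s \<notin> insert 0 {s. poly ?p s = 0}"
      using ex_new_if_finite[OF infinite_UNIV_char_0] by blast
    then show False using root by auto
  qed
  moreover have "coeff ?p q = (\<Sum>e<n. if e = q then a e else 0)"
    unfolding coeff_sum by (intro sum.cong) auto
  ultimately show ?thesis using assms(2) by simp
qed

lemma hcoords_scale_mem:
  assumes "v \<in> hcoords p" "c \<noteq> 0"
  shows "c *s v \<in> hcoords p"
proof -
  have "vec.subspace (line_of p)" using line_of[of p] by auto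
  then show ?thesis using assms by (auto simp: hcoords_def vec.subspace_scale)
qed

text \<open>\<open>f\<close> may be inhomogeneous: rescaling the homogeneous coordinates separates
  its components, and \<open>g\<close> can be cancelled from each of them.\<close>

lemma irreducible_cancel:
  assumes Z: "irreducible_space (subtopology zariski Z)"
    and g: "homogeneous g" "\<not> vanishes_on g Z" and fg: "vanishes_on (f * g) Z"
  shows "vanishes_on f Z"
proof -
  obtain N where N: "\<And>c v. eval_poly f (c *s v) = (\<Sum>d<N. c ^ d * eval_poly (hom_component d f) v)"
    using eval_poly_scale_components by blast
  have comp: "vanishes_on (hom_component d f) Z" if d: "d < N" for d
  proof -
    have "vanishes_on (hom_component d f * g) Z"
      unfolding vanishes_on_def
    proof (intro ballI)
      fix p v assume p: "p \<in> Z" and v: "v \<in> hcoords p"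
      show "eval_poly (hom_component d f * g) v = 0"
      proof (cases "eval_poly g v = 0")
        case False
        have "(\<Sum>d<N. eval_poly (hom_component d f) v * c ^ d) = 0" if "c \<noteq> 0" for c
        proof -
          have cv: "c *s v \<in> hcoords p" by (rule hcoords_scale_mem[OF v that])
          then have "eval_poly (f * g) (c *s v) = 0" using fg p unfolding vanishes_on_def by blast
          moreover have "eval_poly g (c *s v) \<noteq> 0" using homogeneous_vanish_iff[OF g(1) v cv] False by simp
          ultimately show ?thesis using N[of c v] by (simp add: eval_poly_mult mult.commute)
        qed
        then have "eval_poly (hom_component d f) v = 0" using d by (rule poly_sum_coeffs_zero)
        then show ?thesis by (simp add: eval_poly_mult)
      qed (simp add: eval_poly_mult)
    qed
    then show ?thesis
      using irreducible_homogeneous_cancel[OF Z _ g(1)] g(2) hom_deg_component homogeneous_iff_hom_deg by blast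
  qed
  show ?thesis
    unfolding vanishes_on_def
  proof (intro ballI)
    fix p v assume "p \<in> Z" "v \<in> hcoords p"
    then have "eval_poly f (1 *s v) = 0"
      unfolding N using comp by (intro sum.neutral) (auto simp: vanishes_on_def)
    then show "eval_poly f v = 0" by simp
  qed
qed

lemma eval_poly_power: "eval_poly (f ^ k) v = eval_poly f v ^ k"
proof (induction k)
  case 0
  have "eval_poly 1 v = 1" by (simp add: eval_poly_def eval_monom_def lookup_one)
  then show ?case by simp
qed (simp add: eval_poly_mult)

abbreviation const_poly :: "complex \<Rightarrow> 'a::finite cpoly" where
  "const_poly c \<equiv> Poly_Mapping.single 0 c"

lemma eval_const_poly [simp]: "eval_poly (const_poly c) v = c"
  by (simp add: eval_poly_single eval_monom_def)

text \<open>The monomials in \<open>h 0\<close>, ..., \<open>h i\<close> with all exponents below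
  \<open>D\<close>, numbered by reading the exponents as the base \<open>D\<close> digits of
  \<open>q\<close>; the exponent of \<open>h 0\<close> is the leading digit.\<close>

primrec chain_monom :: "(nat \<Rightarrow> 'a::finite cpoly) \<Rightarrow> nat \<Rightarrow> nat \<Rightarrow> nat \<Rightarrow> 'a cpoly" where
  "chain_monom h D 0 q = h 0 ^ q"
| "chain_monom h D (Suc i) q = chain_monom h D i (q div D) * h (Suc i) ^ (q mod D)"

text \<open>Every member of the chain contributes one independent function, as
  \<open>h (Suc i)\<close> vanishes on \<open>Z i\<close> but not on \<open>Z (Suc i)\<close>. The
  linear form \<open>h 0\<close> accounts for the additional dimension of the cone.\<close>

lemma chain_algebraically_independent:
  assumes h0: "hom_deg (h 0) 1" "\<not> vanishes_on (h 0) (Z 0)"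
    and irr: "\<And>i. i \<le> k \<Longrightarrow> irreducible_space (subtopology zariski (Z i))"
    and sub: "\<And>i. i < k \<Longrightarrow> Z i \<subseteq> Z (Suc i)"
    and hS: "\<And>i. i < k \<Longrightarrow> homogeneous (h (Suc i))" "\<And>i. i < k \<Longrightarrow> vanishes_on (h (Suc i)) (Z i)"
      "\<And>i. i < k \<Longrightarrow> \<not> vanishes_on (h (Suc i)) (Z (Suc i))"
    and "D > 0" "i \<le> k"
    and "vanishes_on (\<Sum>q<D ^ Suc i. const_poly (c q) * chain_monom h D i q) (Z i)" "q < D ^ Suc i"
  shows "c q = 0"
  using assms(9-)
proof (induction i arbitrary: c q)
  case 0
  obtain p v where p: "p \<in> Z 0" "v \<in> hcoords p" "eval_poly (h 0) v \<noteq> 0"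
    using h0(2) by (auto simp: vanishes_on_def)
  let ?e = "eval_poly (h 0) v"
  have "(\<Sum>q<D. c q * s ^ q) = 0" if "s \<noteq> 0" for s
  proof -
    have "(s / ?e) *s v \<in> hcoords p" using hcoords_scale_mem[OF p(2)] p(3) that by simp
    then have "eval_poly (\<Sum>q<D ^ Suc 0. const_poly (c q) * chain_monom h D 0 q) ((s / ?e) *s v) = 0"
      using 0(2) p(1) unfolding vanishes_on_def by blast
    moreover have "eval_poly (h 0) ((s / ?e) *s v) = s" using p(3) by (simp add: hom_deg_scale[OF h0(1)])
    ultimately show ?thesis by (simp add: eval_poly_sum eval_poly_mult eval_poly_power)
  qed
  moreover have "q < D" using "0.prems"(3) by simp
  ultimately show ?case by (rule poly_sum_coeffs_zero)
next
  case (Suc i)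
  let ?n = "D ^ Suc i" and ?h = "h (Suc i)"
  let ?F = "\<lambda>b. \<Sum>q<?n. const_poly (b q) * chain_monom h D i q"
  have shift: "(\<Sum>a<Suc A. G a * x ^ a) = G 0 + (\<Sum>a<A. G (Suc a) * x ^ a) * x"
    for G :: "nat \<Rightarrow> 'a cpoly" and A x
    unfolding sum.lessThan_Suc_shift by (simp add: sum_distrib_right sum_distrib_left mult_ac)
  have ik: "i < k" "Suc i \<le> k" using Suc.prems(1) by auto
  note outer_IH = Suc.IH
  \<comment> \<open>Powers of \<open>?h\<close> are peeled off one at a time: on \<open>Z i\<close>
    only the term of exponent 0 survives, and once it is gone a factor \<open>?h\<close> is
    cancelled on \<open>Z (Suc i)\<close>.\<close>
  have inner: "b a q = 0" if "vanishes_on (\<Sum>a<A. ?F (b a) * ?h ^ a) (Z (Suc i))" "a < A" "q < ?n" for b a A q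
    using that
  proof (induction A arbitrary: b a q)
    case (Suc A)
    have split: "(\<Sum>a<Suc A. ?F (b a) * ?h ^ a) = ?F (b 0) + (\<Sum>a<A. ?F (b (Suc a)) * ?h ^ a) * ?h"
      using shift[of "\<lambda>a. ?F (b a)" ?h A] .
    have "vanishes_on (?F (b 0)) (Z i)"
      unfolding vanishes_on_def
    proof (intro ballI)
      fix p v assume pv: "p \<in> Z i" "v \<in> hcoords p"
      then have "eval_poly (\<Sum>a<Suc A. ?F (b a) * ?h ^ a) v = 0"
        using Suc.prems(1) sub[OF ik(1)] unfolding vanishes_on_def by blast
      moreover have "eval_poly ?h v = 0" using hS(2)[OF ik(1)] pv unfolding vanishes_on_def by blast
      ultimately show "eval_poly (?F (b 0)) v = 0" unfolding split by (simp add: eval_poly_add eval_poly_mult)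
    qed
    then have b0: "b 0 q = 0" if "q < ?n" for q
      using outer_IH[of "b 0" q] ik(1) that by simp
    have "?F (b 0) = 0" using b0 by (intro sum.neutral) auto
    then have "vanishes_on ((\<Sum>a<A. ?F (b (Suc a)) * ?h ^ a) * ?h) (Z (Suc i))"
      using Suc.prems(1) unfolding split by simp
    then have "vanishes_on (\<Sum>a<A. ?F (b (Suc a)) * ?h ^ a) (Z (Suc i))"
      by (rule irreducible_cancel[OF irr[OF ik(2)] hS(1)[OF ik(1)] hS(3)[OF ik(1)]])
    then have "b (Suc a) q = 0" if "a < A" "q < ?n" for a q
      by (rule Suc.IH[of "\<lambda>a. b (Suc a)"]) (fact that)+
    then show ?case using b0 Suc.prems(2,3) by (cases a) auto
  qed simp
  let ?b = "\<lambda>a q. c (q * D + a)"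
  have "(\<Sum>q<D ^ Suc (Suc i). const_poly (c q) * chain_monom h D (Suc i) q)
     = (\<Sum>(a, q)\<in>{..<D} \<times> {..<?n}. const_poly (?b a q) * chain_monom h D i q * ?h ^ a)"
  proof (rule sum.reindex_bij_witness[of _ "\<lambda>(a, q). q * D + a" "\<lambda>q. (q mod D, q div D)"])
    fix q assume "q \<in> {..<D ^ Suc (Suc i)}"
    then show "(q mod D, q div D) \<in> {..<D} \<times> {..<?n}"
      using \<open>D > 0\<close> by (simp add: less_mult_imp_div_less mult.commute)
  next
    fix x assume x: "x \<in> {..<D} \<times> {..<?n}"
    obtain a q where [simp]: "x = (a, q)" by fastforce
    have "q * D + a < (q + 1) * D" using x by simp
    also have "\<dots> \<le> ?n * D" using x by (intro mult_right_mono) auto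
    finally show "(case x of (a, q) \<Rightarrow> q * D + a) \<in> {..<D ^ Suc (Suc i)}" by (simp add: mult.commute)
  qed (use \<open>D > 0\<close> in \<open>auto simp: mult.assoc\<close>)
  also have "\<dots> = (\<Sum>a<D. ?F (?b a) * ?h ^ a)"
    by (simp add: sum.cartesian_product[symmetric] sum_distrib_right)
  finally have "vanishes_on (\<Sum>a<D. ?F (?b a) * ?h ^ a) (Z (Suc i))" using Suc.prems(2) by simp
  then have "?b (q mod D) (q div D) = 0"
    by (rule inner) (use \<open>D > 0\<close> Suc.prems(3) in \<open>simp_all add: less_mult_imp_div_less mult.commute\<close>)
  then show ?case by simp
qed

definition exps_le :: "'a::finite cpoly \<Rightarrow> nat \<Rightarrow> bool" where
  "exps_le f B \<longleftrightarrow> (\<forall>m\<in>Poly_Mapping.keys f. \<forall>i. Poly_Mapping.lookup m i \<le> B)"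

lemma exps_le_mult: "exps_le f B \<Longrightarrow> exps_le g C \<Longrightarrow> exps_le (f * g) (B + C)"
  unfolding exps_le_def using keys_mult[of f g] by (fastforce simp: lookup_add intro: add_mono)

lemma exps_le_power: "exps_le f B \<Longrightarrow> exps_le (f ^ k) (k * B)"
proof (induction k)
  case (Suc k)
  then show ?case using exps_le_mult[of f B "f ^ k" "k * B"] by simp
qed (simp add: exps_le_def)

lemma exps_le_mono: "exps_le f B \<Longrightarrow> B \<le> C \<Longrightarrow> exps_le f C"
  unfolding exps_le_def using order_trans by blast

lemma ex_exps_le: "\<exists>B. exps_le f B"
proof -
  have "finite ((\<lambda>(m, i). Poly_Mapping.lookup m i) ` (Poly_Mapping.keys f \<times> UNIV))" by simp
  then obtain B where "\<forall>n\<in>(\<lambda>(m, i). Poly_Mapping.lookup m i) ` (Poly_Mapping.keys f \<times> UNIV). n \<le> B"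
    using finite_nat_set_iff_bounded_le by blast
  then show ?thesis unfolding exps_le_def by auto
qed

lemma exps_le_chain_monom:
  assumes "\<And>i. i \<le> k \<Longrightarrow> exps_le (h i) B" "D > 0" "i \<le> k" "q < D ^ Suc i"
  shows "exps_le (chain_monom h D i q) (Suc i * (D * B))"
  using assms(3,4)
proof (induction i arbitrary: q)
  case 0
  have "exps_le (h 0 ^ q) (q * B)" using assms(1) by (intro exps_le_power) auto
  then show ?case using 0 by (auto elim!: exps_le_mono)
next
  case (Suc i)
  have "exps_le (chain_monom h D i (q div D)) (Suc i * (D * B))"
    using Suc.prems assms(2) by (intro Suc.IH) (auto simp: less_mult_imp_div_less mult.commute)
  moreover have "exps_le (h (Suc i) ^ (q mod D)) (D * B)"
    by (rule exps_le_mono[OF exps_le_power[OF assms(1)[OF Suc.prems(1)], of "q mod D"]])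
       (simp add: less_imp_le assms(2))
  ultimately have "exps_le (chain_monom h D i (q div D) * h (Suc i) ^ (q mod D)) (Suc i * (D * B) + D * B)"
    by (rule exps_le_mult)
  then show ?case by (simp add: add.commute)
qed

text \<open>Polynomials with all exponents at most \<open>C\<close> are spanned by at most
  \<open>(C + 1) ^ CARD('a)\<close> monomials.\<close>

lemma card_independent_exps_le:
  fixes f :: "nat \<Rightarrow> 'a::finite cpoly"
  assumes ind: "\<And>c q. (\<Sum>q<n. const_poly (c q) * f q) = 0 \<Longrightarrow> q < n \<Longrightarrow> c q = 0"
    and B: "\<And>q. q < n \<Longrightarrow> exps_le (f q) C"
  shows "n \<le> (C + 1) ^ CARD('a)"
proof -
  interpret V: vector_space "\<lambda>(c :: complex) (f :: 'a cpoly). const_poly c * f"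
    by unfold_locales (simp_all add: distrib_left distrib_right single_add mult_single mult.assoc[symmetric])
  define Mon :: "('a \<Rightarrow>\<^sub>0 nat) set" where "Mon = {m. \<forall>i. Poly_Mapping.lookup m i \<le> C}"
  have inj: "inj_on Poly_Mapping.lookup Mon" by (auto intro: inj_onI poly_mapping_eqI)
  have img: "Poly_Mapping.lookup ` Mon \<subseteq> PiE UNIV (\<lambda>_. {..C})" by (auto simp: Mon_def)
  have finP: "finite (PiE (UNIV :: 'a set) (\<lambda>_. {..C}))" by (intro finite_PiE) auto
  have fin: "finite Mon" using inj img finP by (meson finite_imageD finite_subset)
  have "card Mon = card (Poly_Mapping.lookup ` Mon)" using card_image[OF inj] by simp
  also have "\<dots> \<le> card (PiE (UNIV :: 'a set) (\<lambda>_. {..C}))" by (rule card_mono[OF finP img])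
  also have "\<dots> = (C + 1) ^ CARD('a)" by (simp add: card_PiE)
  finally have cardM: "card Mon \<le> (C + 1) ^ CARD('a)" .
  let ?T = "(\<lambda>m. Poly_Mapping.single m (1 :: complex)) ` Mon"
  have injf: "inj_on f {..<n}"
  proof (rule inj_onI, rule ccontr)
    fix i j assume ij: "i \<in> {..<n}" "j \<in> {..<n}" "f i = f j" "i \<noteq> j"
    let ?c = "\<lambda>k. (if k = i then 1 else 0) - (if k = j then 1 else (0 :: complex))"
    have "(\<Sum>k<n. const_poly (?c k) * f k) = (\<Sum>k<n. if k = i then f k else 0) - (\<Sum>k<n. if k = j then f k else 0)"
      unfolding sum_subtractf[symmetric] by (intro sum.cong) (auto simp: single_diff)
    also have "\<dots> = 0" using ij by simp
    finally have "?c i = 0" using ind[of ?c i] ij by simp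
    then show False using ij by simp
  qed
  have "V.independent (f ` {..<n})"
  proof (rule V.independent_if_scalars_zero)
    fix c w assume c: "(\<Sum>w\<in>f ` {..<n}. const_poly (c w) * w) = 0" and w: "w \<in> f ` {..<n}"
    then have "(\<Sum>i<n. const_poly (c (f i)) * f i) = 0" by (simp add: sum.reindex[OF injf])
    then show "c w = 0" using ind[of "\<lambda>i. c (f i)"] w by auto
  qed simp
  moreover have "f ` {..<n} \<subseteq> V.span ?T"
  proof
    fix g assume "g \<in> f ` {..<n}"
    then have g: "exps_le g C" using B by auto
    have "g = (\<Sum>m\<in>Poly_Mapping.keys g. Poly_Mapping.single m (Poly_Mapping.lookup g m))" by (rule poly_sum_singles)
    also have "\<dots> = (\<Sum>m\<in>Poly_Mapping.keys g. const_poly (Poly_Mapping.lookup g m) * Poly_Mapping.single m 1)"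
      by (simp add: mult_single)
    also have "\<dots> \<in> V.span ?T"
      using g by (intro V.span_sum V.span_scale V.span_base) (auto simp: exps_le_def Mon_def)
    finally show "g \<in> V.span ?T" .
  qed
  ultimately have "card (f ` {..<n}) \<le> card ?T"
    using V.independent_span_bound[of ?T] fin by auto
  also have "\<dots> \<le> card Mon" by (rule card_image_le[OF fin])
  finally show ?thesis using cardM card_image[OF injf] by simp
qed

text \<open>Comparison of growth: a chain of length \<open>k\<close> gives \<open>D ^ Suc k\<close>
  independent polynomials whose exponents are linear in \<open>D\<close>, and these lie in a space
  of dimension of order \<open>D ^ CARD('a)\<close>.\<close>

lemma krull_dim_zariski_le: "krull_dim (zariski :: 'a::finite proj topology) \<le> enat (CARD('a) - 1)"
  unfolding krull_dim_def
proof (rule Sup_least)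
  fix x assume "x \<in> {enat k | k Z.
     (\<forall>i\<le>k. closedin (zariski :: 'a proj topology) (Z i) \<and> irreducible_space (subtopology zariski (Z i))) \<and>
     (\<forall>i<k. Z i \<subset> Z (Suc i))}"
  then obtain k and Z :: "nat \<Rightarrow> 'a proj set" where x: "x = enat k"
    and Z: "\<And>i. i \<le> k \<Longrightarrow> zariski_closed (Z i)" "\<And>i. i \<le> k \<Longrightarrow> irreducible_space (subtopology zariski (Z i))"
      "\<And>i. i < k \<Longrightarrow> Z i \<subset> Z (Suc i)"
    by (auto simp: closedin_zariski)
  have ex: "\<exists>g. homogeneous g \<and> vanishes_on g (Z i) \<and> \<not> vanishes_on g (Z (Suc i))" if i: "i < k" for i
  proof -
    obtain S where S: "\<forall>f\<in>S. homogeneous f" "Z i = zero_locus S"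
      using Z(1)[of i] i unfolding zariski_closed_def by auto
    obtain p where p: "p \<in> Z (Suc i)" "p \<notin> zero_locus S" using Z(3)[OF i] S(2) by blast
    then obtain f v where f: "f \<in> S" "v \<in> hcoords p" "eval_poly f v \<noteq> 0" unfolding zero_locus_def by blast
    have "vanishes_on f (Z i)" using S(2) f(1) by (auto simp: vanishes_on_def zero_locus_def)
    moreover have "\<not> vanishes_on f (Z (Suc i))" using p f unfolding vanishes_on_def by blast
    ultimately show ?thesis using S(1) f(1) by blast
  qed
  then obtain g where g: "\<And>i. i < k \<Longrightarrow> homogeneous (g i) \<and> vanishes_on (g i) (Z i) \<and> \<not> vanishes_on (g i) (Z (Suc i))"
    by metis
  have "Z 0 \<noteq> {}" using Z(2)[of 0] by (auto simp: irreducible_space_def)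
  then obtain p where p: "p \<in> Z 0" by blast
  obtain v where v: "v \<in> hcoords p" using hcoords_nonempty by blast
  then have "v \<noteq> 0" by (simp add: hcoords_def)
  then obtain j where j: "v $ j \<noteq> 0" by (auto simp: vec_eq_iff)
  define h where "h i = (case i of 0 \<Rightarrow> coord_poly j | Suc i \<Rightarrow> g i)" for i
  have h0: "hom_deg (h 0) 1" "\<not> vanishes_on (h 0) (Z 0)"
    using p v j hom_deg_coord_poly by (auto simp: h_def vanishes_on_def eval_coord_poly)
  have "\<forall>i. \<exists>B. exps_le (h i) B" using ex_exps_le by blast
  then obtain b where b: "\<And>i. exps_le (h i) (b i)" by metis
  define B where "B = (\<Sum>i\<le>k. b i)"
  have hB: "exps_le (h i) B" if "i \<le> k" for i
    using exps_le_mono[OF b[of i]] that by (simp add: B_def member_le_sum)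
  define K where "K = Suc k * B + 1"
  have bound: "D ^ Suc k \<le> (K * D) ^ CARD('a)" if D: "D > 0" for D
  proof -
    have "D ^ Suc k \<le> (Suc k * (D * B) + 1) ^ CARD('a)"
    proof (rule card_independent_exps_le)
      fix c q assume c: "(\<Sum>q<D ^ Suc k. const_poly (c q) * chain_monom h D k q) = 0" and q: "q < D ^ Suc k"
      show "c q = 0"
      proof (rule chain_algebraically_independent[of h Z k D k c q])
        show "vanishes_on (\<Sum>q<D ^ Suc k. const_poly (c q) * chain_monom h D k q) (Z k)"
          unfolding c by (simp add: vanishes_on_def)
      qed (use h0 Z g D q in \<open>auto simp: h_def\<close>)
    next
      fix q assume "q < D ^ Suc k"
      then show "exps_le (chain_monom h D k q) (Suc k * (D * B))"
        by (rule exps_le_chain_monom[where k = k, rotated 3]) (use hB D in simp_all)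
    qed
    also have "\<dots> \<le> (K * D) ^ CARD('a)"
      unfolding K_def using D by (intro power_mono) (auto simp: algebra_simps)
    finally show ?thesis .
  qed
  have "k < CARD('a)"
  proof (rule ccontr)
    assume "\<not> k < CARD('a)"
    \<comment> \<open>Just large enough that \<open>D * D ^ CARD('a)\<close> exceeds
      \<open>(K * D) ^ CARD('a)\<close>.\<close>
    define D where "D = K ^ CARD('a) + 1"
    have "D * D ^ CARD('a) \<le> D ^ Suc k"
      using \<open>\<not> k < CARD('a)\<close> unfolding power_Suc[symmetric] D_def by (intro power_increasing) auto
    also have "\<dots> \<le> K ^ CARD('a) * D ^ CARD('a)"
      using bound[of D] unfolding power_mult_distrib by (simp only: D_def)
    finally have "D \<le> K ^ CARD('a)" by (simp add: D_def)
    then show False by (simp add: D_def)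
  qed
  then show "x \<le> enat (CARD('a) - 1)" unfolding x by simp
qed

text \<open>Needed to see that \<open>tangent_degree\<close> is given by its first branch when
  \<open>Tan X\<close> is the whole space.\<close>

theorem proj_dim_UNIV: "proj_dim (UNIV :: 'a::finite proj set) = enat (CARD('a) - 1)"
proof -
  have "subtopology zariski (UNIV :: 'a proj set) = zariski"
    by (simp add: subtopology_superset)
  then show ?thesis
    unfolding proj_dim_def using krull_dim_zariski_le krull_dim_zariski_ge by (metis antisym)
qed

section \<open>Sard's theorem and zero sets of analytic functions\<close>

text \<open>The library version needs a well-ordered index type; \<open>'a bit0\<close> is one of cardinality \<open>2 * CARD('a)\<close>.\<close>

lemma sard_complex_vec:
  fixes f :: "complex ^ 'a::finite \<Rightarrow> complex ^ 'a"
  assumes der: "\<And>x. x \<in> S \<Longrightarrow> (f has_derivative f' x) (at x)"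
    and ninj: "\<And>x. x \<in> S \<Longrightarrow> \<not> inj (f' x)"
  shows "negligible (f ` S)"
proof -
  have "DIM(complex ^ 'a) = DIM(real ^ ('a bit0))" by simp
  then obtain T :: "complex ^ 'a \<Rightarrow> real ^ ('a bit0)" and T' where
    T: "linear T" "linear T'" "\<And>x. T' (T x) = x" "\<And>y. T (T' y) = y"
    using isomorphisms_UNIV_UNIV by metis
  have dT: "(T has_derivative T) (at x)" "(T' has_derivative T') (at y within U)" for x y U
    using T by (auto intro: bounded_linear_imp_has_derivative simp: linear_conv_bounded_linear)
  let ?g = "\<lambda>y. T (f (T' y))"
  have "negligible (?g ` (T ` S))"
  proof (rule baby_Sard)
    fix y assume "y \<in> T ` S"
    then have y: "T' y \<in> S" using T by auto
    have "(f has_derivative f' (T' y)) (at (T' y) within T' ` (T ` S))"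
      by (rule has_derivative_at_withinI[OF der[OF y]])
    then have "((\<lambda>y. f (T' y)) has_derivative (\<lambda>w. f' (T' y) (T' w))) (at y within T ` S)"
      by (rule has_derivative_in_compose[OF dT(2)])
    then show der': "(?g has_derivative (\<lambda>w. T (f' (T' y) (T' w)))) (at y within T ` S)"
      by (rule has_derivative_compose[OF _ dT(1)])
    have lin: "linear (\<lambda>w. T (f' (T' y) (T' w)))" using der' has_derivative_linear by blast
    have "\<not> inj (\<lambda>w. T (f' (T' y) (T' w)))"
    proof
      assume inj: "inj (\<lambda>w. T (f' (T' y) (T' w)))"
      have "inj (f' (T' y))"
      proof (rule injI)
        fix a b assume "f' (T' y) a = f' (T' y) b"
        then have "T (f' (T' y) (T' (T a))) = T (f' (T' y) (T' (T b)))" by (simp add: T)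
        then have "T a = T b" using inj by (auto dest: injD)
        then show "a = b" using T(3) by metis
      qed
      then show False using ninj[OF y] by blast
    qed
    moreover have "(*v) (matrix (\<lambda>w. T (f' (T' y) (T' w)))) = (\<lambda>w. T (f' (T' y) (T' w)))"
      using lin by simp
    ultimately show "rank (matrix (\<lambda>w. T (f' (T' y) (T' w)))) < CARD('a bit0)"
      unfolding less_rank_noninjective by simp
  qed simp
  then have "negligible (T' ` (?g ` (T ` S)))"
    by (rule negligible_differentiable_image_negligible[rotated])
       (use dT(2) in \<open>auto simp: differentiable_on_def differentiable_def\<close>)
  moreover have "T' ` (?g ` (T ` S)) = f ` S" by (simp add: image_image T)
  ultimately show ?thesis by simp
qed

text \<open>Fubini along rays from a point \<open>c\<close> outside the zero set: every ray meets it in a null set.\<close>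

lemma negligible_zeros_along_rays:
  fixes h :: "'v::euclidean_space \<Rightarrow> complex"
  assumes "open U" "convex U" "continuous_on U h" "c \<in> U"
    and ray: "\<And>x. x \<in> U \<Longrightarrow> countable {t \<in> {0..1}. h (c + t *\<^sub>R (x - c)) = 0}"
  shows "negligible {x \<in> U. h x = 0}"
proof -
  have inU: "c + t *\<^sub>R (x - c) \<in> U" if "x \<in> U" "t \<in> {0..1}" for x t
  proof -
    have "(1 - t) *\<^sub>R c + t *\<^sub>R x \<in> U" using that assms(2,4) by (intro convexD) auto
    then show ?thesis by (simp add: algebra_simps)
  qed
  \<comment> \<open>Contraction towards \<open>c\<close> with ratio \<open>t\<close> maps
    \<open>A t\<close> into the zero set; for ratios tending to 1 these images cover it.\<close>
  define A where "A t = {x \<in> U. h (c + t *\<^sub>R (x - c)) = 0}" for t :: real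
  define E where "E = {z \<in> {1/2<..<1::real} \<times> U. h (c + fst z *\<^sub>R (snd z - c)) = 0}"
  have openP: "open ({1/2<..<1::real} \<times> U)" using assms(1) by (intro open_Times) auto
  have contP: "continuous_on ({1/2<..<1::real} \<times> U) (\<lambda>z. h (c + fst z *\<^sub>R (snd z - c)))"
    by (rule continuous_on_compose2[OF assms(3)]) (auto intro!: continuous_intros inU)
  have "open {z \<in> {1/2<..<1::real} \<times> U. h (c + fst z *\<^sub>R (snd z - c)) \<in> - {0}}"
    using continuous_open_preimage[OF contP openP open_Compl[OF closed_singleton[of 0]]] by (simp add: vimage_def Int_def)
  moreover have "E = {1/2<..<1::real} \<times> U - {z \<in> {1/2<..<1::real} \<times> U. h (c + fst z *\<^sub>R (snd z - c)) \<in> - {0}}"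
    by (auto simp: E_def)
  ultimately have "E \<in> sets borel"
    by (simp only:) (intro sets.Diff borel_open openP, assumption)
  then have E_sets: "E \<in> sets (lborel \<Otimes>\<^sub>M lborel)" unfolding lborel_prod by simp
  \<comment> \<open>Fubini: for fixed \<open>x\<close> the section is countable by
    \<open>ray\<close>, so \<open>E\<close> is null and hence almost every \<open>A t\<close> is
    null.\<close>
  have "emeasure (lborel \<Otimes>\<^sub>M lborel) E = (\<integral>\<^sup>+ x. emeasure lborel ((\<lambda>t. (t, x)) -` E) \<partial>lborel)"
    by (rule lborel_pair.emeasure_pair_measure_alt2[OF E_sets])
  also have "\<dots> = (\<integral>\<^sup>+ x. 0 \<partial>(lborel :: 'v measure))"
  proof (rule nn_integral_cong)
    fix x
    have "countable ((\<lambda>t. (t, x)) -` E)"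
    proof (cases "x \<in> U")
      case True
      show ?thesis by (rule countable_subset[OF _ ray[OF True]]) (auto simp: E_def)
    next
      case False
      then have "(\<lambda>t. (t, x)) -` E = {}" by (auto simp: E_def)
      then show ?thesis by simp
    qed
    then show "emeasure lborel ((\<lambda>t. (t, x)) -` E) = 0" by (rule emeasure_lborel_countable)
  qed
  finally have "emeasure (lborel \<Otimes>\<^sub>M lborel) E = 0" by simp
  moreover have "emeasure (lborel \<Otimes>\<^sub>M lborel) E = (\<integral>\<^sup>+ t. emeasure lborel (Pair t -` E) \<partial>lborel)"
    by (rule lborel.emeasure_pair_measure_alt[OF E_sets])
  ultimately have "(\<integral>\<^sup>+ t. emeasure lborel (Pair t -` E) \<partial>lborel) = 0" by simp
  then have AE: "AE t in lborel. emeasure lborel (Pair t -` E) = 0"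
    by (subst (asm) nn_integral_0_iff_AE) (rule lborel.measurable_emeasure_Pair[OF E_sets])
  \<comment> \<open>A null set of parameters contains no interval, so good ratios exist arbitrarily
    close to 1.\<close>
  have ex: "\<exists>t. 1 - 1 / real (k + 2) < t \<and> t < 1 \<and> negligible (A t)" for k :: nat
  proof (rule ccontr)
    assume neg: "\<not> ?thesis"
    let ?I = "{1 - 1 / real (k + 2)<..<1}"
    have half: "1 - 1 / real (k + 2) \<ge> 1 / 2" by (simp add: field_simps)
    from AE obtain N where N: "N \<in> null_sets lborel" "{t. \<not> emeasure lborel (Pair t -` E) = 0} \<subseteq> N"
      unfolding eventually_ae_filter by auto
    have "?I \<subseteq> N"
    proof
      fix t assume t: "t \<in> ?I"
      then have "1 - 1 / real (k + 2) < t" "t < 1" by (auto simp only: greaterThanLessThan_iff)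
      then have "1 / 2 < t" by (intro le_less_trans[OF half])
      then have "Pair t -` E = A t" using \<open>t < 1\<close> by (auto simp: E_def A_def)
      moreover have "\<not> negligible (A t)" using neg t by auto
      moreover have "Pair t -` E \<in> sets lborel" using sets_Pair1[OF E_sets] by simp
      ultimately have "emeasure lborel (Pair t -` E) \<noteq> 0"
        unfolding negligible_iff_null_sets using null_sets_completionI[OF null_setsI, of lborel "A t"] by auto
      then show "t \<in> N" using N(2) by auto
    qed
    then have "emeasure lborel ?I \<le> emeasure lborel N" using N(1) by (intro emeasure_mono) auto
    then have "emeasure lborel ?I = 0" using N(1) by auto
    then show False by simp
  qed
  then obtain t where t: "\<And>k :: nat. 1 - 1 / real (k + 2) < t k \<and> t k < 1 \<and> negligible (A (t k))" by metis
  have tpos: "t k > 0" for k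
  proof -
    have "1 - 1 / real (k + 2) \<ge> 0" by simp
    then show ?thesis using t[of k] by linarith
  qed
  have neg: "negligible ((\<lambda>x. c + t k *\<^sub>R (x - c)) ` A (t k))" for k
  proof (rule negligible_differentiable_image_negligible)
    have "((\<lambda>x. c + t k *\<^sub>R (x - c)) has_derivative (\<lambda>w. t k *\<^sub>R w)) (at x within S)" for x S
      by (auto intro!: derivative_eq_intros)
    then show "(\<lambda>x. c + t k *\<^sub>R (x - c)) differentiable_on A (t k)"
      unfolding differentiable_on_def differentiable_def by blast
  qed (use t in blast)+
  have "{x \<in> U. h x = 0} \<subseteq> (\<Union>k. (\<lambda>x. c + t k *\<^sub>R (x - c)) ` A (t k))"
  proof
    fix x assume x: "x \<in> {x \<in> U. h x = 0}"
    have "(\<lambda>k. 1 / real (k + 2)) \<longlonglongrightarrow> 0"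
      by (rule LIMSEQ_ignore_initial_segment[OF lim_1_over_n])
    then have "(\<lambda>k. 1 - 1 / real (k + 2)) \<longlonglongrightarrow> 1 - 0" by (intro tendsto_intros)
    then have lim1: "(\<lambda>k. 1 - 1 / real (k + 2)) \<longlonglongrightarrow> 1" by simp
    have "t \<longlonglongrightarrow> 1"
    proof (rule tendsto_sandwich[OF _ _ lim1 tendsto_const])
      show "\<forall>\<^sub>F k in sequentially. 1 - 1 / real (k + 2) \<le> t k"
        by (rule always_eventually) (use t less_imp_le in blast)
      show "\<forall>\<^sub>F k in sequentially. t k \<le> 1"
        by (rule always_eventually) (use t less_imp_le in blast)
    qed
    then have "(\<lambda>k. c + (1 / t k) *\<^sub>R (x - c)) \<longlonglongrightarrow> c + (1 / 1) *\<^sub>R (x - c)"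
      by (intro tendsto_intros) auto
    then have "(\<lambda>k. c + (1 / t k) *\<^sub>R (x - c)) \<longlonglongrightarrow> x" by simp
    then have "\<forall>\<^sub>F k in sequentially. c + (1 / t k) *\<^sub>R (x - c) \<in> U"
      using assms(1) x by (intro topological_tendstoD) auto
    then obtain k where k: "c + (1 / t k) *\<^sub>R (x - c) \<in> U" by (auto simp: eventually_sequentially)
    let ?y = "c + (1 / t k) *\<^sub>R (x - c)"
    have eq: "c + t k *\<^sub>R (?y - c) = x" using tpos[of k] by simp
    have "?y \<in> A (t k)" unfolding A_def mem_Collect_eq eq using k x by simp
    then show "x \<in> (\<Union>k. (\<lambda>x. c + t k *\<^sub>R (x - c)) ` A (t k))"
      by (intro UN_I[of k] image_eqI[of _ _ ?y] eq[symmetric] UNIV_I)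
  qed
  moreover have "negligible (\<Union>k. (\<lambda>x. c + t k *\<^sub>R (x - c)) ` A (t k))"
    using neg by (intro negligible_countable_Union) auto
  ultimately show ?thesis by (rule negligible_subset[rotated])
qed

lemma smult_of_real: "complex_of_real a *s v = a *\<^sub>R v" for v :: "complex ^ 'a::finite"
  unfolding vec_eq_iff vector_smult_component vector_scaleR_component by (simp add: scaleR_conv_of_real)

text \<open>On the complex line through \<open>c\<close> and \<open>x\<close> the function is
  holomorphic on a convex open set and nonzero at \<open>c\<close>, so the compact segment from
  \<open>c\<close> to \<open>x\<close> contains finitely many zeros.\<close>

lemma negligible_analytic_zeros:
  fixes h :: "complex ^ 'a::finite \<Rightarrow> complex"
  assumes U: "open U" "convex U" and h: "continuous_on U h" and c: "c \<in> U" "h c \<noteq> 0"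
    and holo: "\<And>x. x \<in> U \<Longrightarrow> (\<lambda>s. h (c + s *s (x - c))) holomorphic_on {s. c + s *s (x - c) \<in> U}"
  shows "negligible {x \<in> U. h x = 0}"
proof (rule negligible_zeros_along_rays[OF U h c(1)])
  fix x assume x: "x \<in> U"
  let ?D = "{s. c + s *s (x - c) \<in> U}"
  let ?k = "\<lambda>s. h (c + s *s (x - c))"
  have aff: "c + (u *\<^sub>R a + v *\<^sub>R b) *s (x - c) = u *\<^sub>R (c + a *s (x - c)) + v *\<^sub>R (c + b *s (x - c))"
    if "u + v = 1" for u v a b
  proof -
    have "c = (u + v) *\<^sub>R c" using that by simp
    then have "c = u *\<^sub>R c + v *\<^sub>R c" by (simp only: scaleR_left_distrib)
    then have "c + (u *\<^sub>R a + v *\<^sub>R b) *s (x - c)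
        = u *\<^sub>R c + v *\<^sub>R c + (u *\<^sub>R a + v *\<^sub>R b) *s (x - c)" by (rule arg_cong)
    also have "\<dots> = u *\<^sub>R (c + a *s (x - c)) + v *\<^sub>R (c + b *s (x - c))"
      unfolding vec_eq_iff vector_smult_component vector_scaleR_component vector_add_component vector_minus_component
      by (simp add: scaleR_conv_of_real algebra_simps)
    finally show ?thesis .
  qed
  have conv: "convex ?D"
  proof (rule convexI)
    fix a b and u v :: real assume "a \<in> ?D" "b \<in> ?D" "0 \<le> u" "0 \<le> v" "u + v = 1"
    then show "u *\<^sub>R a + v *\<^sub>R b \<in> ?D"
      unfolding mem_Collect_eq aff[OF \<open>u + v = 1\<close>] by (intro convexD[OF U(2)])
  qed
  have cont: "continuous_on UNIV (\<lambda>s. c + s *s (x - c))"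
  proof -
    have "(\<lambda>s. c + s *s (x - c)) = (\<lambda>s. \<chi> i. c $ i + s * (x - c) $ i)" 
      by (intro ext vec_eq_iff[THEN iffD2] allI)
         (simp only: vector_add_component vector_smult_component vec_lambda_beta)
    then show ?thesis by (simp only:) (intro continuous_on_vec_lambda continuous_intros)
  qed
  have opn: "open ?D" using open_vimage[OF U(1) cont] by (simp only: vimage_def)
  have 01: "0 \<in> ?D" "1 \<in> ?D" using c x by auto
  let ?K = "complex_of_real ` {0..1}"
  have K: "?K \<subseteq> ?D"
  proof
    fix z assume "z \<in> ?K"
    then obtain t where t: "z = complex_of_real t" "0 \<le> t" "t \<le> 1" by auto
    have "(1 - t) *\<^sub>R 0 + t *\<^sub>R 1 \<in> ?D" using conv 01 t by (intro convexD) auto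
    then show "z \<in> ?D" using t by (simp add: scaleR_conv_of_real)
  qed
  have "finite {z \<in> ?K. ?k z = 0}"
  proof (cases "?k constant_on ?D")
    case True
    then obtain y where y: "\<And>z. z \<in> ?D \<Longrightarrow> ?k z = y" unfolding constant_on_def by blast
    then have "y \<noteq> 0" using y[OF 01(1)] c(2) by simp
    then have "{z \<in> ?K. ?k z = 0} = {}" using K y by blast
    then show ?thesis by (simp only: finite.emptyI)
  next
    case False
    show ?thesis
      by (rule holomorphic_compact_finite_zeros[OF holo[OF x] opn convex_connected[OF conv] _ K False])
         (intro compact_continuous_image continuous_intros, simp)
  qed
  then have "finite (complex_of_real -` {z \<in> ?K. ?k z = 0})"
    by (rule finite_vimageI) (simp add: inj_of_real)
  moreover have "{t \<in> {0..1}. h (c + t *\<^sub>R (x - c)) = 0} \<subseteq> complex_of_real -` {z \<in> ?K. ?k z = 0}"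
  proof
    fix t assume t: "t \<in> {t \<in> {0..1}. h (c + t *\<^sub>R (x - c)) = 0}"
    then have "?k (complex_of_real t) = 0" unfolding smult_of_real by blast
    moreover have "complex_of_real t \<in> ?K" using t by blast
    ultimately show "t \<in> complex_of_real -` {z \<in> ?K. ?k z = 0}" by blast
  qed
  ultimately show "countable {t \<in> {0..1}. h (c + t *\<^sub>R (x - c)) = 0}"
    by (meson countable_finite finite_subset)
qed

section \<open>Local charts of the incidence variety\<close>

definition grad :: "'a::finite cpoly \<Rightarrow> complex ^ 'a \<Rightarrow> complex ^ 'a" where
  "grad f y = (\<chi> k. eval_poly (partial k f) y)"

definition dot :: "complex ^ 'a::finite \<Rightarrow> complex ^ 'a \<Rightarrow> complex" where
  "dot r w = (\<Sum>k\<in>UNIV. r $ k * w $ k)"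

lemma D1_eq_dot: "D1 f y w = dot (grad f y) w"
  by (simp add: D1_def dot_def grad_def)

lemma dot_axis: "dot (axis i 1) w = w $ i"
proof -
  have "dot (axis i 1) w = (\<Sum>k\<in>UNIV. if k = i then w $ k else 0)"
    unfolding dot_def by (intro sum.cong) (auto simp: axis_def)
  then show ?thesis by simp
qed

lemma grad_coord_poly: "grad (coord_poly i) y = axis i 1"
proof -
  have "eval_poly (partial k (coord_poly i)) y = (if k = i then 1 else 0)" for k
  proof -
    have "Poly_Mapping.single i (1 :: nat) - Poly_Mapping.single i 1 = 0" by simp
    then show ?thesis
      unfolding coord_poly_def partial_single
      by (auto simp: eval_poly_single lookup_single eval_monom_def)
  qed
  then show ?thesis by (simp add: grad_def vec_eq_iff axis_def)
qed

lemma dot_span: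
  assumes "r \<in> vec.span B" "\<And>b. b \<in> B \<Longrightarrow> dot b w = 0"
  shows "dot r w = 0"
proof -
  have "vec.subspace {r. dot r w = 0}"
    by (rule vec.subspaceI) (auto simp: dot_def distrib_right sum.distrib mult.assoc sum_distrib_left[symmetric])
  then have "vec.span B \<subseteq> {r. dot r w = 0}" using assms(2) by (intro vec.span_minimal) auto
  then show ?thesis using assms(1) by auto
qed

text \<open>The gradients at a smooth point span a space of dimension \<open>n\<close>, the
  codimension of the tangent cone. A basis of them is placed at the indices in \<open>J1\<close>,
  the normalizing coordinate at \<open>j0\<close>, and further coordinate forms complete it to an
  invertible Jacobian.\<close>

lemma chart_polys:
  fixes F :: "'a::finite cpoly set" and J1 :: "'a set" and j0 :: 'a
  assumes card: "CARD('a) = 2 * n + 1" and hom: "\<And>f. f \<in> F \<Longrightarrow> homogeneous f"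
    and y0: "y0 \<in> smooth_of F n" "y0 $ i \<noteq> 0" and J1: "card J1 = n" "j0 \<notin> J1"
  shows "\<exists>f. f j0 = coord_poly i \<and> (\<forall>j\<in>J1. f j \<in> F) \<and> (\<forall>j. homogeneous (f j)) \<and>
     (\<forall>w. (\<forall>j. D1 (f j) y0 w = 0) \<longrightarrow> w = 0)"
proof -
  let ?R = "(\<lambda>f. grad f y0) ` F"
  let ?e = "axis i (1 :: complex) :: complex ^ 'a"
  obtain B where B: "B \<subseteq> ?R" "vec.independent B" "?R \<subseteq> vec.span B" by (rule vec.basis_exists)
  have self: "y0 \<in> tan_of F y0" using self_in_tan_of[OF hom] y0(1) by (auto simp: smooth_of_def)
  \<comment> \<open>By Euler's formula all gradients annihilate \<open>y0\<close>, whereas the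
    coordinate form \<open>i\<close> does not.\<close>
  have "?e \<notin> vec.span B"
  proof
    assume "?e \<in> vec.span B"
    then have "dot ?e y0 = 0"
    proof (rule dot_span)
      fix b assume "b \<in> B"
      then show "dot b y0 = 0" using B(1) self by (auto simp: tan_of_def D1_eq_dot)
    qed
    then show False using y0(2) by (simp add: dot_axis)
  qed
  then have eB: "vec.independent (insert ?e B)" "?e \<notin> B"
    using B(2) vec.span_base[of ?e B] by (auto simp: vec.independent_insert)
  let ?S = "insert ?e B \<union> range (\<lambda>k. axis k (1 :: complex))"
  obtain B' where B': "insert ?e B \<subseteq> B'" "B' \<subseteq> ?S" "vec.independent B'" "?S \<subseteq> vec.span B'"
    using vec.maximal_independent_subset_extend[of "insert ?e B" ?S] eB(1) by blast
  have spanB': "w \<in> vec.span B'" for w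
  proof -
    have "(\<Sum>k\<in>UNIV. (w $ k) *s axis k 1) \<in> vec.span B'"
      using B'(4) by (intro vec.span_sum vec.span_scale) auto
    then show ?thesis by (simp add: basis_expansion)
  qed
  have finB': "finite B'" by (rule vec.finiteI_independent[OF B'(3)])
  have finB: "finite B" using finB' B'(1) by (auto intro: finite_subset)
  have "vec.dim (UNIV :: (complex ^ 'a) set) = card B'"
    by (rule vec.dim_unique[of B']) (use B'(3) spanB' in auto)
  then have cardB': "card B' = CARD('a)" by (metis vec_dim_card)
  have zero: "w = 0" if "\<And>b. b \<in> B' \<Longrightarrow> dot b w = 0" for w
  proof -
    have "dot (axis k 1) w = 0" for k using dot_span[OF spanB' that] by blast
    then show ?thesis by (simp add: dot_axis vec_eq_iff)
  qed
  \<comment> \<open>In the linear coordinates given by \<open>B'\<close> the tangent cone is the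
    subspace where the coordinates from \<open>B\<close> vanish; its dimension \<open>n + 1\<close>
    determines the size of \<open>B\<close>.\<close>
  have cardB: "card B = n"
  proof -
    have "card (UNIV :: 'a set) = card B'" by (simp add: cardB')
    then obtain r where r: "bij_betw r (UNIV :: 'a set) B'"
      using finite_same_card_bij[of "UNIV :: 'a set" B'] finB' by auto
    define M where "M = (\<chi> j. r j)"
    have M: "(M *v w) $ j = dot (r j) w" for w j by (simp add: M_def matrix_vector_mult_def dot_def)
    have inj: "inj ((*v) M)"
    proof (rule injI)
      fix a b assume "M *v a = M *v b"
      then have "M *v (a - b) = 0" by (simp add: matrix_vector_mult_diff_distrib)
      then have "dot (r j) (a - b) = 0" for j using M[of "a - b" j] by simp
      then have "a - b = 0" using r by (intro zero) (auto simp: bij_betw_def)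
      then show "a = b" by simp
    qed
    have lin: "Vector_Spaces.linear (*s) (*s) ((*v) M)" by (rule matrix_vector_mul_linear_gen)
    have surj: "surj ((*v) M)" by (rule vec.linear_injective_imp_surjective[OF lin inj]) (rule refl)
    let ?D = "{j. r j \<notin> B}"
    have tan: "tan_of F y0 = {w. \<forall>b\<in>B. dot b w = 0}"
    proof -
      have "(\<forall>f\<in>F. dot (grad f y0) w = 0) \<longleftrightarrow> (\<forall>b\<in>B. dot b w = 0)" for w
      proof
        assume *: "\<forall>f\<in>F. dot (grad f y0) w = 0"
        show "\<forall>b\<in>B. dot b w = 0"
        proof
          fix b assume "b \<in> B"
          then obtain f where "f \<in> F" "b = grad f y0" using B(1) by blast
          then show "dot b w = 0" using * by simp
        qed
      next
        assume *: "\<forall>b\<in>B. dot b w = 0"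
        show "\<forall>f\<in>F. dot (grad f y0) w = 0"
        proof
          fix f assume "f \<in> F"
          then have "grad f y0 \<in> vec.span B" using B(3) by blast
          then show "dot (grad f y0) w = 0" by (rule dot_span) (use * in blast)
        qed
      qed
      then show ?thesis by (simp add: tan_of_def D1_eq_dot)
    qed
    have img: "(*v) M ` tan_of F y0 = {z. \<forall>j. j \<notin> ?D \<longrightarrow> z $ j = 0}"
    proof (intro equalityI subsetI)
      fix z assume "z \<in> (*v) M ` tan_of F y0"
      then show "z \<in> {z. \<forall>j. j \<notin> ?D \<longrightarrow> z $ j = 0}" by (auto simp: tan M)
    next
      fix z :: "complex ^ 'a" assume z: "z \<in> {z. \<forall>j. j \<notin> ?D \<longrightarrow> z $ j = 0}"
      obtain w where w: "z = M *v w" using surj by (metis surjD)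
      have "dot b w = 0" if "b \<in> B" for b
      proof -
        have "b \<in> r ` UNIV" using r B'(1) that by (auto simp: bij_betw_def)
        then obtain j where "b = r j" by blast
        then show ?thesis using z w that M[of w j] by simp
      qed
      then have "w \<in> tan_of F y0" unfolding tan by simp
      then show "z \<in> (*v) M ` tan_of F y0" unfolding w by (rule imageI)
    qed
    have "vec.dim ((*v) M ` tan_of F y0) = vec.dim (tan_of F y0)"
      by (rule vec.dim_image_eq[OF lin]) (use inj in \<open>auto intro: inj_on_subset\<close>)
    then have "vec.dim (tan_of F y0) = vec.dim ((*v) M ` tan_of F y0)" by (rule sym)
    also have "\<dots> = card ?D" unfolding img by (rule dim_substandard_cart)
    finally have "vec.dim (tan_of F y0) = card ?D" .
    moreover have "vec.dim (tan_of F y0) = n + 1" using y0(1) by (simp add: smooth_of_def)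
    moreover have "card ?D = CARD('a) - card B"
    proof -
      have "r ` ?D = B' - B" using r by (auto simp: bij_betw_def)
      moreover have "inj_on r ?D" using r inj_on_subset[of r UNIV ?D] by (simp add: bij_betw_def)
      ultimately have "card ?D = card (B' - B)" using card_image[of r ?D] by simp
      also have "\<dots> = CARD('a) - card B" using finB B'(1) cardB' by (subst card_Diff_subset) auto
      finally show ?thesis .
    qed
    moreover have "card B \<le> CARD('a)" using card_mono[OF finB'] B'(1) cardB' by auto
    ultimately show ?thesis using card by linarith
  qed
  have "UNIV - J1 - {j0} = UNIV - insert j0 J1" by auto
  then have card1: "card (UNIV - J1 - {j0}) = n"
    using card_Diff_subset[of "insert j0 J1" UNIV] J1 card by simp
  have card2: "card (B' - insert ?e B) = n"
    using card_Diff_subset[of "insert ?e B" B'] B'(1) finB cardB cardB' card eB(2) by simp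
  have "card (UNIV - J1 - {j0}) = card (B' - insert ?e B)" unfolding card1 card2 ..
  from finite_same_card_bij[OF finite finite_Diff[OF finB'] this]
  obtain b2 where b2: "bij_betw b2 (UNIV - J1 - {j0}) (B' - insert ?e B)" by blast
  have "card J1 = card B" using cardB J1(1) by simp
  from finite_same_card_bij[OF finite finB this] obtain b1 where b1: "bij_betw b1 J1 B" by blast
  have ex1: "\<exists>f. f \<in> F \<and> grad f y0 = b1 j" if "j \<in> J1" for j
  proof -
    have "b1 j \<in> B" using bij_betwE[OF b1] that by blast
    then obtain f where "f \<in> F" "b1 j = grad f y0" using B(1) by blast
    then show ?thesis by auto
  qed
  have ex2: "\<exists>k. axis k 1 = b2 j" if "j \<in> UNIV - J1 - {j0}" for j
  proof -
    have "b2 j \<in> B' - insert ?e B" using bij_betwE[OF b2] that by blast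
    then obtain k where "b2 j = axis k 1" using B'(2) by blast
    then show ?thesis by auto
  qed
  define f where "f j = (if j = j0 then coord_poly i else if j \<in> J1 then (SOME f. f \<in> F \<and> grad f y0 = b1 j)
      else coord_poly (SOME k. axis k (1 :: complex) = b2 j))" for j
  have f1: "f j \<in> F \<and> grad (f j) y0 = b1 j" if "j \<in> J1" for j
    using someI_ex[OF ex1[OF that]] that J1(2) by (auto simp: f_def)
  have f2: "grad (f j) y0 = b2 j" if "j \<in> UNIV - J1 - {j0}" for j
    using someI_ex[OF ex2[OF that]] that by (simp add: f_def grad_coord_poly)
  have f0: "f j0 = coord_poly i" by (simp add: f_def)
  have cp: "homogeneous (coord_poly k)" for k :: 'a
    using hom_deg_coord_poly homogeneous_iff_hom_deg by blast
  have "homogeneous (f j)" for j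
    using f1[of j] hom cp by (cases "j = j0"; cases "j \<in> J1") (auto simp: f_def)
  moreover have "w = 0" if w: "\<forall>j. D1 (f j) y0 w = 0" for w
  proof (rule zero)
    fix b assume "b \<in> B'"
    then consider "b = ?e" | "b \<in> B" | "b \<in> B' - insert ?e B" by blast
    then have "\<exists>j. grad (f j) y0 = b"
    proof cases
      case 1
      then show ?thesis using f0 grad_coord_poly by metis
    next
      case 2
      then have "b \<in> b1 ` J1" using b1 by (simp add: bij_betw_def)
      then show ?thesis using f1 by (metis imageE)
    next
      case 3
      then have "b \<in> b2 ` (UNIV - J1 - {j0})" using b2 by (simp add: bij_betw_def)
      then show ?thesis using f2 by (metis imageE)
    qed
    then show "dot b w = 0" using w by (auto simp: D1_eq_dot)
  qed
  ultimately show ?thesis using f0 f1 by (intro exI[of _ f]) auto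
qed

lemma has_derivative_vec:
  fixes g :: "'i::finite \<Rightarrow> 'v::real_normed_vector \<Rightarrow> 'b::euclidean_space"
  assumes "\<And>i. (g i has_derivative g' i) (at x)"
  shows "((\<lambda>x. \<chi> i. g i x) has_derivative (\<lambda>w. \<chi> i. g' i w)) (at x)"
  by (subst has_derivative_componentwise_within)
     (auto simp: Basis_vec_def inner_axis intro!: has_derivative_inner_left assms)

text \<open>\<open>J1\<close> indexes the equations and \<open>j0\<close> the normalization. The
  bijection \<open>\<beta>\<close> stores the remaining coordinates of the base point in the entries
  of a parameter vector indexed by \<open>J1\<close>; the other entries describe the tangent vector,
  so both fit into one vector of \<open>complex ^ 'a\<close>.\<close>

locale chart =
  fixes f :: "'a::finite \<Rightarrow> 'a cpoly" and J1 :: "'a set" and j0 :: 'a and \<beta> :: "'a \<Rightarrow> 'a"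
  assumes j0: "j0 \<notin> J1" and \<beta>: "bij_betw \<beta> (UNIV - J1 - {j0}) J1"
begin

definition jac :: "complex ^ 'a \<Rightarrow> complex ^ 'a \<Rightarrow> complex ^ 'a" where
  "jac y w = (\<chi> j. D1 (f j) y w)"

text \<open>Straightening map: in the coordinates \<open>H z\<close> the set \<open>Inc\<close>
  becomes an affine coordinate subspace, parametrized by \<open>incl 1\<close>.\<close>

definition H :: "(complex ^ 'a) \<times> (complex ^ 'a) \<Rightarrow> (complex ^ 'a) \<times> (complex ^ 'a)" where
  "H z = ((\<chi> j. eval_poly (f j) (fst z)), jac (fst z) (snd z))"

definition H' :: "(complex ^ 'a) \<times> (complex ^ 'a) \<Rightarrow> (complex ^ 'a) \<times> (complex ^ 'a) \<Rightarrow> (complex ^ 'a) \<times> (complex ^ 'a)" where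
  "H' z w = (jac (fst z) (fst w), (\<chi> j. D2 (f j) (fst z) (fst w) (snd z) + D1 (f j) (fst z) (snd w)))"

text \<open>The value 1 of \<open>c\<close> gives points of the straightened set and the value 0 its
  directions, so \<open>incl 0\<close> is the derivative of \<open>incl 1\<close>.\<close>

definition incl :: "complex \<Rightarrow> complex ^ 'a \<Rightarrow> (complex ^ 'a) \<times> (complex ^ 'a)" where
  "incl c \<xi> = ((\<chi> j. if j = j0 then c else if j \<in> J1 then 0 else \<xi> $ \<beta> j), (\<chi> j. if j \<in> J1 then 0 else \<xi> $ j))"

definition proj :: "(complex ^ 'a) \<times> (complex ^ 'a) \<Rightarrow> complex ^ 'a" where
  "proj z = (\<chi> j. if j \<in> J1 then fst z $ the_inv_into (UNIV - J1 - {j0}) \<beta> j else snd z $ j)"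

text \<open>Only the equations indexed by \<open>J1\<close> are imposed; whether the remaining
  equations of the cone also hold on a chart is decided by \<open>eval_dichotomy\<close>.\<close>

definition Inc :: "((complex ^ 'a) \<times> (complex ^ 'a)) set" where
  "Inc = {z. eval_poly (f j0) (fst z) = 1 \<and> (\<forall>j\<in>J1. eval_poly (f j) (fst z) = 0 \<and> D1 (f j) (fst z) (snd z) = 0)}"

lemma incl_proj:
  assumes "fst z $ j0 = c" "\<And>j. j \<in> J1 \<Longrightarrow> fst z $ j = 0 \<and> snd z $ j = 0"
  shows "incl c (proj z) = z"
proof (rule prod_eqI)
  have "proj z $ \<beta> j = fst z $ j" if "j \<in> UNIV - J1 - {j0}" for j
  proof -
    have "\<beta> j \<in> J1" using \<beta> that by (auto simp: bij_betw_def)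
    moreover have "the_inv_into (UNIV - J1 - {j0}) \<beta> (\<beta> j) = j"
      using \<beta> that by (intro the_inv_into_f_f) (auto simp: bij_betw_def)
    ultimately show ?thesis by (simp add: proj_def)
  qed
  then show "fst (incl c (proj z)) = fst z" using assms by (auto simp: incl_def vec_eq_iff)
  show "snd (incl c (proj z)) = snd z" using assms by (auto simp: incl_def vec_eq_iff proj_def)
qed

lemma Inc_iff: "z \<in> Inc \<longleftrightarrow> fst (H z) $ j0 = 1 \<and> (\<forall>j\<in>J1. fst (H z) $ j = 0 \<and> snd (H z) $ j = 0)"
  by (simp add: Inc_def H_def jac_def)

lemma has_derivative_H: "(H has_derivative H' z) (at z)"
proof -
  have fst': "((\<lambda>z. eval_poly g (fst z)) has_derivative (\<lambda>w. D1 g (fst z) (fst w))) (at z)" for g :: "'a cpoly"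
    by (rule has_derivative_compose[OF _ has_derivative_eval_poly]) (auto intro: derivative_eq_intros)
  have snd': "((\<lambda>z :: (complex ^ 'a) \<times> (complex ^ 'a). snd z $ k) has_derivative (\<lambda>w. snd w $ k)) (at z)" for k
    by (rule bounded_linear_imp_has_derivative)
       (rule bounded_linear_compose[OF bounded_linear_vec_nth bounded_linear_snd])
  have D1': "((\<lambda>z. D1 g (fst z) (snd z)) has_derivative (\<lambda>w. D2 g (fst z) (fst w) (snd z) + D1 g (fst z) (snd w))) (at z)" for g :: "'a cpoly"
  proof -
    have "((\<lambda>z. \<Sum>k\<in>UNIV. eval_poly (partial k g) (fst z) * snd z $ k) has_derivative
       (\<lambda>w. \<Sum>k\<in>UNIV. eval_poly (partial k g) (fst z) * snd w $ k + D1 (partial k g) (fst z) (fst w) * snd z $ k)) (at z)"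
      by (intro has_derivative_sum has_derivative_mult fst' snd')
    then show ?thesis by (simp add: D1_def[of g] D2_def[of g] sum.distrib add.commute)
  qed
  show ?thesis
    unfolding H_def[abs_def] H'_def[abs_def] jac_def
    by (intro has_derivative_Pair has_derivative_vec fst' D1')
qed

lemma linear_H': "bounded_linear (H' z)"
  using has_derivative_H has_derivative_bounded_linear by blast

lemma continuous_on_H': "continuous_on UNIV (\<lambda>z. H' z w)"
  unfolding H'_def jac_def D2_def D1_def
  by (intro continuous_intros)

lemma H'_scale: "H' z (c *s a, c *s b) = (c *s fst (H' z (a, b)), c *s snd (H' z (a, b)))"
  by (simp add: H'_def jac_def D1_scale D2_scale_left vec_eq_iff distrib_left)

text \<open>The derivative is block triangular with \<open>jac (fst z)\<close> twice on the
  diagonal.\<close>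

lemma inj_H':
  assumes "\<And>w. jac (fst z) w = 0 \<Longrightarrow> w = 0"
  shows "inj (H' z)"
proof -
  interpret bounded_linear "H' z" by (rule linear_H')
  have "w = 0" if "H' z w = 0" for w
  proof -
    have 1: "fst w = 0" using that assms by (simp add: H'_def zero_prod_def)
    have "D2 (f j) (fst z) 0 (snd z) = 0" for j by (simp add: D2_def)
    then have "jac (fst z) (snd w) = 0" using that 1 by (simp add: H'_def zero_prod_def jac_def)
    then show ?thesis using assms 1 by (simp add: prod_eq_iff)
  qed
  then show ?thesis using linear_injective_0 linear_axioms by blast
qed

text \<open>The inverse function theorem for \<open>H\<close>, composed with \<open>incl 1\<close>.
  The derivative is recorded through its image under \<open>H'\<close>, which is the form the linear
  algebra uses, and the domain is a ball because the analytic dichotomy works on convex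
  sets.\<close>

lemma chart_exists:
  assumes z0: "z0 \<in> Inc" and inj: "\<And>w. jac (fst z0) w = 0 \<Longrightarrow> w = 0"
  shows "\<exists>N r \<xi>0 \<Theta> \<Theta>'. open N \<and> z0 \<in> N \<and> r > 0 \<and> \<Theta> \<xi>0 = z0 \<and>
     (\<forall>z\<in>N. z \<in> Inc \<longrightarrow> (\<exists>\<xi>\<in>ball \<xi>0 r. \<Theta> \<xi> = z)) \<and>
     (\<forall>\<xi>\<in>ball \<xi>0 r. \<Theta> \<xi> \<in> Inc \<and> (\<Theta> has_derivative \<Theta>' \<xi>) (at \<xi>) \<and>
        (\<forall>\<eta>. H' (\<Theta> \<xi>) (\<Theta>' \<xi> \<eta>) = incl 0 \<eta>) \<and> inj (H' (\<Theta> \<xi>)))"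
proof -
  define B where "B z = Blinfun (H' z)" for z
  have B: "blinfun_apply (B z) = H' z" for z unfolding B_def by (rule bounded_linear_Blinfun_apply[OF linear_H'])
  have contB: "continuous_on UNIV B"
    by (rule continuous_on_blinfun_componentwise) (simp add: B continuous_on_H')
  have "inj (H' z0)" by (rule inj_H'[OF inj])
  then obtain g where g: "linear g" "g \<circ> H' z0 = id"
    using linear_injective_left_inverse bounded_linear.linear[OF linear_H'] by blast
  have "bounded_linear g" using g(1) by (simp add: linear_conv_bounded_linear)
  then have inv: "Blinfun g o\<^sub>L B z0 = id_blinfun"
    by (intro blinfun_eqI) (simp add: B bounded_linear_Blinfun_apply pointfree_idE[OF g(2)])
  obtain U' V G G' where G: "open U'" "U' \<subseteq> UNIV" "z0 \<in> U'" "open V" "H z0 \<in> V" "homeomorphism U' V H G"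
    "\<And>y. y \<in> V \<Longrightarrow> (G has_derivative (G' y)) (at y)"
    "\<And>y. y \<in> V \<Longrightarrow> G' y = Hilbert_Choice.inv (blinfun_apply (B (G y)))"
    "\<And>y. y \<in> V \<Longrightarrow> bij (blinfun_apply (B (G y)))"
  proof -
    have d: "\<And>x. x \<in> UNIV \<Longrightarrow> (H has_derivative blinfun_apply (B x)) (at x)"
      by (simp add: B has_derivative_H)
    show thesis
      by (rule inverse_function_theorem[OF open_UNIV d contB UNIV_I inv]) (assumption, rule that, assumption+)
  qed
  define \<xi>0 where "\<xi>0 = proj (H z0)"
  have incl0: "incl 1 \<xi>0 = H z0"
    unfolding \<xi>0_def by (rule incl_proj) (use z0 in \<open>auto simp: Inc_iff\<close>)
  have d_incl: "(incl 1 has_derivative incl 0) (at \<xi>)" for \<xi>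
  proof -
    have 1: "((\<lambda>\<xi>. if j = j0 then 1 else if j \<in> J1 then 0 else \<xi> $ \<beta> j) has_derivative
        (\<lambda>\<eta>. if j = j0 then 0 else if j \<in> J1 then 0 else \<eta> $ \<beta> j)) (at \<xi>)" for j
      by (cases "j = j0"; cases "j \<in> J1") (auto intro: bounded_linear_imp_has_derivative bounded_linear_vec_nth)
    have 2: "((\<lambda>\<xi>. if j \<in> J1 then 0 else \<xi> $ j) has_derivative
        (\<lambda>\<eta>. if j \<in> J1 then 0 else \<eta> $ j)) (at \<xi>)" for j
      by (cases "j \<in> J1") (auto intro: bounded_linear_imp_has_derivative bounded_linear_vec_nth)
    show ?thesis unfolding incl_def[abs_def] by (intro has_derivative_Pair has_derivative_vec 1 2)
  qed
  have cont_incl: "continuous_on UNIV (incl 1)"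
    by (intro continuous_at_imp_continuous_on ballI has_derivative_continuous[OF d_incl])
  have "open (incl 1 -` V)" by (rule open_vimage[OF G(4) cont_incl])
  moreover have "\<xi>0 \<in> incl 1 -` V" using incl0 G(5) by simp
  ultimately obtain r where r: "r > 0" "ball \<xi>0 r \<subseteq> incl 1 -` V" using open_contains_ball by blast
  have cont_proj: "continuous_on UNIV (\<lambda>z. proj (H z))"
  proof -
    have "continuous_on UNIV H"
      by (intro continuous_at_imp_continuous_on ballI has_derivative_continuous[OF has_derivative_H])
    moreover have "continuous_on UNIV proj"
      unfolding proj_def[abs_def]
    proof (rule continuous_on_vec_lambda)
      fix j show "continuous_on UNIV (\<lambda>z :: (complex ^ 'a) \<times> (complex ^ 'a). if j \<in> J1 then fst z $ the_inv_into (UNIV - J1 - {j0}) \<beta> j else snd z $ j)"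
        by (cases "j \<in> J1") (auto intro!: continuous_intros)
    qed
    ultimately show ?thesis using continuous_on_compose2[of UNIV proj UNIV H] by simp
  qed
  define N where "N = U' \<inter> (\<lambda>z. proj (H z)) -` ball \<xi>0 r"
  define \<Theta> where "\<Theta> \<xi> = G (incl 1 \<xi>)" for \<xi>
  define \<Theta>' where "\<Theta>' \<xi> \<eta> = G' (incl 1 \<xi>) (incl 0 \<eta>)" for \<xi> \<eta>
  have GH: "G (H z) = z" if "z \<in> U'" for z using G(6) that by (simp add: homeomorphism_def)
  have HG: "H (G y) = y" if "y \<in> V" for y using G(6) that by (simp add: homeomorphism_def)
  show ?thesis
  proof (intro exI conjI ballI impI allI)
    show "open N" unfolding N_def by (intro open_Int G(1) open_vimage[OF open_ball cont_proj])
    show "z0 \<in> N" using G(3) r(1) by (simp add: N_def \<xi>0_def[symmetric])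
    show "r > 0" by (rule r(1))
    show "\<Theta> \<xi>0 = z0" unfolding \<Theta>_def incl0 by (rule GH[OF G(3)])
  next
    fix z assume z: "z \<in> N" "z \<in> Inc"
    then have "incl 1 (proj (H z)) = H z" by (intro incl_proj) (auto simp: Inc_iff)
    then have "\<Theta> (proj (H z)) = z" using GH z(1) by (simp add: \<Theta>_def N_def)
    then show "\<exists>\<xi>\<in>ball \<xi>0 r. \<Theta> \<xi> = z" using z(1) by (intro bexI[of _ "proj (H z)"]) (auto simp: N_def)
  next
    fix \<xi> assume "\<xi> \<in> ball \<xi>0 r"
    then have V: "incl 1 \<xi> \<in> V" using r(2) by auto
    have "H (\<Theta> \<xi>) = incl 1 \<xi>" unfolding \<Theta>_def by (rule HG[OF V])
    then show "\<Theta> \<xi> \<in> Inc" using j0 by (auto simp: Inc_iff incl_def)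
    show "(\<Theta> has_derivative \<Theta>' \<xi>) (at \<xi>)"
      unfolding \<Theta>_def[abs_def] \<Theta>'_def[abs_def]
      by (rule has_derivative_compose[OF d_incl G(7)[OF V]])
    have bij: "bij (H' (\<Theta> \<xi>))" using G(9)[OF V] by (simp add: B \<Theta>_def)
    then show "inj (H' (\<Theta> \<xi>))" by (simp add: bij_def)
    show "H' (\<Theta> \<xi>) (\<Theta>' \<xi> \<eta>) = incl 0 \<eta>" for \<eta>
      unfolding \<Theta>'_def G(8)[OF V] B \<Theta>_def[symmetric] using bij by (simp add: bij_def surj_f_inv_f)
  qed
qed

end

section \<open>Limits of tangent conditions along a curve\<close>

lemma has_derivative_line:
  fixes v w :: "complex ^ 'a::finite"
  shows "((\<lambda>t. v + t *s w) has_derivative (\<lambda>s. s *s w)) (at t)"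
proof -
  have "((\<lambda>t. \<chi> i. v $ i + t * w $ i) has_derivative (\<lambda>s. \<chi> i. s * w $ i)) (at t)"
    by (rule has_derivative_vec) (auto intro!: derivative_eq_intros)
  moreover have "(\<lambda>t. \<chi> i. v $ i + t * w $ i) = (\<lambda>t. v + t *s w)"
    by (intro ext vec_eq_iff[THEN iffD2] allI) (simp only: vector_add_component vector_smult_component vec_lambda_beta)
  moreover have "(\<lambda>s. \<chi> i. s * w $ i) = (\<lambda>s. s *s w)"
    by (intro ext vec_eq_iff[THEN iffD2] allI) (simp only: vector_smult_component vec_lambda_beta)
  ultimately show ?thesis by simp
qed

lemma eval_poly_line_deriv:
  "((\<lambda>t. eval_poly f (v + t *s w)) has_field_derivative D1 f (v + t *s w) w) (at t)"
proof -
  have "((\<lambda>t. eval_poly f (v + t *s w)) has_derivative (\<lambda>s. D1 f (v + t *s w) (s *s w))) (at t)"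
    by (rule has_derivative_compose[OF has_derivative_line has_derivative_eval_poly])
  moreover have "(\<lambda>s. D1 f (v + t *s w) (s *s w)) = (*) (D1 f (v + t *s w) w)"
    by (auto simp: D1_scale mult.commute)
  ultimately show ?thesis by (simp add: has_field_derivative_def)
qed

lemma D1_line_deriv:
  "((\<lambda>t. D1 f (v + t *s w) w) has_field_derivative D2 f (v + t *s w) w w) (at t)"
  unfolding D1_def[of f] D2_def by (intro DERIV_sum DERIV_cmult_right eval_poly_line_deriv)

lemma eval_poly_line_taylor:
  obtains P d where "\<And>v w. degree (P v w) \<le> d"
    "\<And>j. continuous_on UNIV (\<lambda>z. coeff (P (fst z) (snd z)) j)"
    "\<And>v w t. eval_poly f (v + t *s w) = poly (P v w) t"
    "\<And>v w t. D1 f (v + t *s w) w = poly (pderiv (P v w)) t"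
    "\<And>v w. coeff (P v w) 0 = eval_poly f v" "\<And>v w. coeff (P v w) 1 = D1 f v w"
    "\<And>v w. 2 * coeff (P v w) 2 = D2 f v w w"
proof -
  obtain P d where P: "\<And>v w. degree (P v w) \<le> d"
    "\<And>j. continuous_on UNIV (\<lambda>z. coeff (P (fst z) (snd z)) j)"
    "\<And>v w t. eval_poly f (v + t *s w) = poly (P v w) t" by (rule eval_poly_line[of f]) (rule that)
  have 1: "D1 f (v + t *s w) w = poly (pderiv (P v w)) t" for v w t
    using eval_poly_line_deriv[of f v w t] poly_DERIV[of "P v w" t] unfolding P(3) by (rule DERIV_unique)
  have 2: "D2 f (v + t *s w) w w = poly (pderiv (pderiv (P v w))) t" for v w t
    using D1_line_deriv[of f v w t] poly_DERIV[of "pderiv (P v w)" t] unfolding 1 by (rule DERIV_unique)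
  show thesis
  proof
    show "coeff (P v w) 0 = eval_poly f v" for v w using P(3)[of v 0 w] by (simp add: poly_0_coeff_0)
    show "coeff (P v w) 1 = D1 f v w" for v w using 1[of v 0 w] by (simp add: poly_0_coeff_0 coeff_pderiv)
    show "2 * coeff (P v w) 2 = D2 f v w w" for v w
      using 2[of v 0 w] by (simp add: poly_0_coeff_0 coeff_pderiv numeral_2_eq_2)
  qed (fact P 1)+
qed

lemma poly_eq_sum_bound:
  fixes p :: "complex poly"
  assumes "degree p \<le> d"
  shows "poly p t = (\<Sum>m\<le>d. coeff p m * t ^ m)"
  unfolding poly_altdef by (rule sum.mono_neutral_left) (use assms in \<open>auto simp: coeff_eq_0\<close>)

lemma tendsto_eval_poly:
  assumes "(\<delta> \<longlongrightarrow> b) G"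
  shows "((\<lambda>k. eval_poly f (\<delta> k)) \<longlongrightarrow> eval_poly f b) G"
proof -
  have "isCont (eval_poly f) b" using has_derivative_continuous[OF has_derivative_eval_poly] .
  then show ?thesis using assms isCont_tendsto_compose by blast
qed

lemma tendsto_D1:
  assumes "(x \<longlongrightarrow> y) G" "(c \<longlongrightarrow> c') G"
  shows "((\<lambda>k. D1 f (x k) (c k)) \<longlongrightarrow> D1 f y c') G"
  unfolding D1_def using assms by (intro tendsto_intros tendsto_eval_poly)

lemma tendsto_coeff:
  fixes P :: "complex ^ 'a::finite \<Rightarrow> complex ^ 'a \<Rightarrow> complex poly"
  assumes c: "continuous_on UNIV (\<lambda>z. coeff (P (fst z) (snd z)) j)" and "(\<delta> \<longlongrightarrow> b) G"
  shows "((\<lambda>k. coeff (P y (\<delta> k)) j) \<longlongrightarrow> coeff (P y b) j) G"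
proof -
  have "isCont (\<lambda>z. coeff (P (fst z) (snd z)) j) (y, b)"
    using c by (simp add: continuous_on_eq_continuous_at)
  moreover have "((\<lambda>k. (y, \<delta> k)) \<longlongrightarrow> (y, b)) G" using assms(2) by (intro tendsto_intros)
  ultimately show ?thesis using isCont_tendsto_compose[of "(y, b)" "\<lambda>z. coeff (P (fst z) (snd z)) j" "\<lambda>k. (y, \<delta> k)" G] by simp
qed

text \<open>The direction varies with \<open>k\<close>; continuity of the Taylor coefficients in the
  direction permits the limit.\<close>

lemma tendsto_difference_quotient:
  fixes t :: "nat \<Rightarrow> complex"
  assumes \<delta>: "\<delta> \<longlonglongrightarrow> b" and t: "t \<longlonglongrightarrow> 0" "\<And>k. t k \<noteq> 0"
  shows "(\<lambda>k. (eval_poly f (y + t k *s \<delta> k) - eval_poly f y) / t k) \<longlonglongrightarrow> D1 f y b"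
proof -
  obtain P d where P: "\<And>v w. degree (P v w) \<le> d"
    "\<And>j. continuous_on UNIV (\<lambda>z. coeff (P (fst z) (snd z)) j)"
    "\<And>v w t. eval_poly f (v + t *s w) = poly (P v w) t"
    "\<And>v w t. D1 f (v + t *s w) w = poly (pderiv (P v w)) t"
    "\<And>v w. coeff (P v w) 0 = eval_poly f v" "\<And>v w. coeff (P v w) 1 = D1 f v w"
    "\<And>v w. 2 * coeff (P v w) 2 = D2 f v w w"
    by (rule eval_poly_line_taylor[of f]) (rule that)
  have eq: "(eval_poly f (y + t k *s \<delta> k) - eval_poly f y) / t k = (\<Sum>m\<le>d. coeff (P y (\<delta> k)) (Suc m) * t k ^ m)" for k
  proof -
    have "degree (P y (\<delta> k)) \<le> Suc d" using P(1)[of y "\<delta> k"] by simp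
    then have "poly (P y (\<delta> k)) (t k) = coeff (P y (\<delta> k)) 0 + (\<Sum>m\<le>d. coeff (P y (\<delta> k)) (Suc m) * t k ^ Suc m)"
      by (subst poly_eq_sum_bound[of _ "Suc d"]) (simp_all add: sum.atMost_Suc_shift del: sum.atMost_Suc)
    then have "eval_poly f (y + t k *s \<delta> k) - eval_poly f y = (\<Sum>m\<le>d. coeff (P y (\<delta> k)) (Suc m) * t k ^ m) * t k"
      unfolding P(3) P(5) by (simp add: sum_distrib_left mult_ac)
    then show ?thesis using t(2) by simp
  qed
  have "(\<lambda>k. \<Sum>m\<le>d. coeff (P y (\<delta> k)) (Suc m) * t k ^ m) \<longlonglongrightarrow> (\<Sum>m\<le>d. coeff (P y b) (Suc m) * 0 ^ m)"
    by (intro tendsto_intros tendsto_coeff[OF P(2) \<delta>] t(1))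
  moreover have "(\<Sum>m\<le>d. coeff (P y b) (Suc m) * 0 ^ m) = D1 f y b"
    by (subst sum.atMost_shift) (simp add: P(6)[unfolded One_nat_def])
  ultimately show ?thesis unfolding eq by simp
qed

text \<open>Since \<open>c k\<close> lies in the kernel of the differential at \<open>y\<close>,
  only the motion of the base point contributes.\<close>

lemma tendsto_D1_quotient:
  fixes t :: "nat \<Rightarrow> complex"
  assumes \<delta>: "\<delta> \<longlonglongrightarrow> b" and t: "t \<longlonglongrightarrow> 0" "\<And>k. t k \<noteq> 0"
    and c: "c \<longlonglongrightarrow> c'" "\<And>k. D1 f y (c k) = 0"
  shows "(\<lambda>k. D1 f (y + t k *s \<delta> k) (c k) / t k) \<longlonglongrightarrow> D2 f y b c'"
proof -
  have "D1 f (y + t k *s \<delta> k) (c k) / t k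
      = (\<Sum>i\<in>UNIV. (eval_poly (partial i f) (y + t k *s \<delta> k) - eval_poly (partial i f) y) / t k * c k $ i)" for k
  proof -
    have "D1 f (y + t k *s \<delta> k) (c k) / t k = (D1 f (y + t k *s \<delta> k) (c k) - D1 f y (c k)) / t k"
      using c(2) by simp
    also have "\<dots> = (\<Sum>i\<in>UNIV. (eval_poly (partial i f) (y + t k *s \<delta> k) - eval_poly (partial i f) y) / t k * c k $ i)"
      unfolding D1_def sum_subtractf[symmetric] sum_divide_distrib
      by (intro sum.cong refl) (simp add: left_diff_distrib diff_divide_distrib)
    finally show ?thesis .
  qed
  moreover have "(\<lambda>k. \<Sum>i\<in>UNIV. (eval_poly (partial i f) (y + t k *s \<delta> k) - eval_poly (partial i f) y) / t k * c k $ i)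
      \<longlonglongrightarrow> (\<Sum>i\<in>UNIV. D1 (partial i f) y b * c' $ i)"
    by (intro tendsto_intros tendsto_difference_quotient \<delta> t c(1))
  ultimately show ?thesis by (simp add: D2_def)
qed

text \<open>By Euler's formula \<open>D1 f x x = 0\<close> on the cone, so only the second-order term survives.\<close>

lemma tendsto_D1_euler:
  fixes t :: "nat \<Rightarrow> complex"
  assumes \<delta>: "\<delta> \<longlonglongrightarrow> b" and t: "t \<longlonglongrightarrow> 0" "\<And>k. t k \<noteq> 0"
    and hom: "homogeneous f" and y: "eval_poly f y = 0" and x: "\<And>k. eval_poly f (y + t k *s \<delta> k) = 0"
  shows "(\<lambda>k. D1 f (y + t k *s \<delta> k) y / (t k)\<^sup>2) \<longlonglongrightarrow> - D2 f y b b / 2"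
proof -
  obtain P d where P: "\<And>v w. degree (P v w) \<le> d"
    "\<And>j. continuous_on UNIV (\<lambda>z. coeff (P (fst z) (snd z)) j)"
    "\<And>v w t. eval_poly f (v + t *s w) = poly (P v w) t"
    "\<And>v w t. D1 f (v + t *s w) w = poly (pderiv (P v w)) t"
    "\<And>v w. coeff (P v w) 0 = eval_poly f v" "\<And>v w. coeff (P v w) 1 = D1 f v w"
    "\<And>v w. 2 * coeff (P v w) 2 = D2 f v w w"
    by (rule eval_poly_line_taylor[of f]) (rule that)
  obtain e where e: "hom_deg f e" using hom by (auto simp: homogeneous_iff_hom_deg)
  have eq: "D1 f (y + t k *s \<delta> k) y / (t k)\<^sup>2 = - (\<Sum>m\<le>d. of_nat (Suc m) * coeff (P y (\<delta> k)) (Suc (Suc m)) * t k ^ m)" for k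
  proof -
    let ?x = "y + t k *s \<delta> k" and ?p = "P y (\<delta> k)"
    have "D1 f ?x ?x = 0" using euler[OF e] x by simp
    \<comment> \<open>As \<open>y\<close> is \<open>?x\<close> minus
      \<open>t k *s \<delta> k\<close>, a first derivative along the line remains. Adding
      \<open>poly ?p (t k) = 0\<close> cancels the linear term, and the expansion starts with the
      square of \<open>t k\<close>.\<close>
    then have "D1 f ?x y = - (t k * poly (pderiv ?p) (t k))"
      by (simp add: D1_add D1_scale P(4) eq_neg_iff_add_eq_0)
    moreover have "t k * poly (pderiv ?p) (t k) = t k * poly (pderiv ?p) (t k) - poly ?p (t k)"
      using x[of k] P(3) by simp
    moreover have "t k * poly (pderiv ?p) (t k) - poly ?p (t k)
       = (\<Sum>m\<le>d. of_nat (Suc m) * coeff ?p (Suc (Suc m)) * t k ^ m) * (t k)\<^sup>2"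
    proof -
      have d: "degree ?p \<le> Suc (Suc d)" "degree (pderiv ?p) \<le> Suc d"
        using P(1)[of y "\<delta> k"] by (auto simp: degree_pderiv)
      have "coeff ?p 0 = 0" using P(5) y by simp
      then have "poly ?p (t k) = coeff ?p 1 * t k + (\<Sum>m\<le>d. coeff ?p (Suc (Suc m)) * t k ^ Suc (Suc m))"
        by (subst poly_eq_sum_bound[OF d(1)]) (simp add: sum.atMost_Suc_shift del: sum.atMost_Suc)
      moreover have "t k * poly (pderiv ?p) (t k) = coeff ?p 1 * t k + (\<Sum>m\<le>d. of_nat (Suc (Suc m)) * coeff ?p (Suc (Suc m)) * t k ^ Suc (Suc m))"
        by (subst poly_eq_sum_bound[OF d(2)])
           (simp add: sum.atMost_Suc_shift coeff_pderiv distrib_left sum_distrib_left mult_ac del: sum.atMost_Suc of_nat_Suc)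
      ultimately show ?thesis
        by (simp add: sum_subtractf[symmetric] sum_distrib_left power2_eq_square algebra_simps)
    qed
    ultimately show ?thesis using t(2)[of k] by (simp add: field_simps)
  qed
  have "(\<lambda>k. - (\<Sum>m\<le>d. of_nat (Suc m) * coeff (P y (\<delta> k)) (Suc (Suc m)) * t k ^ m))
     \<longlonglongrightarrow> - (\<Sum>m\<le>d. of_nat (Suc m) * coeff (P y b) (Suc (Suc m)) * 0 ^ m)"
    by (intro tendsto_intros tendsto_coeff[OF P(2) \<delta>] t(1))
  moreover have "(\<Sum>m\<le>d. of_nat (Suc m) * coeff (P y b) (Suc (Suc m)) * 0 ^ m) = D2 f y b b / 2"
    by (subst sum.atMost_shift) (simp add: P(7)[symmetric] numeral_2_eq_2)
  ultimately show ?thesis unfolding eq by (simp only: minus_divide_left)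
qed

text \<open>The Taylor coefficients are again polynomials in the direction \<open>w\<close>, so
  restriction to lines and continuity apply to them.\<close>

lemma eval_poly_expand:
  "\<exists>C d. \<forall>w t. eval_poly f (v + t *s w) = (\<Sum>m<d. t ^ m * eval_poly (C m) w)"
proof -
  let ?e = "\<lambda>x :: 'a option \<Rightarrow> complex. eval_poly f (\<chi> j. v $ j + x None * x (Some j))"
  have "?e \<in> polyfun_on UNIV" by (rule polyfun_on_eval_poly) (auto intro!: polyfun_on.intros)
  from polyfun_as_poly[OF this, of None] obtain P d where
    P: "\<forall>x. degree (P x) \<le> d" "\<forall>j. (\<lambda>x. coeff (P x) j) \<in> polyfun_on (UNIV - {None})"
       "\<forall>x t. ?e (x(None := t)) = poly (P x) t" by blast
  define s where "s w = (\<lambda>i. case i of None \<Rightarrow> 0 | Some j \<Rightarrow> w $ j)" for w :: "complex ^ 'a"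
  have "(\<lambda>w. coeff (P (s w)) m) \<in> range eval_poly" for m
  proof (rule polyfun_in_range_eval_poly[of "\<lambda>x. coeff (P x) m" "UNIV - {None}"])
    show "(\<lambda>v. s v i) \<in> range eval_poly" for i
      by (cases i) (auto simp: s_def coord_in_range_eval_poly const_in_range_eval_poly)
  qed (use P(2) in blast)
  then have "\<forall>m. \<exists>c. eval_poly c = (\<lambda>w. coeff (P (s w)) m)" by (metis (no_types, lifting) rangeE)
  from choice[OF this] obtain C where C: "\<And>m. eval_poly (C m) = (\<lambda>w. coeff (P (s w)) m)" by blast
  have "eval_poly f (v + t *s w) = (\<Sum>m<Suc d. t ^ m * eval_poly (C m) w)" for w t
  proof -
    have "(\<chi> j. v $ j + t * w $ j) = v + t *s w"
      by (intro vec_eq_iff[THEN iffD2] allI) (simp only: vector_add_component vector_smult_component vec_lambda_beta)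
    then have "eval_poly f (v + t *s w) = poly (P (s w)) t" using P(3)[rule_format, of "s w" t] by (simp add: s_def)
    also have "\<dots> = (\<Sum>m\<le>d. coeff (P (s w)) m * t ^ m)" using P(1) by (intro poly_eq_sum_bound) blast
    finally show ?thesis by (simp add: C lessThan_Suc_atMost mult.commute)
  qed
  then show ?thesis by blast
qed

lemma ex_common_vector:
  fixes S T :: "(complex ^ 'a::finite) set"
  assumes "vec.subspace S" "vec.subspace T" "vec.dim S + vec.dim T > CARD('a)"
  shows "\<exists>p. p \<noteq> 0 \<and> p \<in> S \<and> p \<in> T"
proof (rule ccontr)
  assume "\<not> ?thesis"
  then have "S \<inter> T \<subseteq> {0}" by auto
  then have "vec.dim (S \<inter> T) = 0" by (simp add: vec.dim_eq_0)
  moreover have "vec.dim {x + y |x y. x \<in> S \<and> y \<in> T} + vec.dim (S \<inter> T) = vec.dim S + vec.dim T"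
    by (rule vec.dim_sums_Int[OF assms(1,2)])
  moreover have "vec.dim {x + y |x y. x \<in> S \<and> y \<in> T} \<le> CARD('a)"
    using vec.dim_subset[OF subset_UNIV, of "{x + y |x y. x \<in> S \<and> y \<in> T}"] unfolding vec_dim_card .
  ultimately show False using assms(3) by linarith
qed

section \<open>Geometry inside a chart\<close>

text \<open>An injective derivative bounds the increments of \<open>f\<close> from below, so the
  points of a fibre are isolated, and in a second countable space there are only countably many of
  them.\<close>

lemma countable_fibre:
  fixes f :: "'v::euclidean_space \<Rightarrow> 'w::euclidean_space"
  assumes der: "\<And>x. x \<in> S \<Longrightarrow> (f has_derivative D x) (at x)" and inj: "\<And>x. x \<in> S \<Longrightarrow> inj (D x)"
    and eq: "\<And>x. x \<in> S \<Longrightarrow> f x = p"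
  shows "countable S"
proof -
  obtain \<B> :: "'v set set" where \<B>: "countable \<B>" "topological_basis \<B>" using ex_countable_basis by blast
  have "\<exists>B\<in>\<B>. B \<inter> S = {x}" if x: "x \<in> S" for x
  proof -
    have lin: "linear (D x)" using der[OF x] by (rule has_derivative_linear)
    obtain e where e: "e > 0" "\<And>h. e * norm h \<le> norm (D x h)"
      using linear_inj_bounded_below_pos[OF lin inj[OF x]] by blast
    obtain d where d: "d > 0" "\<And>y. norm (y - x) < d \<Longrightarrow> norm (f y - f x - D x (y - x)) \<le> e / 2 * norm (y - x)"
      using der[OF x] e(1) unfolding has_derivative_at_alt by (meson half_gt_zero)
    have "y = x" if y: "y \<in> ball x d" "y \<in> S" for y
    proof -
      have "norm (y - x) < d" using y(1) by (simp add: dist_norm norm_minus_commute)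
      then have "norm (D x (y - x)) \<le> e / 2 * norm (y - x)" using d(2) eq x y(2) by fastforce
      then have "e * norm (y - x) \<le> e / 2 * norm (y - x)" using e(2)[of "y - x"] by linarith
      then show ?thesis using e(1) by simp
    qed
    then have "ball x d \<inter> S = {x}" using x d(1) by auto
    moreover obtain B where "B \<in> \<B>" "x \<in> B" "B \<subseteq> ball x d"
      using topological_basisE[OF \<B>(2) open_ball, of x x d] d(1) by auto
    ultimately show ?thesis using x by blast
  qed
  then obtain B where B: "\<And>x. x \<in> S \<Longrightarrow> B x \<in> \<B> \<and> B x \<inter> S = {x}" by metis
  have "inj_on B S"
  proof (rule inj_onI)
    fix x y assume xy: "x \<in> S" "y \<in> S" "B x = B y"
    have "{x} = {y}" using B[OF xy(1)] B[OF xy(2)] xy(3) by metis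
    then show "x = y" by simp
  qed
  moreover have "B ` S \<subseteq> \<B>" using B by blast
  ultimately show ?thesis using \<B>(1) by (meson countable_image_inj_on countable_subset)
qed

lemma tendsto_D2:
  assumes "(u \<longlongrightarrow> u') G" "(w \<longlongrightarrow> w') G"
  shows "((\<lambda>k. D2 f y (u k) (w k)) \<longlongrightarrow> D2 f y u' w') G"
  unfolding D2_def using assms by (intro tendsto_intros tendsto_D1)

lemma tendsto_vector_smult:
  fixes c :: "'k \<Rightarrow> complex" and v :: "'k \<Rightarrow> complex ^ 'a::finite"
  assumes "(c \<longlongrightarrow> c') G" "(v \<longlongrightarrow> v') G"
  shows "((\<lambda>k. c k *s v k) \<longlongrightarrow> c' *s v') G"
  by (rule vec_tendstoI) (simp only: vector_smult_component, intro tendsto_mult tendsto_vec_nth assms)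

locale smooth_chart = chart f J1 j0 \<beta>
  for f :: "'a::finite \<Rightarrow> 'a cpoly" and J1 j0 \<beta> +
  fixes F :: "'a cpoly set" and n :: nat and i :: 'a and U :: "(complex ^ 'a) set"
    and \<Theta> :: "complex ^ 'a \<Rightarrow> (complex ^ 'a) \<times> (complex ^ 'a)" and \<Theta>'
  assumes card: "CARD('a) = 2 * n + 1" and hom: "\<And>g. g \<in> F \<Longrightarrow> homogeneous g"
    and J1: "card J1 = n" and f0: "f j0 = coord_poly i" and fJ: "\<And>j. j \<in> J1 \<Longrightarrow> f j \<in> F"
    and U: "open U" "convex U"
    and \<Theta>: "\<And>\<xi>. \<xi> \<in> U \<Longrightarrow> \<Theta> \<xi> \<in> Inc" and der: "\<And>\<xi>. \<xi> \<in> U \<Longrightarrow> (\<Theta> has_derivative \<Theta>' \<xi>) (at \<xi>)"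
    and H'_\<Theta>': "\<And>\<xi> \<eta>. \<xi> \<in> U \<Longrightarrow> H' (\<Theta> \<xi>) (\<Theta>' \<xi> \<eta>) = incl 0 \<eta>"
    and inj_H: "\<And>\<xi>. \<xi> \<in> U \<Longrightarrow> inj (H' (\<Theta> \<xi>))"
begin

lemma \<Theta>_eqs:
  assumes "\<xi> \<in> U"
  shows "fst (\<Theta> \<xi>) $ i = 1" "j \<in> J1 \<Longrightarrow> eval_poly (f j) (fst (\<Theta> \<xi>)) = 0"
    "j \<in> J1 \<Longrightarrow> D1 (f j) (fst (\<Theta> \<xi>)) (snd (\<Theta> \<xi>)) = 0"
  using \<Theta>[OF assms] by (auto simp: Inc_def f0 eval_coord_poly)

lemma jac_j0: "jac y w $ j0 = w $ i"
  by (simp add: jac_def f0 D1_eq_dot grad_coord_poly dot_axis)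

lemma jac_inj:
  assumes "\<xi> \<in> U" "jac (fst (\<Theta> \<xi>)) u = 0"
  shows "u = 0"
proof -
  have "H' (\<Theta> \<xi>) (0, u) = H' (\<Theta> \<xi>) (0, 0)"
    using assms(2) by (simp add: H'_def jac_def D2_def vec_eq_iff)
  then show ?thesis using inj_H[OF assms(1)] by (auto dest: injD)
qed

lemma linear_jac: "Vector_Spaces.linear (*s) (*s) (jac y)"
proof -
  have "jac y = (*v) (\<chi> j. grad (f j) y)"
    by (auto simp: jac_def D1_eq_dot dot_def matrix_vector_mult_def)
  then show ?thesis by (simp add: matrix_vector_mul_linear_gen)
qed

lemma inj_jac:
  assumes "\<xi> \<in> U"
  shows "inj (jac (fst (\<Theta> \<xi>)))"
proof (rule injI)
  fix a b assume "jac (fst (\<Theta> \<xi>)) a = jac (fst (\<Theta> \<xi>)) b"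
  then have "jac (fst (\<Theta> \<xi>)) (a - b) = 0" by (simp add: jac_def D1_diff vec_eq_iff)
  then have "a - b = 0" by (rule jac_inj[OF assms])
  then show "a = b" by simp
qed

lemma jac_surj: "\<xi> \<in> U \<Longrightarrow> surj (jac (fst (\<Theta> \<xi>)))"
  by (rule vec.linear_injective_imp_surjective[OF linear_jac inj_jac]) (simp_all add: refl)

text \<open>The conditions are the linearized equations of \<open>Inc\<close>, so \<open>w\<close>
  is a direction of the parametrized set.\<close>

lemma \<Theta>'_onto:
  assumes "\<xi> \<in> U" "fst (H' (\<Theta> \<xi>) w) $ j0 = 0"
    "\<And>j. j \<in> J1 \<Longrightarrow> fst (H' (\<Theta> \<xi>) w) $ j = 0 \<and> snd (H' (\<Theta> \<xi>) w) $ j = 0"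
  shows "\<exists>\<eta>. \<Theta>' \<xi> \<eta> = w"
proof -
  have "H' (\<Theta> \<xi>) (\<Theta>' \<xi> (proj (H' (\<Theta> \<xi>) w))) = H' (\<Theta> \<xi>) w"
    unfolding H'_\<Theta>'[OF assms(1)] by (rule incl_proj) (use assms in auto)
  then show ?thesis using inj_H[OF assms(1)] by (auto dest: injD)
qed

text \<open>The derivative comes from a real theorem; its complex homogeneity is what makes
  pullbacks holomorphic on complex lines.\<close>

lemma \<Theta>'_scale:
  assumes "\<xi> \<in> U"
  shows "\<Theta>' \<xi> (c *s \<eta>) = (c *s fst (\<Theta>' \<xi> \<eta>), c *s snd (\<Theta>' \<xi> \<eta>))"
proof -
  have "incl 0 (c *s \<eta>) = (c *s fst (incl 0 \<eta>), c *s snd (incl 0 \<eta>))"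
    by (auto simp: incl_def vec_eq_iff)
  then have "H' (\<Theta> \<xi>) (\<Theta>' \<xi> (c *s \<eta>)) = H' (\<Theta> \<xi>) (c *s fst (\<Theta>' \<xi> \<eta>), c *s snd (\<Theta>' \<xi> \<eta>))"
    unfolding H'_scale prod.collapse H'_\<Theta>'[OF assms] .
  then show ?thesis using inj_H[OF assms] by (auto dest: injD)
qed

text \<open>A direction of the base point extends to one of the incidence set: the second component
  \<open>q\<close> solves a linear system with the surjective Jacobian.\<close>

lemma \<Theta>'_lift:
  assumes \<xi>: "\<xi> \<in> U" and u: "u $ i = 0" "\<And>j. j \<in> J1 \<Longrightarrow> D1 (f j) (fst (\<Theta> \<xi>)) u = 0"
  shows "\<exists>\<eta>. fst (\<Theta>' \<xi> \<eta>) = u"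
proof -
  let ?y = "fst (\<Theta> \<xi>)" and ?p = "snd (\<Theta> \<xi>)"
  obtain q where q: "jac ?y q = (\<chi> j. - D2 (f j) ?y u ?p)" using jac_surj[OF \<xi>] by (metis surjD)
  have "D1 (f j) ?y q = - D2 (f j) ?y u ?p" for j using arg_cong[OF q, of "\<lambda>v. v $ j"] by (simp add: jac_def)
  then have "snd (H' (\<Theta> \<xi>) (u, q)) = 0" by (simp add: H'_def vec_eq_iff)
  moreover have "fst (H' (\<Theta> \<xi>) (u, q)) $ j0 = 0" using u(1) by (simp add: H'_def jac_j0)
  moreover have "fst (H' (\<Theta> \<xi>) (u, q)) $ j = 0" if "j \<in> J1" for j using u(2) that by (simp add: H'_def jac_def)
  ultimately obtain \<eta> where "\<Theta>' \<xi> \<eta> = (u, q)" using \<Theta>'_onto[OF \<xi>, of "(u, q)"] by auto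
  then show ?thesis by (metis fst_conv)
qed

text \<open>Such a \<open>u\<close> makes \<open>(u, 0)\<close> a direction of the incidence set
  that the projection to \<open>p\<close> kills. This converts regularity of the projection into
  injectivity of the second fundamental form against \<open>p\<close>.\<close>

lemma nondegenerate:
  assumes \<xi>: "\<xi> \<in> U" and inj: "inj (\<lambda>\<eta>. snd (\<Theta>' \<xi> \<eta>))" and u: "u $ i = 0"
    "\<And>j. j \<in> J1 \<Longrightarrow> D1 (f j) (fst (\<Theta> \<xi>)) u = 0"
    "\<And>j. j \<in> J1 \<Longrightarrow> D2 (f j) (fst (\<Theta> \<xi>)) u (snd (\<Theta> \<xi>)) = 0"
  shows "u = 0"
proof -
  have "\<exists>\<eta>. \<Theta>' \<xi> \<eta> = (u, 0)"
    by (rule \<Theta>'_onto[OF \<xi>]) (use u in \<open>auto simp: H'_def jac_j0, auto simp: jac_def\<close>)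
  then obtain \<eta> where \<eta>: "\<Theta>' \<xi> \<eta> = (u, 0)" by blast
  have z: "\<Theta>' \<xi> 0 = (0, 0)" using \<Theta>'_scale[OF \<xi>, of 0 0] by simp
  have "snd (\<Theta>' \<xi> \<eta>) = snd (\<Theta>' \<xi> 0)" unfolding \<eta> z by simp
  then have "\<eta> = 0" using inj by (auto dest: injD)
  then show ?thesis using \<eta> z by simp
qed

lemma der_snd: "\<xi> \<in> U \<Longrightarrow> ((\<lambda>\<xi>. snd (\<Theta> \<xi>)) has_derivative (\<lambda>\<eta>. snd (\<Theta>' \<xi> \<eta>))) (at \<xi>)"
  by (rule has_derivative_snd[OF der])

lemma der_fst: "\<xi> \<in> U \<Longrightarrow> ((\<lambda>\<xi>. fst (\<Theta> \<xi>)) has_derivative (\<lambda>\<eta>. fst (\<Theta>' \<xi> \<eta>))) (at \<xi>)"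
  by (rule has_derivative_fst[OF der])

lemma der_eval:
  "\<xi> \<in> U \<Longrightarrow> ((\<lambda>\<xi>. eval_poly g (fst (\<Theta> \<xi>))) has_derivative (\<lambda>\<eta>. D1 g (fst (\<Theta> \<xi>)) (fst (\<Theta>' \<xi> \<eta>)))) (at \<xi>)"
  by (rule has_derivative_compose[OF der_fst has_derivative_eval_poly])

text \<open>The pullback is holomorphic on complex lines in the convex set \<open>U\<close>, so it
  vanishes identically or on a null set.\<close>

lemma eval_dichotomy:
  "negligible {\<xi> \<in> U. eval_poly g (fst (\<Theta> \<xi>)) = 0} \<or> (\<forall>\<xi>\<in>U. eval_poly g (fst (\<Theta> \<xi>)) = 0)"
proof (rule disjCI)
  assume "\<not> (\<forall>\<xi>\<in>U. eval_poly g (fst (\<Theta> \<xi>)) = 0)"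
  then obtain c where c: "c \<in> U" "eval_poly g (fst (\<Theta> c)) \<noteq> 0" by blast
  have cont: "continuous_on U (\<lambda>\<xi>. eval_poly g (fst (\<Theta> \<xi>)))"
    by (intro continuous_at_imp_continuous_on ballI has_derivative_continuous[OF der_eval])
  have "(\<lambda>s. eval_poly g (fst (\<Theta> (c + s *s (x - c))))) holomorphic_on {s. c + s *s (x - c) \<in> U}" for x
  proof (rule holomorphic_onI)
    fix s assume "s \<in> {s. c + s *s (x - c) \<in> U}"
    then have s: "c + s *s (x - c) \<in> U" by simp
    let ?\<xi> = "c + s *s (x - c)"
    from has_derivative_compose[OF has_derivative_line der_eval[OF s]]
    have "((\<lambda>s. eval_poly g (fst (\<Theta> (c + s *s (x - c))))) has_derivative
      (\<lambda>h. D1 g (fst (\<Theta> ?\<xi>)) (fst (\<Theta>' ?\<xi> (h *s (x - c)))))) (at s)" .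
    moreover have "(\<lambda>h. D1 g (fst (\<Theta> ?\<xi>)) (fst (\<Theta>' ?\<xi> (h *s (x - c))))) = (*) (D1 g (fst (\<Theta> ?\<xi>)) (fst (\<Theta>' ?\<xi> (x - c))))"
      by (rule ext) (simp only: \<Theta>'_scale[OF s] fst_conv D1_scale mult.commute)
    ultimately have "((\<lambda>s. eval_poly g (fst (\<Theta> (c + s *s (x - c))))) has_field_derivative
        D1 g (fst (\<Theta> ?\<xi>)) (fst (\<Theta>' ?\<xi> (x - c)))) (at s)"
      unfolding has_field_derivative_def by (simp only:)
    then show "(\<lambda>s. eval_poly g (fst (\<Theta> (c + s *s (x - c))))) field_differentiable at s within {s. c + s *s (x - c) \<in> U}"
      using field_differentiable_at_within field_differentiable_def by blast
  qed
  then show "negligible {\<xi> \<in> U. eval_poly g (fst (\<Theta> \<xi>)) = 0}"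
    by (intro negligible_analytic_zeros[OF U cont c])
qed

lemma negligible_critical_values:
  "negligible ((\<lambda>\<xi>. snd (\<Theta> \<xi>)) ` {\<xi> \<in> U. \<not> inj (\<lambda>\<eta>. snd (\<Theta>' \<xi> \<eta>))})"
  by (rule sard_complex_vec[where f' = "\<lambda>\<xi> \<eta>. snd (\<Theta>' \<xi> \<eta>)"]) (use der_snd in auto)

lemma countable_preimage:
  assumes "p \<notin> (\<lambda>\<xi>. snd (\<Theta> \<xi>)) ` {\<xi> \<in> U. \<not> inj (\<lambda>\<eta>. snd (\<Theta>' \<xi> \<eta>))}"
  shows "countable {\<xi> \<in> U. snd (\<Theta> \<xi>) = p}"
  by (rule countable_fibre[where f = "\<lambda>\<xi>. snd (\<Theta> \<xi>)" and D = "\<lambda>\<xi> \<eta>. snd (\<Theta>' \<xi> \<eta>)"])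
     (use assms der_snd in auto)

section \<open>Charts on which all equations of the cone hold\<close>

context
  assumes full: "\<And>g \<xi>. g \<in> F \<Longrightarrow> \<xi> \<in> U \<Longrightarrow> eval_poly g (fst (\<Theta> \<xi>)) = 0"
begin

text \<open>Every further equation is constant on the chart, so its differential kills the
  directions of the base point; together with the radial direction these fill the kernel of the
  chosen equations.\<close>

lemma tan_eq:
  assumes \<xi>: "\<xi> \<in> U"
  shows "tan_of F (fst (\<Theta> \<xi>)) = {w. \<forall>j\<in>J1. D1 (f j) (fst (\<Theta> \<xi>)) w = 0}"
proof
  let ?y = "fst (\<Theta> \<xi>)"
  show "tan_of F ?y \<subseteq> {w. \<forall>j\<in>J1. D1 (f j) ?y w = 0}" using fJ by (auto simp: tan_of_def)
  show "{w. \<forall>j\<in>J1. D1 (f j) ?y w = 0} \<subseteq> tan_of F ?y"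
  proof
    fix w assume w: "w \<in> {w. \<forall>j\<in>J1. D1 (f j) ?y w = 0}"
    have "?y \<in> cone_of F" using full \<xi> by (simp add: cone_of_def)
    then have self: "?y \<in> tan_of F ?y" using self_in_tan_of hom by blast
    let ?u = "w - (w $ i) *s ?y"
    have "?u $ i = 0" using \<Theta>_eqs(1)[OF \<xi>] by simp
    moreover have "D1 (f j) ?y ?u = 0" if "j \<in> J1" for j
      using w self fJ[OF that] that by (simp add: D1_diff D1_scale tan_of_def)
    ultimately obtain \<eta> where \<eta>: "fst (\<Theta>' \<xi> \<eta>) = ?u" using \<Theta>'_lift[OF \<xi>] by blast
    have "D1 g ?y w = 0" if g: "g \<in> F" for g
    proof -
      have "((\<lambda>\<xi>. eval_poly g (fst (\<Theta> \<xi>))) has_derivative (\<lambda>\<eta>. 0)) (at \<xi>)"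
        by (rule has_derivative_transform_within_open[OF has_derivative_const U(1) \<xi>]) (simp add: full[OF g])
      then have "(\<lambda>\<eta>. D1 g ?y (fst (\<Theta>' \<xi> \<eta>))) = (\<lambda>\<eta>. 0)"
        using der_eval[OF \<xi>] has_derivative_unique by blast
      then have "D1 g ?y ?u = 0" using \<eta> by metis
      then show ?thesis using self g by (simp add: D1_diff D1_scale tan_of_def)
    qed
    then show "w \<in> tan_of F ?y" by (simp add: tan_of_def)
  qed
qed

lemma smooth:
  assumes \<xi>: "\<xi> \<in> U"
  shows "fst (\<Theta> \<xi>) \<in> smooth_of F n"
proof -
  let ?y = "fst (\<Theta> \<xi>)"
  have "jac ?y ` tan_of F ?y = {z. \<forall>j. j \<notin> - J1 \<longrightarrow> z $ j = 0}"
  proof (intro equalityI subsetI)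
    fix z assume "z \<in> jac ?y ` tan_of F ?y"
    then show "z \<in> {z. \<forall>j. j \<notin> - J1 \<longrightarrow> z $ j = 0}" unfolding tan_eq[OF \<xi>] by (auto simp: jac_def)
  next
    fix z :: "complex ^ 'a" assume z: "z \<in> {z. \<forall>j. j \<notin> - J1 \<longrightarrow> z $ j = 0}"
    obtain w where w: "z = jac ?y w" using jac_surj[OF \<xi>] by (metis surjD)
    have "w \<in> tan_of F ?y" using z unfolding tan_eq[OF \<xi>] w by (simp add: jac_def)
    then show "z \<in> jac ?y ` tan_of F ?y" unfolding w by (rule imageI)
  qed
  then have "vec.dim (jac ?y ` tan_of F ?y) = card (- J1)" by (simp only: dim_substandard_cart)
  moreover have "vec.dim (jac ?y ` tan_of F ?y) = vec.dim (tan_of F ?y)"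
    by (rule vec.dim_image_eq[OF linear_jac]) (rule inj_on_subset[OF inj_jac[OF \<xi>] subset_UNIV])
  moreover have "card (- J1) = n + 1" using card_Diff_subset[of J1 UNIV] J1 card by (simp add: Compl_eq_Diff_UNIV)
  moreover have "?y \<noteq> 0" using \<Theta>_eqs(1)[OF \<xi>] by auto
  ultimately show ?thesis using full \<xi> by (simp add: smooth_of_def cone_of_def)
qed

text \<open>The direction \<open>b\<close> needs three properties: injectivity of the second
  fundamental form against it, a nonzero lowest-order term of \<open>g\<close> at half of it, and a
  nonzero value of the form on \<open>(b, b)\<close>, which separates the two tangent cones. The
  first is open and the second dense in \<open>T\<close>; the third then follows from the
  first.\<close>

lemma double_tangent:
  assumes n: "n \<ge> 1" and \<xi>1: "\<xi>1 \<in> U" and inj: "inj (\<lambda>\<eta>. snd (\<Theta>' \<xi>1 \<eta>))"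
    and g: "homogeneous g" "eval_poly g (snd (\<Theta> \<xi>1)) \<noteq> 0"
  shows "\<exists>p. eval_poly g p \<noteq> 0 \<and> many_tangents F n 2 p"
proof -
  define y0 where "y0 = fst (\<Theta> \<xi>1)"
  define p0 where "p0 = snd (\<Theta> \<xi>1)"
  define T where "T = {u. u $ i = 0 \<and> (\<forall>j\<in>J1. D1 (f j) y0 u = 0)}"
  have y0i: "y0 $ i = 1" and fy0: "\<And>j. j \<in> J1 \<Longrightarrow> eval_poly (f j) y0 = 0"
    using \<Theta>_eqs[OF \<xi>1] by (auto simp: y0_def)
  have homf: "homogeneous (f j)" if "j \<in> J1" for j using fJ hom that by blast
  have self0: "D1 (f j) y0 y0 = 0" if j: "j \<in> J1" for j
  proof -
    obtain d where "hom_deg (f j) d" using homf[OF j] by (auto simp: homogeneous_iff_hom_deg)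
    then show ?thesis using euler[of "f j" d y0] fy0[OF j] by simp
  qed
  have T_scale: "c *s u \<in> T" if "u \<in> T" for c u using that by (simp add: T_def D1_scale)
  have T_add: "u + v \<in> T" if "u \<in> T" "v \<in> T" for u v using that by (simp add: T_def D1_add)
  have T_diff: "u - v \<in> T" if "u \<in> T" "v \<in> T" for u v using that by (simp add: T_def D1_diff)
  have T_lim: "u' \<in> T" if "\<And>k. u k \<in> T" "u \<longlonglongrightarrow> u'" for u u'
  proof -
    have "(\<lambda>k. u k $ i) \<longlonglongrightarrow> u' $ i" by (intro tendsto_intros that(2))
    moreover have "(\<lambda>k. u k $ i) = (\<lambda>k. 0)" using that(1) by (auto simp: T_def)
    ultimately have "u' $ i = 0" using LIMSEQ_unique tendsto_const by metis
    moreover have "D1 (f j) y0 u' = 0" if j: "j \<in> J1" for j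
    proof -
      have "(\<lambda>k. D1 (f j) y0 (u k)) \<longlonglongrightarrow> D1 (f j) y0 u'" by (intro tendsto_D1 tendsto_const \<open>u \<longlonglongrightarrow> u'\<close>)
      moreover have "(\<lambda>k. D1 (f j) y0 (u k)) = (\<lambda>k. 0)" using \<open>\<And>k. u k \<in> T\<close> j by (auto simp: T_def)
      ultimately show ?thesis using LIMSEQ_unique tendsto_const by metis
    qed
    ultimately show ?thesis by (simp add: T_def)
  qed
  \<comment> \<open>\<open>T\<close> is a complement of \<open>y0\<close> in the tangent cone; \<open>nd b\<close> is injectivity of the second fundamental form against \<open>b\<close>.\<close>
  define nd where "nd b \<longleftrightarrow> (\<forall>u\<in>T. (\<forall>j\<in>J1. D2 (f j) y0 u b = 0) \<longrightarrow> u = 0)" for b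
  define b0 where "b0 = p0 - (p0 $ i) *s y0"
  have b0T: "b0 \<in> T"
    using \<Theta>_eqs(3)[OF \<xi>1] self0 y0i by (simp add: T_def b0_def D1_diff D1_scale y0_def p0_def)
  have nd0: "nd b0"
    unfolding nd_def
  proof (intro ballI impI)
    fix u assume u: "u \<in> T" "\<forall>j\<in>J1. D2 (f j) y0 u b0 = 0"
    have "D2 (f j) y0 u p0 = 0" if j: "j \<in> J1" for j
    proof -
      obtain d where "hom_deg (f j) d" using homf[OF j] by (auto simp: homogeneous_iff_hom_deg)
      then have "D2 (f j) y0 u y0 = 0" using D2_euler[of "f j" d y0 u] u(1) j by (simp add: T_def)
      moreover have "p0 = b0 + (p0 $ i) *s y0" by (simp add: b0_def)
      ultimately show ?thesis using u(2) j by (metis D2_add_right D2_scale_right add.right_neutral mult_zero_right)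
    qed
    then show "u = 0"
      using nondegenerate[OF \<xi>1 inj, of u] u(1) by (simp add: T_def y0_def p0_def)
  qed
  obtain C d where C: "\<And>w t. eval_poly g (y0 + t *s w) = (\<Sum>m<d. t ^ m * eval_poly (C m) w)"
    using eval_poly_expand[of g y0] by blast
  \<comment> \<open>Moving \<open>p0\<close> along \<open>y0\<close> and rescaling gives a point
    \<open>y0 + (1 / s) *s b0\<close>, where the expansion of \<open>g\<close> applies; the excluded
    value of \<open>t\<close> keeps \<open>s\<close> nonzero.\<close>
  have "\<exists>m. \<exists>w\<in>T. eval_poly (C m) w \<noteq> 0 \<and> m < d"
  proof -
    obtain R where R: "\<And>t. eval_poly g (p0 + t *s y0) = poly R t" using eval_poly_line[of g] by metis
    have "poly R 0 \<noteq> 0" using R[of 0] g(2) by (simp add: p0_def)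
    then have "R \<noteq> 0" by auto
    then have "finite (insert (- (p0 $ i)) {t. poly R t = 0})" using poly_roots_finite by simp
    then obtain t where "t \<notin> insert (- (p0 $ i)) {t. poly R t = 0}"
      using ex_new_if_finite[OF infinite_UNIV_char_0] by blast
    then have t: "t \<noteq> - (p0 $ i)" "poly R t \<noteq> 0" by auto
    define s where "s = p0 $ i + t"
    have s: "s \<noteq> 0" using t(1) by (simp add: s_def add_eq_0_iff)
    have "p0 + t *s y0 = s *s (y0 + (1 / s) *s b0)"
      using s by (simp add: b0_def s_def vec_eq_iff field_simps)
    then have "eval_poly g (s *s (y0 + (1 / s) *s b0)) \<noteq> 0" using R t(2) by metis
    moreover obtain e where e: "hom_deg g e" using g(1) by (auto simp: homogeneous_iff_hom_deg)
    ultimately have "s ^ e * eval_poly g (y0 + (1 / s) *s b0) \<noteq> 0" by (simp only: hom_deg_scale[OF e] not_False_eq_True)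
    then have "(\<Sum>m<d. (1 / s) ^ m * eval_poly (C m) b0) \<noteq> 0" unfolding C by (simp only: mult_eq_0_iff de_Morgan_disj not_False_eq_True)
    then obtain m where "m \<in> {..<d}" "(1 / s) ^ m * eval_poly (C m) b0 \<noteq> 0" by (rule sum.not_neutral_contains_not_neutral)
    then show ?thesis using b0T by auto
  qed
  then have ex: "\<exists>m. \<exists>w\<in>T. eval_poly (C m) w \<noteq> 0 \<and> m < d" .
  \<comment> \<open>The lowest order in \<open>t\<close> of \<open>g\<close> along the directions of \<open>T\<close>: it decides whether \<open>g\<close> vanishes at \<open>y0 + s w\<close> for small \<open>s\<close>.\<close>
  define m0 where "m0 = (LEAST m. \<exists>w\<in>T. eval_poly (C m) w \<noteq> 0 \<and> m < d)"
  obtain w0 where w0: "w0 \<in> T" "eval_poly (C m0) w0 \<noteq> 0" "m0 < d"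
    using LeastI_ex[OF ex] unfolding m0_def[symmetric] by blast
  have low: "eval_poly (C m) w = 0" if "m < m0" "w \<in> T" for m w
    using not_less_Least[of m "\<lambda>m. \<exists>w\<in>T. eval_poly (C m) w \<noteq> 0 \<and> m < d"] that w0(3)
    unfolding m0_def[symmetric] by auto
  \<comment> \<open>\<open>nd\<close> is an open condition, so it survives a small move from \<open>b0\<close> towards \<open>w0\<close>.\<close>
  obtain b1 where b1: "b1 \<in> T" "nd b1" "eval_poly (C m0) b1 \<noteq> 0"
  proof (rule ccontr)
    note th = that
    assume nthesis: "\<not> thesis"
    have no: "\<not> nd b" if b: "b \<in> T" "eval_poly (C m0) b \<noteq> 0" for b
      using th[OF b(1) _ b(2)] nthesis by blast
    obtain R where R: "\<And>t. eval_poly (C m0) (b0 + t *s (w0 - b0)) = poly R t" using eval_poly_line[of "C m0"] by metis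
    have "poly R 1 \<noteq> 0" using R[of 1] w0(2) by simp
    then have "R \<noteq> 0" by auto
    then have fin: "finite {t. poly R t = 0}" by (rule poly_roots_finite)
    have "inj (\<lambda>k. complex_of_real (1 / real (Suc k)))" by (rule injI) simp
    then have "finite ((\<lambda>k. complex_of_real (1 / real (Suc k))) -` {t. poly R t = 0})" using fin by (rule finite_vimageI[rotated])
    then obtain K where "((\<lambda>k. complex_of_real (1 / real (Suc k))) -` {t. poly R t = 0}) \<subseteq> {..<K}"
      unfolding finite_nat_iff_bounded by blast
    then have K: "k < K" if "poly R (complex_of_real (1 / real (Suc k))) = 0" for k using that by auto
    \<comment> \<open>The shift by \<open>K\<close> avoids the finitely many zeros of
      \<open>eval_poly (C m0)\<close> on the line towards \<open>w0\<close>, so each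
      \<open>b k\<close> would have to violate \<open>nd\<close>.\<close>
    define \<tau> where "\<tau> k = complex_of_real (1 / real (Suc (k + K)))" for k
    define b where "b k = b0 + \<tau> k *s (w0 - b0)" for k
    have bT: "b k \<in> T" for k unfolding b_def by (intro T_add T_scale T_diff b0T w0(1))
    have "poly R (\<tau> k) \<noteq> 0" for k using K[of "k + K"] by (auto simp: \<tau>_def)
    then have nn: "\<not> nd (b k)" for k using no[OF bT[of k]] R unfolding b_def by simp
    \<comment> \<open>Normalized kernel vectors have a limit point of norm 1 by compactness, and it
      would be a kernel vector against \<open>b0\<close>.\<close>
    have "\<exists>u. u \<in> T \<and> norm u = 1 \<and> (\<forall>j\<in>J1. D2 (f j) y0 u (b k) = 0)" for k
    proof -
      obtain u where u: "u \<in> T" "\<forall>j\<in>J1. D2 (f j) y0 u (b k) = 0" "u \<noteq> 0" using nn[of k] unfolding nd_def by blast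
      let ?c = "complex_of_real (1 / norm u)"
      have "norm (?c *s u) = 1" unfolding smult_of_real using u(3) by simp
      moreover have "\<forall>j\<in>J1. D2 (f j) y0 (?c *s u) (b k) = 0" using u(2) by (simp add: D2_scale_left)
      ultimately show ?thesis using T_scale[OF u(1)] by blast
    qed
    then obtain u where u: "\<And>k. u k \<in> T" "\<And>k. norm (u k) = 1" "\<And>k j. j \<in> J1 \<Longrightarrow> D2 (f j) y0 (u k) (b k) = 0"
      by metis
    have "\<forall>k. u k \<in> sphere 0 1" using u(2) by simp
    then obtain u' r where u': "u' \<in> sphere 0 1" "strict_mono r" "(u \<circ> r) \<longlonglongrightarrow> u'"
      by (rule seq_compactE[OF compact_imp_seq_compact[OF compact_sphere]])
    have u'T: "u' \<in> T" by (rule T_lim[OF _ u'(3)]) (simp add: u(1))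
    have "\<tau> \<longlonglongrightarrow> complex_of_real 0"
      unfolding \<tau>_def by (intro tendsto_of_real LIMSEQ_ignore_initial_segment[OF LIMSEQ_Suc[OF lim_1_over_n]])
    then have "(\<tau> \<circ> r) \<longlonglongrightarrow> 0" using LIMSEQ_subseq_LIMSEQ[OF _ u'(2)] by simp
    then have "(\<lambda>k. \<tau> (r k) *s (w0 - b0)) \<longlonglongrightarrow> 0 *s (w0 - b0)"
      unfolding o_def by (intro tendsto_vector_smult tendsto_const)
    then have "(\<lambda>k. b0 + \<tau> (r k) *s (w0 - b0)) \<longlonglongrightarrow> b0 + 0 *s (w0 - b0)" by (intro tendsto_add tendsto_const)
    then have bl: "(\<lambda>k. b (r k)) \<longlonglongrightarrow> b0" by (simp add: b_def)
    have "D2 (f j) y0 u' b0 = 0" if j: "j \<in> J1" for j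
    proof -
      have "(\<lambda>k. D2 (f j) y0 (u (r k)) (b (r k))) \<longlonglongrightarrow> D2 (f j) y0 u' b0"
        using u'(3) bl by (intro tendsto_D2) (simp_all add: o_def)
      then have "(\<lambda>k. 0 :: complex) \<longlonglongrightarrow> D2 (f j) y0 u' b0" using u(3)[OF j] by simp
      then show ?thesis using LIMSEQ_unique tendsto_const by metis
    qed
    then have "u' = 0" using nd0 u'T unfolding nd_def by blast
    then show False using u'(1) by simp
  qed
  \<comment> \<open>The common vector will tend to half the direction of departure, so that
    direction is twice the wanted limit \<open>b1\<close>.\<close>
  define b where "b = 2 *s b1"
  have bT: "b \<in> T" unfolding b_def by (rule T_scale[OF b1(1)])
  have half: "(1 / 2) *s b = b1" by (simp add: b_def vec_eq_iff)
  have ndb: "u = 0" if "u \<in> T" "\<And>j. j \<in> J1 \<Longrightarrow> D2 (f j) y0 u b = 0" for u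
    using b1(2) that unfolding nd_def b_def by (simp add: D2_scale_right)
  have tan0: "tan_of F y0 = {w. \<forall>j\<in>J1. D1 (f j) y0 w = 0}" unfolding y0_def by (rule tan_eq[OF \<xi>1])
  \<comment> \<open>This equation will separate the cones: \<open>b\<close> is tangent at
    \<open>y0\<close>, while \<open>D1 (f j1)\<close> of \<open>b\<close> at the second base point
    is of exact first order in the step. A nonzero \<open>b\<close> exists because
    \<open>n \<ge> 1\<close>.\<close>
  obtain j1 where j1: "j1 \<in> J1" "D2 (f j1) y0 b b \<noteq> 0"
  proof -
    have "b \<noteq> 0"
    proof
      assume "b = 0"
      have "u = 0" if "u \<in> T" for u
        by (rule ndb[OF that]) (simp add: \<open>b = 0\<close> D2_def)
      have "tan_of F y0 \<subseteq> vec.span {y0}"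
      proof
        fix w assume "w \<in> tan_of F y0"
        then have "w - (w $ i) *s y0 \<in> T"
          using self0 y0i by (simp add: tan0 T_def D1_diff D1_scale)
        then have "w - (w $ i) *s y0 = 0" by (rule \<open>\<And>u. u \<in> T \<Longrightarrow> u = 0\<close>)
        then have eq: "w = (w $ i) *s y0" by simp
        have "(w $ i) *s y0 \<in> vec.span {y0}" by (intro vec.span_scale vec.span_base) simp
        then show "w \<in> vec.span {y0}" by (subst eq)
      qed
      then have "vec.dim (tan_of F y0) \<le> card {y0}" by (intro vec.dim_le_card) auto
      moreover have "vec.dim (tan_of F y0) = n + 1" using smooth[OF \<xi>1] by (simp add: smooth_of_def y0_def)
      ultimately show False using n by simp
    qed
    then show thesis using ndb[OF bT] that by blast
  qed
  \<comment> \<open>Along the lifted direction in the parameter domain the base point leaves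
    \<open>y0\<close> with velocity \<open>b\<close>.\<close>
  obtain \<eta> where \<eta>: "fst (\<Theta>' \<xi>1 \<eta>) = b"
    using \<Theta>'_lift[OF \<xi>1, of b] bT by (auto simp: T_def y0_def)
  define t0 where "t0 k = 1 / real (Suc k)" for k
  have t0: "t0 \<longlonglongrightarrow> 0" unfolding t0_def by (rule LIMSEQ_Suc[OF lim_1_over_n])
  have "(\<lambda>k. \<xi>1 + t0 k *\<^sub>R \<eta>) \<longlonglongrightarrow> \<xi>1 + 0 *\<^sub>R \<eta>" by (intro tendsto_intros t0)
  then have "\<forall>\<^sub>F k in sequentially. \<xi>1 + t0 k *\<^sub>R \<eta> \<in> U" using U(1) \<xi>1 by (intro topological_tendstoD) auto
  then obtain K where K: "\<And>k. k \<ge> K \<Longrightarrow> \<xi>1 + t0 k *\<^sub>R \<eta> \<in> U" by (auto simp: eventually_sequentially)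
  define tr where "tr k = t0 (k + K)" for k
  have tr: "tr \<longlonglongrightarrow> 0" "\<And>k. tr k \<noteq> 0" "\<And>k. \<xi>1 + tr k *\<^sub>R \<eta> \<in> U"
    using LIMSEQ_ignore_initial_segment[OF t0, of K] K[OF le_add2] by (simp_all add: tr_def[abs_def] t0_def)
  define x where "x k = fst (\<Theta> (\<xi>1 + tr k *\<^sub>R \<eta>))" for k
  define t where "t k = complex_of_real (tr k)" for k
  define \<delta> where "\<delta> k = (1 / tr k) *\<^sub>R (x k - y0)" for k
  have t: "t \<longlonglongrightarrow> 0" "\<And>k. t k \<noteq> 0"
    using tendsto_of_real[OF tr(1)] tr(2) by (auto simp: t_def[abs_def])
  have x_eq: "x k = y0 + t k *s \<delta> k" for k
    unfolding t_def smult_of_real \<delta>_def using tr(2)[of k] by simp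
  have \<delta>_lim: "\<delta> \<longlonglongrightarrow> b"
  proof -
    have "((\<lambda>s :: real. \<xi>1 + s *\<^sub>R \<eta>) has_derivative (\<lambda>s. s *\<^sub>R \<eta>)) (at 0)"
      by (auto intro!: derivative_eq_intros)
    moreover have "((\<lambda>\<xi>. fst (\<Theta> \<xi>)) has_derivative (\<lambda>\<eta>. fst (\<Theta>' \<xi>1 \<eta>))) (at (\<xi>1 + 0 *\<^sub>R \<eta>))"
      using der_fst[OF \<xi>1] by simp
    ultimately have "((\<lambda>s :: real. fst (\<Theta> (\<xi>1 + s *\<^sub>R \<eta>))) has_derivative (\<lambda>s. fst (\<Theta>' \<xi>1 (s *\<^sub>R \<eta>)))) (at 0)"
      by (rule has_derivative_compose)
    moreover have "fst (\<Theta>' \<xi>1 (s *\<^sub>R \<eta>)) = s *\<^sub>R b" for s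
      unfolding smult_of_real[symmetric] \<Theta>'_scale[OF \<xi>1] fst_conv \<eta> ..
    ultimately have "((\<lambda>s :: real. fst (\<Theta> (\<xi>1 + s *\<^sub>R \<eta>))) has_derivative (\<lambda>s. s *\<^sub>R b)) (at 0)" by simp
    then have "((\<lambda>s. (1 / norm (s - 0)) *\<^sub>R (fst (\<Theta> (\<xi>1 + s *\<^sub>R \<eta>)) - (fst (\<Theta> (\<xi>1 + 0 *\<^sub>R \<eta>)) + (s - 0) *\<^sub>R b))) \<longlongrightarrow> 0) (at (0 :: real))"
      unfolding has_derivative_within by blast
    then have "((\<lambda>s. (1 / norm (s - 0)) *\<^sub>R (fst (\<Theta> (\<xi>1 + s *\<^sub>R \<eta>)) - (fst (\<Theta> (\<xi>1 + 0 *\<^sub>R \<eta>)) + (s - 0) *\<^sub>R b))) \<circ> tr) \<longlonglongrightarrow> 0"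
      using tr(1,2) unfolding tendsto_at_iff_sequentially by blast
    moreover have "((\<lambda>s. (1 / norm (s - 0)) *\<^sub>R (fst (\<Theta> (\<xi>1 + s *\<^sub>R \<eta>)) - (fst (\<Theta> (\<xi>1 + 0 *\<^sub>R \<eta>)) + (s - 0) *\<^sub>R b))) \<circ> tr)
        = (\<lambda>k. \<delta> k - b)"
    proof
      fix k
      have pos: "tr k > 0" by (simp add: tr_def t0_def)
      have "(1 / tr k) *\<^sub>R (x k - (y0 + tr k *\<^sub>R b)) = \<delta> k - b"
        unfolding \<delta>_def using pos by (simp add: scaleR_diff_right scaleR_add_right)
      then show "((\<lambda>s. (1 / norm (s - 0)) *\<^sub>R (fst (\<Theta> (\<xi>1 + s *\<^sub>R \<eta>)) - (fst (\<Theta> (\<xi>1 + 0 *\<^sub>R \<eta>)) + (s - 0) *\<^sub>R b))) \<circ> tr) k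
        = \<delta> k - b" using pos by (simp add: x_def y0_def)
    qed
    ultimately have "(\<lambda>k. \<delta> k - b) \<longlonglongrightarrow> 0" by simp
    then show ?thesis by (simp add: LIM_zero_iff)
  qed
  have x_smooth: "x k \<in> smooth_of F n" and tanx: "tan_of F (x k) = {w. \<forall>j\<in>J1. D1 (f j) (x k) w = 0}"
    and fx: "\<And>j. j \<in> J1 \<Longrightarrow> eval_poly (f j) (x k) = 0" for k
    unfolding x_def using smooth[OF tr(3)] tan_eq[OF tr(3)] \<Theta>_eqs(2)[OF tr(3)] by blast+
  have y0_smooth: "y0 \<in> smooth_of F n" unfolding y0_def by (rule smooth[OF \<xi>1])
  \<comment> \<open>A common vector of the two tangent cones, written as \<open>a y0 + c\<close> with \<open>c \<in> T\<close>, gives \<open>z = (a t, c)\<close>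
    up to normalization; rescaling the first coordinate by \<open>t\<close> keeps both limits in play.\<close>
  have "\<exists>z :: complex \<times> (complex ^ 'a). norm z = 1 \<and> snd z \<in> T \<and>
      (\<forall>j\<in>J1. fst z * D1 (f j) (x k) y0 + t k * D1 (f j) (x k) (snd z) = 0)" for k
  proof -
    have "vec.dim (tan_of F y0) + vec.dim (tan_of F (x k)) > CARD('a)"
      using y0_smooth x_smooth[of k] card by (simp add: smooth_of_def)
    then obtain p where p: "p \<noteq> 0" "p \<in> tan_of F y0" "p \<in> tan_of F (x k)"
      using ex_common_vector[OF subspace_tan_of subspace_tan_of] by blast
    let ?c = "p - (p $ i) *s y0"
    let ?z = "(p $ i * t k, ?c)"
    have cT: "?c \<in> T" using p(2) self0 y0i by (simp add: tan0 T_def D1_diff D1_scale)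
    have "?z \<noteq> 0"
    proof
      assume "?z = 0"
      then have "p $ i = 0" "?c = 0" using t(2)[of k] by (auto simp: zero_prod_def)
      then show False using p(1) by simp
    qed
    then have nz: "norm ?z > 0" by simp
    let ?N = "complex_of_real (1 / norm ?z)"
    let ?w = "(?N * (p $ i * t k), ?N *s ?c)"
    have "?w = (1 / norm ?z) *\<^sub>R ?z"
      by (rule prod_eqI) (simp_all only: fst_conv snd_conv fst_scaleR snd_scaleR smult_of_real scaleR_conv_of_real)
    then have "norm ?w = norm ((1 / norm ?z) *\<^sub>R ?z)" by (rule arg_cong)
    also have "\<dots> = 1" unfolding norm_scaleR using nz by (simp del: norm_Pair)
    finally have "norm ?w = 1" .
    moreover have "snd ?w \<in> T" unfolding snd_conv by (rule T_scale[OF cT])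
    moreover have "fst ?w * D1 (f j) (x k) y0 + t k * D1 (f j) (x k) (snd ?w) = 0" if j: "j \<in> J1" for j
    proof -
      have "D1 (f j) (x k) p = 0" using p(3) j by (simp add: tanx)
      then have "(p $ i) * D1 (f j) (x k) y0 + D1 (f j) (x k) ?c = 0" by (simp add: D1_diff D1_scale)
      then have "?N * t k * ((p $ i) * D1 (f j) (x k) y0 + D1 (f j) (x k) ?c) = 0" by (simp only: mult_zero_right)
      moreover have "fst ?w * D1 (f j) (x k) y0 + t k * D1 (f j) (x k) (snd ?w)
          = ?N * t k * ((p $ i) * D1 (f j) (x k) y0 + D1 (f j) (x k) ?c)"
        unfolding fst_conv snd_conv D1_scale distrib_left by (simp only: mult_ac)
      ultimately show ?thesis by simp
    qed
    ultimately show ?thesis by blast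
  qed
  then obtain z where z: "\<And>k. norm (z k :: complex \<times> (complex ^ 'a)) = 1" "\<And>k. snd (z k) \<in> T"
    "\<And>k j. j \<in> J1 \<Longrightarrow> fst (z k) * D1 (f j) (x k) y0 + t k * D1 (f j) (x k) (snd (z k)) = 0"
    by metis
  have "\<forall>k. z k \<in> sphere 0 1" using z(1) by simp
  then obtain z' r where z': "z' \<in> sphere 0 1" "strict_mono r" "(z \<circ> r) \<longlonglongrightarrow> z'"
    by (rule seq_compactE[OF compact_imp_seq_compact[OF compact_sphere]])
  define \<sigma> c where "\<sigma> k = fst (z (r k))" and "c k = snd (z (r k))" for k
  define \<sigma>' c' where "\<sigma>' = fst z'" and "c' = snd z'"
  have \<sigma>_lim: "\<sigma> \<longlonglongrightarrow> \<sigma>'" using tendsto_fst[OF z'(3)] by (simp add: \<sigma>_def[abs_def] \<sigma>'_def o_def)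
  have c_lim: "c \<longlonglongrightarrow> c'" using tendsto_snd[OF z'(3)] by (simp add: c_def[abs_def] c'_def o_def)
  have cT: "c k \<in> T" for k using z(2) by (simp add: c_def)
  have c'T: "c' \<in> T" by (rule T_lim[OF cT c_lim])
  define s where "s k = t (r k)" for k
  define \<epsilon> where "\<epsilon> k = \<delta> (r k)" for k
  define v where "v k = x (r k)" for k
  have s: "s \<longlonglongrightarrow> 0" "\<And>k. s k \<noteq> 0"
    using LIMSEQ_subseq_LIMSEQ[OF t(1) z'(2)] t(2) by (auto simp: s_def[abs_def] o_def)
  have \<epsilon>: "\<epsilon> \<longlonglongrightarrow> b" using LIMSEQ_subseq_LIMSEQ[OF \<delta>_lim z'(2)] by (simp add: \<epsilon>_def[abs_def] o_def)
  have v_eq: "v k = y0 + s k *s \<epsilon> k" for k unfolding v_def s_def \<epsilon>_def by (rule x_eq)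
  \<comment> \<open>The tangency relation for \<open>z\<close> is divided by the square of
    \<open>s k\<close>; the \<open>y0\<close> term then has a limit by
    \<open>tendsto_D1_euler\<close> and the \<open>c\<close> term one by
    \<open>tendsto_D1_quotient\<close>.\<close>
  have main: "D2 (f j) y0 (c' - (\<sigma>' / 2) *s b) b = 0" if j: "j \<in> J1" for j
  proof -
    have A: "(\<lambda>k. D1 (f j) (v k) y0 / (s k)\<^sup>2) \<longlonglongrightarrow> - D2 (f j) y0 b b / 2"
    proof -
      have "eval_poly (f j) (y0 + s k *s \<epsilon> k) = 0" for k
        using fx[OF j, of "r k"] unfolding v_def[symmetric] v_eq .
      then show ?thesis unfolding v_eq by (rule tendsto_D1_euler[OF \<epsilon> s homf[OF j] fy0[OF j]])
    qed
    have B: "(\<lambda>k. D1 (f j) (v k) (c k) / s k) \<longlonglongrightarrow> D2 (f j) y0 b c'"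
      unfolding v_eq by (rule tendsto_D1_quotient[OF \<epsilon> s c_lim]) (use cT j in \<open>simp add: T_def\<close>)
    have "\<sigma> k * (D1 (f j) (v k) y0 / (s k)\<^sup>2) + D1 (f j) (v k) (c k) / s k = 0" for k
    proof -
      have "\<sigma> k * D1 (f j) (v k) y0 + s k * D1 (f j) (v k) (c k) = 0"
        using z(3)[OF j, of "r k"] by (simp add: \<sigma>_def c_def v_def s_def)
      then have "(\<sigma> k * D1 (f j) (v k) y0 + s k * D1 (f j) (v k) (c k)) / (s k)\<^sup>2 = 0" by simp
      then show ?thesis using s(2)[of k] by (simp add: add_divide_distrib power2_eq_square)
    qed
    moreover have "(\<lambda>k. \<sigma> k * (D1 (f j) (v k) y0 / (s k)\<^sup>2) + D1 (f j) (v k) (c k) / s k)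
       \<longlonglongrightarrow> \<sigma>' * (- D2 (f j) y0 b b / 2) + D2 (f j) y0 b c'"
      by (intro tendsto_add tendsto_mult \<sigma>_lim A B)
    ultimately have "(\<lambda>k. 0 :: complex) \<longlonglongrightarrow> \<sigma>' * (- D2 (f j) y0 b b / 2) + D2 (f j) y0 b c'" by simp
    then have lim0: "\<sigma>' * (- D2 (f j) y0 b b / 2) + D2 (f j) y0 b c' = 0" using LIMSEQ_unique tendsto_const by metis
    have expand: "D2 (f j) y0 (c' - (\<sigma>' / 2) *s b) b = D2 (f j) y0 b c' - \<sigma>' / 2 * D2 (f j) y0 b b"
    proof -
      have "c' - (\<sigma>' / 2) *s b = c' + (- (\<sigma>' / 2)) *s b" by (simp add: vec_eq_iff)
      then show ?thesis by (simp only: D2_add_left D2_scale_left D2_sym[of _ _ c' b]) simp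
    qed
    show ?thesis unfolding expand using lim0 by (simp add: algebra_simps)
  qed
  have c'_eq: "c' = (\<sigma>' / 2) *s b"
  proof -
    have "c' - (\<sigma>' / 2) *s b = 0" by (rule ndb[OF T_diff[OF c'T T_scale[OF bT]] main])
    then show ?thesis by simp
  qed
  \<comment> \<open>The limit has norm 1, and its second component is already a multiple of the
    first.\<close>
  have \<sigma>': "\<sigma>' \<noteq> 0"
  proof
    assume "\<sigma>' = 0"
    then have "z' = 0" using c'_eq by (simp add: \<sigma>'_def c'_def prod_eq_iff)
    then show False using z'(1) by simp
  qed
  define w where "w k = (1 / \<sigma> k) *s c k" for k
  have wT: "w k \<in> T" for k unfolding w_def by (rule T_scale[OF cT])
  have w_lim: "w \<longlonglongrightarrow> b1"
  proof -
    have "(\<lambda>k. (1 / \<sigma> k) *s c k) \<longlonglongrightarrow> (1 / \<sigma>') *s c'"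
      by (intro tendsto_vector_smult tendsto_divide tendsto_const \<sigma>_lim c_lim \<sigma>')
    moreover have "(1 / \<sigma>') *s c' = b1" unfolding c'_eq b_def using \<sigma>' by (simp add: vec_eq_iff)
    ultimately show ?thesis by (simp add: w_def[abs_def])
  qed
  \<comment> \<open>This is \<open>g\<close> at the common vector divided by
    \<open>s k ^ m0\<close>, as the coefficients below \<open>m0\<close> vanish on
    \<open>T\<close>.\<close>
  have "(\<lambda>k. \<Sum>m\<in>{m0..<d}. s k ^ (m - m0) * eval_poly (C m) (w k))
      \<longlonglongrightarrow> (\<Sum>m\<in>{m0..<d}. 0 ^ (m - m0) * eval_poly (C m) b1)"
    by (intro tendsto_intros tendsto_eval_poly w_lim s(1))
  moreover have "(\<Sum>m\<in>{m0..<d}. 0 ^ (m - m0) * eval_poly (C m) b1) = eval_poly (C m0) b1"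
  proof -
    have "(\<Sum>m\<in>{m0..<d}. 0 ^ (m - m0) * eval_poly (C m) b1) = (\<Sum>m\<in>{m0..<d}. if m = m0 then eval_poly (C m) b1 else 0)"
      by (intro sum.cong) auto
    then show ?thesis using w0(3) by simp
  qed
  ultimately have ev1: "\<forall>\<^sub>F k in sequentially. (\<Sum>m\<in>{m0..<d}. s k ^ (m - m0) * eval_poly (C m) (w k)) \<noteq> 0"
    using b1(3) by (intro tendsto_imp_eventually_ne) auto
  have ev2: "\<forall>\<^sub>F k in sequentially. \<sigma> k \<noteq> 0" using tendsto_imp_eventually_ne[OF \<sigma>_lim \<sigma>'] .
  have "(\<lambda>k. D1 (f j1) (v k) b / s k) \<longlonglongrightarrow> D2 (f j1) y0 b b"
    unfolding v_eq by (rule tendsto_D1_quotient[OF \<epsilon> s tendsto_const]) (use bT j1 in \<open>simp add: T_def\<close>)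
  then have ev3: "\<forall>\<^sub>F k in sequentially. D1 (f j1) (v k) b / s k \<noteq> 0"
    using tendsto_imp_eventually_ne j1(2) by blast
  from eventually_happens'[OF sequentially_bot eventually_conj[OF ev1 eventually_conj[OF ev2 ev3]]]
  obtain k where k: "(\<Sum>m\<in>{m0..<d}. s k ^ (m - m0) * eval_poly (C m) (w k)) \<noteq> 0" "\<sigma> k \<noteq> 0" "D1 (f j1) (v k) b \<noteq> 0"
    by (metis (no_types, lifting) div_0)
  define p where "p = y0 + s k *s w k"
  have "eval_poly g p = (\<Sum>m<d. s k ^ m * eval_poly (C m) (w k))" unfolding p_def C ..
  also have "\<dots> = (\<Sum>m\<in>{m0..<d}. s k ^ m * eval_poly (C m) (w k))"
    by (rule sum.mono_neutral_right) (use low wT in auto)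
  also have "\<dots> = s k ^ m0 * (\<Sum>m\<in>{m0..<d}. s k ^ (m - m0) * eval_poly (C m) (w k))"
    unfolding sum_distrib_left by (intro sum.cong) (auto simp: mult.assoc[symmetric] power_add[symmetric])
  finally have gp: "eval_poly g p \<noteq> 0" using k(1) s(2)[of k] by simp
  have p0: "p \<in> tan_of F y0"
    using self0 wT[of k] by (simp add: tan0 p_def D1_add D1_scale T_def)
  have pv: "p \<in> tan_of F (v k)"
  proof -
    have "D1 (f j) (v k) p = 0" if j: "j \<in> J1" for j
    proof -
      have "\<sigma> k * D1 (f j) (v k) y0 + s k * D1 (f j) (v k) (c k) = 0"
        using z(3)[OF j, of "r k"] by (simp add: \<sigma>_def c_def v_def s_def)
      then have "D1 (f j) (v k) y0 + s k * (1 / \<sigma> k * D1 (f j) (v k) (c k)) = 0"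
        using k(2) by (simp add: field_simps)
      then show ?thesis by (simp add: p_def w_def D1_add D1_scale)
    qed
    then show ?thesis by (simp add: v_def tanx)
  qed
  have "b \<in> tan_of F y0" using bT by (simp add: tan0 T_def)
  moreover have "b \<notin> tan_of F (v k)" using k(3) j1(1) by (auto simp: v_def tanx)
  ultimately have ne: "tan_of F y0 \<noteq> tan_of F (v k)" by blast
  have vs: "v k \<in> smooth_of F n" unfolding v_def by (rule x_smooth)
  have "many_tangents F n 2 p"
    unfolding many_tangents_def
    by (rule exI[of _ "\<lambda>l. if l = 0 then y0 else v k"])
       (use y0_smooth vs p0 pv ne in \<open>auto simp: less_2_cases_iff\<close>)
  then show ?thesis using gp by blast
qed

end

end

section \<open>The general fibre\<close>

lemma countable_neighbourhood_cover:
  fixes S :: "'b::second_countable_topology set"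
  assumes "\<And>z. z \<in> S \<Longrightarrow> \<exists>N. open N \<and> z \<in> N \<and> P N"
  obtains \<N> where "countable \<N>" "\<And>N. N \<in> \<N> \<Longrightarrow> P N" "S \<subseteq> \<Union>\<N>"
proof -
  obtain \<N> where \<N>: "\<N> \<subseteq> {N. open N \<and> P N}" "countable \<N>" "\<Union>\<N> = \<Union>{N. open N \<and> P N}"
    by (rule Lindelof[of "{N. open N \<and> P N}"]) auto
  have "S \<subseteq> \<Union>\<N>" unfolding \<N>(3) using assms by blast
  then show thesis using \<N>(1,2) by (intro that[of \<N>]) auto
qed

lemma negligible_eval_poly_zeros:
  fixes g :: "'a::finite cpoly"
  assumes "eval_poly g v \<noteq> 0"
  shows "negligible {p. eval_poly g p = 0}"
proof -
  have "(\<lambda>s. eval_poly g (v + s *s (x - v))) holomorphic_on S" for x S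
    using eval_poly_line_deriv field_differentiable_at_within field_differentiable_def
    unfolding holomorphic_on_def by blast
  then have "negligible {x \<in> UNIV. eval_poly g x = 0}"
    by (intro negligible_analytic_zeros[OF open_UNIV convex_UNIV continuous_on_eval_poly[OF continuous_on_id] UNIV_I assms])
  then show ?thesis by simp
qed

lemma not_negligible_eval_poly_nonzero:
  fixes g :: "'a::finite cpoly"
  assumes "eval_poly g v \<noteq> 0"
  shows "\<not> negligible {p. eval_poly g p \<noteq> 0}"
proof
  assume "negligible {p. eval_poly g p \<noteq> 0}"
  then have "negligible ({p. eval_poly g p \<noteq> 0} \<union> {p. eval_poly g p = 0})"
    by (intro negligible_Un negligible_eval_poly_zeros[OF assms])
  moreover have "{p. eval_poly g p \<noteq> 0} \<union> {p. eval_poly g p = 0} = UNIV" by blast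
  ultimately show False using open_not_negligible[of "UNIV :: (complex ^ 'a) set"] by simp
qed

text \<open>The normalization picks one representative of each point of contact; without it a
  nonempty fibre would contain whole punctured lines and could not be countable.\<close>

definition incidence :: "'a::finite cpoly set \<Rightarrow> nat \<Rightarrow> 'a \<Rightarrow> ((complex ^ 'a) \<times> (complex ^ 'a)) set" where
  "incidence F n i = {(y, p). y \<in> smooth_of F n \<and> y $ i = 1 \<and> p \<in> tan_of F y}"

lemma smooth_chart_exists:
  fixes F :: "'a::finite cpoly set"
  assumes card: "CARD('a) = 2 * n + 1" and hom: "\<And>g. g \<in> F \<Longrightarrow> homogeneous g"
    and z0: "z0 \<in> incidence F n i"
  shows "\<exists>f J1 j0 \<beta> U \<Theta> \<Theta>' N. smooth_chart f J1 j0 \<beta> F n i U \<Theta> \<Theta>' \<and> open N \<and> z0 \<in> N \<and>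
    (\<forall>z\<in>N. z \<in> incidence F n i \<longrightarrow> (\<exists>\<xi>\<in>U. \<Theta> \<xi> = z))"
proof -
  obtain J1 :: "'a set" where J1: "card J1 = n"
    using obtain_subset_with_card_n[of n "UNIV :: 'a set"] card by auto
  have "J1 \<noteq> UNIV" using J1 card by auto
  then obtain j0 where j0: "j0 \<notin> J1" by blast
  have "card (UNIV - J1 - {j0}) = card J1"
    using j0 J1 card by (simp add: card_Diff_subset card_Diff_singleton)
  then obtain \<beta> where \<beta>: "bij_betw \<beta> (UNIV - J1 - {j0}) J1"
    using finite_same_card_bij[OF finite finite] by blast
  obtain y0 p0 where y0: "z0 = (y0, p0)" "y0 \<in> smooth_of F n" "y0 $ i = 1" "p0 \<in> tan_of F y0"
    using z0 by (auto simp: incidence_def)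
  have "y0 $ i \<noteq> 0" using y0(3) by simp
  then obtain f where f: "f j0 = coord_poly i" "\<And>j. j \<in> J1 \<Longrightarrow> f j \<in> F"
    "\<And>w. (\<And>j. D1 (f j) y0 w = 0) \<Longrightarrow> w = 0"
    using chart_polys[OF card hom y0(2) _ J1 j0, of i] by blast
  interpret chart f J1 j0 \<beta> by unfold_locales (fact j0 \<beta>)+
  have Inc: "z \<in> Inc" if "z \<in> incidence F n i" for z
    using that f(2) by (auto simp: incidence_def Inc_def f(1) eval_coord_poly smooth_of_def cone_of_def tan_of_def)
  have "w = 0" if "jac (fst z0) w = 0" for w
  proof (rule f(3))
    fix j show "D1 (f j) y0 w = 0" using arg_cong[OF that, of "\<lambda>v. v $ j"] by (simp add: jac_def y0(1))
  qed
  from chart_exists[OF Inc[OF z0] this] obtain N r \<xi>0 \<Theta> \<Theta>' where *: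
    "open N" "z0 \<in> N" "\<And>z. z \<in> N \<Longrightarrow> z \<in> Inc \<Longrightarrow> \<exists>\<xi>\<in>ball \<xi>0 r. \<Theta> \<xi> = z"
    "\<forall>\<xi>\<in>ball \<xi>0 r. \<Theta> \<xi> \<in> Inc \<and> (\<Theta> has_derivative \<Theta>' \<xi>) (at \<xi>) \<and>
        (\<forall>\<eta>. H' (\<Theta> \<xi>) (\<Theta>' \<xi> \<eta>) = incl 0 \<eta>) \<and> inj (H' (\<Theta> \<xi>))"
    by blast
  have "smooth_chart f J1 j0 \<beta> F n i (ball \<xi>0 r) \<Theta> \<Theta>'"
    by unfold_locales (use card hom J1 f *(4) in auto)
  then show ?thesis using *(1-3) Inc by blast
qed

text \<open>Countably many charts cover the incidence set. Outside their critical values the fibre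
  is countable in every chart, also where \<open>Inc\<close> exceeds the incidence set, because
  subsets of countable sets are countable.\<close>

lemma negligible_infinite_fibres:
  fixes F :: "'a::finite cpoly set"
  assumes card: "CARD('a) = 2 * n + 1" and hom: "\<And>g. g \<in> F \<Longrightarrow> homogeneous g"
  obtains E where "negligible E" "\<And>p. p \<notin> E \<Longrightarrow> countable {y. (y, p) \<in> incidence F n i}"
proof -
  let ?P = "\<lambda>N. \<exists>E. negligible E \<and> (\<forall>p. p \<notin> E \<longrightarrow> countable {y. (y, p) \<in> incidence F n i \<inter> N})"
  have "\<exists>N. open N \<and> z0 \<in> N \<and> ?P N" if z0: "z0 \<in> incidence F n i" for z0
  proof -
    obtain f J1 j0 \<beta> U \<Theta> \<Theta>' N where *: "smooth_chart f J1 j0 \<beta> F n i U \<Theta> \<Theta>'" "open N" "z0 \<in> N"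
      "\<And>z. z \<in> N \<Longrightarrow> z \<in> incidence F n i \<Longrightarrow> \<exists>\<xi>\<in>U. \<Theta> \<xi> = z"
      using smooth_chart_exists[OF card hom z0] by blast
    interpret smooth_chart f J1 j0 \<beta> F n i U \<Theta> \<Theta>' by (fact *(1))
    have "countable {y. (y, p) \<in> incidence F n i \<inter> N}"
      if p: "p \<notin> (\<lambda>\<xi>. snd (\<Theta> \<xi>)) ` {\<xi> \<in> U. \<not> inj (\<lambda>\<eta>. snd (\<Theta>' \<xi> \<eta>))}" for p
    proof (rule countable_subset[OF _ countable_image[OF countable_preimage[OF p]]])
      show "{y. (y, p) \<in> incidence F n i \<inter> N} \<subseteq> (\<lambda>\<xi>. fst (\<Theta> \<xi>)) ` {\<xi> \<in> U. snd (\<Theta> \<xi>) = p}"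
        using *(4) by (force simp: image_iff)
    qed
    then show ?thesis using *(2,3) negligible_critical_values by blast
  qed
  then obtain \<N> where \<N>: "countable \<N>" "\<And>N. N \<in> \<N> \<Longrightarrow> ?P N" "incidence F n i \<subseteq> \<Union>\<N>"
    by (rule countable_neighbourhood_cover[where P = ?P]) (assumption, rule that)
  then obtain E where E: "\<And>N. N \<in> \<N> \<Longrightarrow> negligible (E N)"
    "\<And>N p. N \<in> \<N> \<Longrightarrow> p \<notin> E N \<Longrightarrow> countable {y. (y, p) \<in> incidence F n i \<inter> N}" by metis
  have "countable {y. (y, p) \<in> incidence F n i}" if p: "p \<notin> \<Union>(E ` \<N>)" for p
  proof (rule countable_subset)
    show "{y. (y, p) \<in> incidence F n i} \<subseteq> (\<Union>N\<in>\<N>. {y. (y, p) \<in> incidence F n i \<inter> N})" using \<N>(3) by blast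
    show "countable (\<Union>N\<in>\<N>. {y. (y, p) \<in> incidence F n i \<inter> N})"
      using \<N>(1) E(2) p by (intro countable_UN) auto
  qed
  moreover have "negligible (\<Union>(E ` \<N>))"
    by (rule negligible_countable_Union) (use \<N>(1) E(1) in auto)
  ultimately show thesis by (rule that[rotated])
qed

text \<open>In a chart where all of \<open>F\<close> vanishes, a regular incidence point with
  \<open>eval_poly g p \<noteq> 0\<close> would produce a double point by
  \<open>double_tangent\<close>, so only critical values remain. In any other chart the incidence
  points lie over a null set of parameters, whose differentiable image is null.\<close>

lemma tangents_avoiding_double_points_negligible:
  fixes F :: "'a::finite cpoly set"
  assumes card: "CARD('a) = 2 * n + 1" and hom: "\<And>g. g \<in> F \<Longrightarrow> homogeneous g"
    and n: "n \<ge> 1" and g: "homogeneous g" and single: "\<And>p. eval_poly g p \<noteq> 0 \<Longrightarrow> \<not> many_tangents F n 2 p"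
  shows "negligible {p. eval_poly g p \<noteq> 0 \<and> (\<exists>y. (y, p) \<in> incidence F n i)}"
proof -
  let ?P = "\<lambda>N. negligible {p. eval_poly g p \<noteq> 0 \<and> (\<exists>y. (y, p) \<in> incidence F n i \<inter> N)}"
  have "\<exists>N. open N \<and> z0 \<in> N \<and> ?P N" if z0: "z0 \<in> incidence F n i" for z0
  proof -
    obtain f J1 j0 \<beta> U \<Theta> \<Theta>' N where *: "smooth_chart f J1 j0 \<beta> F n i U \<Theta> \<Theta>'" "open N" "z0 \<in> N"
      "\<And>z. z \<in> N \<Longrightarrow> z \<in> incidence F n i \<Longrightarrow> \<exists>\<xi>\<in>U. \<Theta> \<xi> = z"
      using smooth_chart_exists[OF card hom z0] by blast
    interpret smooth_chart f J1 j0 \<beta> F n i U \<Theta> \<Theta>' by (fact *(1))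
    have "?P N"
    proof (cases "\<forall>h\<in>F. \<forall>\<xi>\<in>U. eval_poly h (fst (\<Theta> \<xi>)) = 0")
      case True
      show ?thesis
      proof (rule negligible_subset[OF negligible_critical_values], safe)
        fix p y assume p: "eval_poly g p \<noteq> 0" "(y, p) \<in> incidence F n i" "(y, p) \<in> N"
        then obtain \<xi> where \<xi>: "\<xi> \<in> U" "\<Theta> \<xi> = (y, p)" using *(4) by blast
        have "\<not> inj (\<lambda>\<eta>. snd (\<Theta>' \<xi> \<eta>))"
        proof
          assume inj: "inj (\<lambda>\<eta>. snd (\<Theta>' \<xi> \<eta>))"
          have "eval_poly g (snd (\<Theta> \<xi>)) \<noteq> 0" using p(1) \<xi>(2) by simp
          from double_tangent[OF _ n \<xi>(1) inj g this] True single show False by blast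
        qed
        then show "p \<in> (\<lambda>\<xi>. snd (\<Theta> \<xi>)) ` {\<xi> \<in> U. \<not> inj (\<lambda>\<eta>. snd (\<Theta>' \<xi> \<eta>))}"
          using \<xi> by (intro image_eqI[of _ _ \<xi>]) auto
      qed
    next
      case False
      then obtain h where h: "h \<in> F" "negligible {\<xi> \<in> U. eval_poly h (fst (\<Theta> \<xi>)) = 0}"
        using eval_dichotomy by blast
      have "negligible ((\<lambda>\<xi>. snd (\<Theta> \<xi>)) ` {\<xi> \<in> U. eval_poly h (fst (\<Theta> \<xi>)) = 0})"
      proof (rule negligible_differentiable_image_negligible[OF order.refl h(2)])
        show "(\<lambda>\<xi>. snd (\<Theta> \<xi>)) differentiable_on {\<xi> \<in> U. eval_poly h (fst (\<Theta> \<xi>)) = 0}"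
          using has_derivative_at_withinI[OF der_snd] unfolding differentiable_on_def differentiable_def by blast
      qed
      then show ?thesis
      proof (rule negligible_subset, safe)
        fix p y assume p: "eval_poly g p \<noteq> 0" "(y, p) \<in> incidence F n i" "(y, p) \<in> N"
        then obtain \<xi> where \<xi>: "\<xi> \<in> U" "\<Theta> \<xi> = (y, p)" using *(4) by blast
        moreover have "eval_poly h y = 0" using p(2) h(1) by (simp add: incidence_def smooth_of_def cone_of_def)
        ultimately show "p \<in> (\<lambda>\<xi>. snd (\<Theta> \<xi>)) ` {\<xi> \<in> U. eval_poly h (fst (\<Theta> \<xi>)) = 0}"
          by (intro image_eqI[of _ _ \<xi>]) auto
      qed
    qed
    then show ?thesis using *(2,3) by blast
  qed
  then obtain \<N> where \<N>: "countable \<N>" "\<And>N. N \<in> \<N> \<Longrightarrow> ?P N" "incidence F n i \<subseteq> \<Union>\<N>"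
    by (rule countable_neighbourhood_cover[where P = ?P]) (assumption, rule that)
  have "negligible (\<Union>N\<in>\<N>. {p. eval_poly g p \<noteq> 0 \<and> (\<exists>y. (y, p) \<in> incidence F n i \<inter> N)})"
    by (rule negligible_countable_Union) (use \<N>(1,2) in auto)
  then show ?thesis by (rule negligible_subset) (use \<N>(3) in blast)
qed


lemma incidence_rescale:
  assumes hom: "\<And>g. g \<in> F \<Longrightarrow> homogeneous g" and w: "w \<in> smooth_of F n" "p \<in> tan_of F w"
  shows "\<exists>i y. (y, p) \<in> incidence F n i \<and> tan_of F y = tan_of F w"
proof -
  have "w \<noteq> 0" using w(1) by (simp add: smooth_of_def)
  then obtain i where i: "w $ i \<noteq> 0" by (auto simp: vec_eq_iff)
  then have c: "1 / w $ i \<noteq> 0" by simp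
  have "(((1 / w $ i) *s w), p) \<in> incidence F n i"
    unfolding incidence_def using w i by (simp add: smooth_of_scale[OF hom c] tan_of_scale[OF hom c])
  then show ?thesis using tan_of_scale[OF hom c] by blast
qed

lemma many_tangents_iff:
  "many_tangents F n m p \<longleftrightarrow> (\<exists>S \<subseteq> tan_of F ` {w \<in> smooth_of F n. p \<in> tan_of F w}. finite S \<and> card S = m)"
  (is "_ \<longleftrightarrow> ?R")
proof
  assume "many_tangents F n m p"
  then obtain W where W: "\<And>i. i < m \<Longrightarrow> W i \<in> smooth_of F n \<and> p \<in> tan_of F (W i)"
    "\<And>i j. i < m \<Longrightarrow> j < m \<Longrightarrow> i \<noteq> j \<Longrightarrow> tan_of F (W i) \<noteq> tan_of F (W j)"
    unfolding many_tangents_def by blast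
  have "inj_on (\<lambda>i. tan_of F (W i)) {..<m}" using W(2) by (auto simp: inj_on_def)
  then have "card ((\<lambda>i. tan_of F (W i)) ` {..<m}) = m" by (simp add: card_image)
  then show ?R using W(1) by (intro exI[of _ "(\<lambda>i. tan_of F (W i)) ` {..<m}"]) auto
next
  assume ?R
  then obtain S where S: "S \<subseteq> tan_of F ` {w \<in> smooth_of F n. p \<in> tan_of F w}" "finite S" "card S = m" by blast
  obtain b where b: "bij_betw b {..<m} S"
    using finite_same_card_bij[of "{..<m}" S] S(2,3) by auto
  have "\<exists>w. i < m \<longrightarrow> w \<in> smooth_of F n \<and> p \<in> tan_of F w \<and> tan_of F w = b i" for i
  proof (cases "i < m")
    case True
    then have "b i \<in> S" using b by (auto simp: bij_betw_def)
    then show ?thesis using S(1) by blast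
  qed simp
  then obtain W where W: "\<And>i. i < m \<Longrightarrow> W i \<in> smooth_of F n \<and> p \<in> tan_of F (W i) \<and> tan_of F (W i) = b i"
    by metis
  have "tan_of F (W i) \<noteq> tan_of F (W j)" if ij: "i < m" "j < m" "i \<noteq> j" for i j
  proof -
    have "b i \<noteq> b j" using b ij by (auto simp: bij_betw_def inj_on_def)
    then show ?thesis using W ij by simp
  qed
  then show "many_tangents F n m p" unfolding many_tangents_def using W by blast
qed

lemma finite_card_iff_many_tangents:
  fixes F n p defines "T \<equiv> tan_of F ` {w \<in> smooth_of F n. p \<in> tan_of F w}"
  assumes "many_tangents F n k p" "\<not> many_tangents F n (Suc k) p"
  shows "finite T" "card T = k"
proof -
  have no: "\<not> (\<exists>S \<subseteq> T. finite S \<and> card S = Suc k)" using assms(3) unfolding many_tangents_iff T_def .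
  show fin: "finite T"
  proof (rule ccontr)
    assume "infinite T"
    from infinite_arbitrarily_large[OF this, of "Suc k"] no show False by blast
  qed
  obtain S where S: "S \<subseteq> T" "card S = k" using assms(2) unfolding many_tangents_iff T_def by blast
  then have "k \<le> card T" using card_mono[OF fin] by blast
  moreover have "\<not> Suc k \<le> card T"
  proof
    assume "Suc k \<le> card T"
    then obtain S where "S \<subseteq> T" "card S = Suc k" "finite S" by (rule obtain_subset_with_card_n)
    then show False using no by blast
  qed
  ultimately show "card T = k" by simp
qed

lemma homogeneous_generic_mult:
  assumes "homogeneous g" "eval_poly g v \<noteq> 0" "homogeneous h" "eval_poly h w \<noteq> 0"
  shows "homogeneous (g * h)" "\<exists>u. eval_poly (g * h) u \<noteq> 0"
  using homogeneous_mult[OF assms(1,3)] eval_poly_line_nonzero[OF assms(2,4)] by (auto simp: eval_poly_mult)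

text \<open>For each \<open>m\<close>, lying on at least \<open>m\<close> tangent spaces is
  generically true or generically false. The hypothesis \<open>dom\<close> expresses density of the
  tangent spaces.\<close>

lemma generic_tangent_count:
  fixes F :: "'a::finite cpoly set"
  assumes card: "CARD('a) = 2 * n + 1" and n: "n \<ge> 1" and F: "finite F" "\<And>f. f \<in> F \<Longrightarrow> homogeneous f"
    and dom: "\<And>g v. homogeneous g \<Longrightarrow> eval_poly g v \<noteq> 0 \<Longrightarrow> \<exists>p. eval_poly g p \<noteq> 0 \<and> many_tangents F n 1 p"
  obtains k g v where "k \<ge> 2" "homogeneous g" "eval_poly g v \<noteq> 0"
    "\<And>p. eval_poly g p \<noteq> 0 \<Longrightarrow> many_tangents F n k p \<and> \<not> many_tangents F n (Suc k) p"
proof -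
  define gen where "gen m \<longleftrightarrow> (\<exists>g. homogeneous g \<and> (\<exists>v. eval_poly g v \<noteq> 0) \<and>
    (\<forall>p. eval_poly g p \<noteq> 0 \<longrightarrow> many_tangents F n m p))" for m
  have dich: "gen m \<or> (\<exists>g. homogeneous g \<and> (\<exists>v. eval_poly g v \<noteq> 0) \<and>
    (\<forall>p. eval_poly g p \<noteq> 0 \<longrightarrow> \<not> many_tangents F n m p))" for m
    using definable_homogeneous_generic[OF definable_many_tangents[OF F(1)] many_tangents_scale, of n m]
    unfolding gen_def by blast
  have gen0: "gen 0" using dich[of 0] by (auto simp: many_tangents_def)
  have gen1: "gen 1" using dich[of 1] dom by blast
  \<comment> \<open>Otherwise, off a hypersurface, every point lies on a tangent space but not on
    two, and a null set would contain a nonempty Zariski open set.\<close>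
  have gen2: "gen 2"
  proof (rule ccontr)
    assume "\<not> gen 2"
    then obtain h v where h: "homogeneous h" "eval_poly h v \<noteq> 0"
      "\<And>p. eval_poly h p \<noteq> 0 \<Longrightarrow> \<not> many_tangents F n 2 p" using dich by blast
    obtain g w where g: "homogeneous g" "eval_poly g w \<noteq> 0"
      "\<And>p. eval_poly g p \<noteq> 0 \<Longrightarrow> many_tangents F n 1 p" using gen1 unfolding gen_def by blast
    let ?g = "g * h"
    obtain u where u: "eval_poly ?g u \<noteq> 0" and hom: "homogeneous ?g"
      using homogeneous_generic_mult[OF g(1,2) h(1,2)] by blast
    have "\<not> many_tangents F n 2 p" if "eval_poly ?g p \<noteq> 0" for p using that h(3) by (simp add: eval_poly_mult)
    note null = tangents_avoiding_double_points_negligible[OF card F(2) n hom this]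
    have "negligible (\<Union>i\<in>UNIV. {p. eval_poly ?g p \<noteq> 0 \<and> (\<exists>y. (y, p) \<in> incidence F n i)})"
      by (rule negligible_Union) (use null in auto)
    moreover have "{p. eval_poly ?g p \<noteq> 0} \<subseteq> (\<Union>i\<in>UNIV. {p. eval_poly ?g p \<noteq> 0 \<and> (\<exists>y. (y, p) \<in> incidence F n i)})"
    proof
      fix p assume p: "p \<in> {p. eval_poly ?g p \<noteq> 0}"
      then have "many_tangents F n 1 p" using g(3) by (simp add: eval_poly_mult)
      then obtain w where "w \<in> smooth_of F n" "p \<in> tan_of F w" by (auto simp: many_tangents_def)
      from incidence_rescale[OF F(2) this] p
      show "p \<in> (\<Union>i\<in>UNIV. {p. eval_poly ?g p \<noteq> 0 \<and> (\<exists>y. (y, p) \<in> incidence F n i)})" by blast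
    qed
    ultimately show False using not_negligible_eval_poly_nonzero[OF u] negligible_subset by blast
  qed
  \<comment> \<open>Otherwise a point off countably many hypersurfaces and exceptional null sets
    lies on arbitrarily many tangent spaces, although its fibre is countable and definable, hence
    finite.\<close>
  have "\<not> (\<forall>m. gen m)"
  proof
    assume "\<forall>m. gen m"
    then obtain g v where g: "\<And>m. eval_poly (g m) (v m) \<noteq> 0"
      "\<And>m p. eval_poly (g m) p \<noteq> 0 \<Longrightarrow> many_tangents F n m p" unfolding gen_def by metis
    have "\<exists>E. negligible E \<and> (\<forall>p. p \<notin> E \<longrightarrow> countable {y. (y, p) \<in> incidence F n i})" for i
      by (rule negligible_infinite_fibres[OF card F(2), of F i]) blast+
    then obtain E where E: "\<And>i. negligible (E i)" "\<And>i p. p \<notin> E i \<Longrightarrow> countable {y. (y, p) \<in> incidence F n i}"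
      by metis
    have "negligible ((\<Union>m. {p. eval_poly (g m) p = 0}) \<union> (\<Union>i. E i))"
      using negligible_eval_poly_zeros[OF g(1)] E(1)
      by (intro negligible_Un negligible_countable_Union) auto
    then have "(\<Union>m. {p. eval_poly (g m) p = 0}) \<union> (\<Union>i. E i) \<noteq> UNIV"
      using open_not_negligible[of "UNIV :: (complex ^ 'a) set"] by force
    then obtain p where p: "\<And>m. eval_poly (g m) p \<noteq> 0" "\<And>i. p \<notin> E i" by blast
    define Y where "Y i = {y. (y, p) \<in> incidence F n i}" for i
    have "finite (Y i)" for i
    proof -
      have "definable (\<lambda>x. slot 2 x \<in> smooth_of F n \<and> slot 2 x $ i = 1 \<and> slot 0 x \<in> tan_of F (slot 2 x))"
        by (intro definable.conj definable_smooth_of definable_tan_of definable_eq slot_nth_polyfun polyfun_intros F(1))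
      from definable_countable_imp_finite[where R = "\<lambda>y p. y \<in> smooth_of F n \<and> y $ i = 1 \<and> p \<in> tan_of F y", OF this, of p]
      show ?thesis using E(2)[OF p(2), of i] by (simp add: Y_def incidence_def)
    qed
    then have fin: "finite (tan_of F ` (\<Union>i\<in>UNIV. Y i))" by simp
    have sub: "tan_of F ` {w \<in> smooth_of F n. p \<in> tan_of F w} \<subseteq> tan_of F ` (\<Union>i\<in>UNIV. Y i)"
    proof safe
      fix w assume "w \<in> smooth_of F n" "p \<in> tan_of F w"
      from incidence_rescale[OF F(2) this]
      show "tan_of F w \<in> tan_of F ` (\<Union>i\<in>UNIV. Y i)" unfolding Y_def by (metis (mono_tags) UN_I UNIV_I image_eqI mem_Collect_eq)
    qed
    let ?m = "Suc (card (tan_of F ` (\<Union>i\<in>UNIV. Y i)))"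
    have "many_tangents F n ?m p" using g(2) p(1) by blast
    then obtain S where S: "S \<subseteq> tan_of F ` {w \<in> smooth_of F n. p \<in> tan_of F w}" "card S = ?m"
      unfolding many_tangents_iff by blast
    have "card S \<le> card (tan_of F ` (\<Union>i\<in>UNIV. Y i))" by (rule card_mono[OF fin order_trans[OF S(1) sub]])
    then show False using S(2) by simp
  qed
  then have ex: "\<exists>m. \<not> gen m" by blast
  \<comment> \<open>The first failure of \<open>gen\<close> is one above the generic number of
    tangent spaces.\<close>
  define l where "l = (LEAST m. \<not> gen m)"
  have l: "\<not> gen l" unfolding l_def by (rule LeastI_ex[OF ex])
  have below: "gen m" if "m < l" for m using not_less_Least[of m "\<lambda>m. \<not> gen m"] that by (simp add: l_def)
  have "l \<noteq> 0" "l \<noteq> 1" "l \<noteq> 2" using l gen0 gen1 gen2 by metis+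
  then have l': "l = Suc (l - 1)" "l - 1 \<ge> 2" by auto
  obtain k where k: "l = Suc k" "k \<ge> 2" using l' by (rule that)
  obtain g v where g: "homogeneous g" "eval_poly g v \<noteq> 0" "\<And>p. eval_poly g p \<noteq> 0 \<Longrightarrow> many_tangents F n k p"
    using below[of k, unfolded k(1), OF lessI] unfolding gen_def by blast
  obtain h w where h: "homogeneous h" "eval_poly h w \<noteq> 0" "\<And>p. eval_poly h p \<noteq> 0 \<Longrightarrow> \<not> many_tangents F n (Suc k) p"
    using dich[of l] l unfolding k(1) by blast
  obtain u where "homogeneous (g * h)" "eval_poly (g * h) u \<noteq> 0" using homogeneous_generic_mult[OF g(1,2) h(1,2)] by blast
  then show thesis using g(3) h(3) by (intro that[OF k(2)]) (auto simp: eval_poly_mult)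
qed


section \<open>The tangent degree\<close>

lemma ex_nonzero_point:
  assumes "eval_poly g v \<noteq> 0"
  shows "\<exists>p. \<exists>u\<in>hcoords p. eval_poly g u \<noteq> 0"
proof -
  obtain u where u: "u \<noteq> 0" "eval_poly g u \<noteq> 0"
  proof (rule ccontr)
    assume "\<not> thesis"
    then have "{p. eval_poly g p \<noteq> 0} \<subseteq> {0}" using that by blast
    then have "negligible {p. eval_poly g p \<noteq> 0}" by (rule negligible_subset[OF negligible_sing])
    then show False using not_negligible_eval_poly_nonzero[OF assms] by blast
  qed
  then show ?thesis using ex_proj_point by blast
qed

text \<open>Makes the generic number unique, as the definite description in
  \<open>tangent_degree\<close> requires.\<close>

lemma nonempty_open_zariski_meet:
  assumes "openin zariski U" "U \<noteq> {}" "openin zariski V" "V \<noteq> {}"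
  shows "U \<inter> V \<noteq> {}"
proof -
  have *: "\<exists>f. (\<exists>v. eval_poly f v \<noteq> 0) \<and> (\<forall>p. \<forall>v\<in>hcoords p. eval_poly f v \<noteq> 0 \<longrightarrow> p \<in> W)"
    if W: "openin zariski W" "W \<noteq> {}" for W :: "'a proj set"
  proof -
    obtain S where S: "- W = zero_locus S" using W(1) by (auto simp: openin_zariski zariski_closed_def)
    obtain p where "p \<in> W" using W(2) by blast
    then have "p \<notin> zero_locus S" using S by blast
    then obtain f v where "f \<in> S" "eval_poly f v \<noteq> 0" by (auto simp: zero_locus_def)
    moreover have "q \<in> W" if "w \<in> hcoords q" "eval_poly f w \<noteq> 0" for q w
    proof (rule ccontr)
      assume "q \<notin> W"
      then have "q \<in> zero_locus S" using S by blast
      then show False using that \<open>f \<in> S\<close> by (auto simp: zero_locus_def)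
    qed
    ultimately show ?thesis by blast
  qed
  obtain f v where f: "eval_poly f v \<noteq> 0" "\<And>p v. v \<in> hcoords p \<Longrightarrow> eval_poly f v \<noteq> 0 \<Longrightarrow> p \<in> U"
    using *[OF assms(1,2)] by blast
  obtain g w where g: "eval_poly g w \<noteq> 0" "\<And>p v. v \<in> hcoords p \<Longrightarrow> eval_poly g v \<noteq> 0 \<Longrightarrow> p \<in> V"
    using *[OF assms(3,4)] by blast
  obtain t where "eval_poly (f * g) t \<noteq> 0"
    using eval_poly_line_nonzero[OF f(1) g(1)] by (auto simp: eval_poly_mult)
  then obtain p u where "u \<in> hcoords p" "eval_poly (f * g) u \<noteq> 0" using ex_nonzero_point by blast
  then have "p \<in> U \<inter> V" using f(2)[of u p] g(2)[of u p] by (simp add: eval_poly_mult)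
  then show ?thesis by blast
qed

section \<open>From tangent cones back to projective tangent spaces\<close>

definition projectivization :: "(complex ^ 'a::finite) set \<Rightarrow> 'a proj set" where
  "projectivization L = {q. line_of q \<subseteq> L}"

lemma mem_projectivization:
  assumes "vec.subspace L" "v \<in> hcoords q"
  shows "q \<in> projectivization L \<longleftrightarrow> v \<in> L"
proof
  assume "q \<in> projectivization L"
  then show "v \<in> L" using assms(2) by (auto simp: projectivization_def hcoords_def)
next
  assume "v \<in> L"
  then show "q \<in> projectivization L"
    unfolding projectivization_def mem_Collect_eq hcoords_span[OF assms(2)]
    using assms(1) by (intro vec.span_minimal) auto
qed

text \<open>Ensures that counting tangent cones and counting embedded tangent spaces give the same
  number.\<close>

lemma projectivization_inject:
  assumes "vec.subspace L" "vec.subspace M" "projectivization L = projectivization M"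
  shows "L = M"
proof -
  have "u \<in> L \<longleftrightarrow> u \<in> M" for u
  proof (cases "u = 0")
    case True
    then show ?thesis using assms(1,2) by (simp add: vec.subspace_0)
  next
    case False
    then obtain q where "u \<in> hcoords q" using ex_proj_point by blast
    then show ?thesis using mem_projectivization assms by blast
  qed
  then show ?thesis by blast
qed

theorem theorem10:
  fixes X :: "'a::finite proj set" and n :: nat
  assumes "n \<ge> 1"
    and "CARD('a) = 2 * n + 1"
    and "irreducible_variety X"
    and "proj_dim X = enat n"
    and "Tan X = UNIV"
  shows "tangent_degree X \<ge> 2"
proof -
  have "zariski_closed X" using assms(3) by (simp add: irreducible_variety_def closedin_zariski)
  then obtain F where F: "finite F" "\<And>f. f \<in> F \<Longrightarrow> homogeneous f"
    "\<And>p v. v \<in> hcoords p \<Longrightarrow> p \<in> X \<longleftrightarrow> v \<in> cone_of F"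
    "\<And>p v. p \<in> X \<Longrightarrow> v \<in> hcoords p \<Longrightarrow> tangent_cone X p = tan_of F v"
    by (rule finite_tangent_equations) (rule that)
  have smooth: "x \<in> smooth_locus X \<longleftrightarrow> w \<in> smooth_of F n" if w: "w \<in> hcoords x" for x w
  proof -
    have "w \<noteq> 0" using w by (simp add: hcoords_def)
    moreover have "enat d = enat n + 1 \<longleftrightarrow> d = n + 1" for d by (simp add: one_enat_def)
    ultimately show ?thesis
      unfolding smooth_locus_def smooth_of_def mem_Collect_eq assms(4) F(3)[OF w, symmetric]
      using F(4)[OF _ w] by auto
  qed
  have space: "tangent_space X x = projectivization (tan_of F w)" if "w \<in> hcoords x" "w \<in> smooth_of F n" for x w
  proof -
    have "x \<in> X" using F(3)[OF that(1)] that(2) by (simp add: smooth_of_def)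
    then show ?thesis by (simp add: tangent_space_def projectivization_def F(4)[OF _ that(1)])
  qed
  \<comment> \<open>Tangent cones do not depend on the scaling of homogeneous coordinates, so points
    of contact may be represented by arbitrary nonzero vectors.\<close>
  have through: "tangent_spaces_through X p = projectivization ` tan_of F ` {w \<in> smooth_of F n. v \<in> tan_of F w}"
    (is "_ = ?R") if v: "v \<in> hcoords p" for p v
  proof (intro equalityI subsetI)
    fix T assume "T \<in> tangent_spaces_through X p"
    then obtain x where x: "p \<in> T" "x \<in> smooth_locus X" "T = tangent_space X x"
      by (auto simp: tangent_spaces_through_def)
    obtain w where w: "w \<in> hcoords x" using hcoords_nonempty by blast
    have sm: "w \<in> smooth_of F n" using smooth[OF w] x(2) by blast
    have "T = projectivization (tan_of F w)" unfolding x(3) by (rule space[OF w sm])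
    moreover from this have "v \<in> tan_of F w" using mem_projectivization[OF subspace_tan_of v] x(1) by blast
    ultimately show "T \<in> ?R" using sm by blast
  next
    fix T assume "T \<in> ?R"
    then obtain w where w: "w \<in> smooth_of F n" "v \<in> tan_of F w" "T = projectivization (tan_of F w)" by blast
    have "w \<noteq> 0" using w(1) by (simp add: smooth_of_def)
    then obtain x where x: "w \<in> hcoords x" using ex_proj_point by blast
    have "p \<in> T" unfolding w(3) using mem_projectivization[OF subspace_tan_of v] w(2) by blast
    moreover have "T = tangent_space X x" unfolding w(3) using space[OF x w(1)] by simp
    moreover have "x \<in> smooth_locus X" using smooth[OF x] w(1) by blast
    ultimately show "T \<in> tangent_spaces_through X p" by (auto simp: tangent_spaces_through_def)
  qed
  \<comment> \<open>If all tangent points satisfied \<open>g = 0\<close>, the closure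
    \<open>Tan X\<close> would lie in that hypersurface and could not be the whole space.\<close>
  have dom: "\<exists>p. eval_poly g p \<noteq> 0 \<and> many_tangents F n 1 p" if g: "homogeneous g" "eval_poly g v \<noteq> 0" for g v
  proof (rule ccontr)
    assume no: "\<not> ?thesis"
    have "(\<Union>x\<in>smooth_locus X. tangent_space X x) \<subseteq> zero_locus {g}"
    proof safe
      fix x q assume x: "x \<in> smooth_locus X" "q \<in> tangent_space X x"
      have "eval_poly g u = 0" if u: "u \<in> hcoords q" for u
      proof -
        have "tangent_space X x \<in> tangent_spaces_through X q" using x by (auto simp: tangent_spaces_through_def)
        then obtain w where "w \<in> smooth_of F n" "u \<in> tan_of F w" unfolding through[OF u] by blast
        then have "many_tangents F n 1 u" unfolding many_tangents_def by (intro exI[of _ "\<lambda>_. w"]) auto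
        then show ?thesis using no by blast
      qed
      then show "q \<in> zero_locus {g}" by (simp add: zero_locus_def)
    qed
    moreover have "closedin zariski (zero_locus {g})"
      unfolding closedin_zariski zariski_closed_def using g(1) by blast
    ultimately have "Tan X \<subseteq> zero_locus {g}" unfolding Tan_def by (rule closure_of_minimal)
    then have "q \<in> zero_locus {g}" for q using assms(5) by blast
    then show False using ex_nonzero_point[OF g(2)] by (auto simp: zero_locus_def)
  qed
  obtain k g v where k: "k \<ge> 2" and g: "homogeneous g" "eval_poly g v \<noteq> 0"
    "\<And>p. eval_poly g p \<noteq> 0 \<Longrightarrow> many_tangents F n k p \<and> \<not> many_tangents F n (Suc k) p"
    by (rule generic_tangent_count[OF assms(2,1) F(1,2) dom]) (assumption+, rule that)
  let ?Q = "\<lambda>k. \<exists>U. openin zariski U \<and> U \<noteq> {} \<and>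
             (\<forall>p\<in>U. finite (tangent_spaces_through X p) \<and> card (tangent_spaces_through X p) = k)"
  have "?Q k"
  proof (intro exI conjI ballI)
    let ?U = "- zero_locus {g}"
    show "openin zariski ?U" unfolding openin_zariski zariski_closed_def double_complement using g(1) by blast
    show "?U \<noteq> {}" using ex_nonzero_point[OF g(2)] by (auto simp: zero_locus_def)
    fix p assume "p \<in> ?U"
    then obtain u where u: "u \<in> hcoords p" "eval_poly g u \<noteq> 0" by (auto simp: zero_locus_def)
    let ?T = "tan_of F ` {w \<in> smooth_of F n. u \<in> tan_of F w}"
    have T: "finite ?T" "card ?T = k" using finite_card_iff_many_tangents g(3)[OF u(2)] by blast+
    have "inj_on projectivization ?T"
    proof (rule inj_onI)
      fix L M assume L: "L \<in> ?T" and M: "M \<in> ?T" and eq: "projectivization L = projectivization M"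
      have "vec.subspace L" "vec.subspace M" using L M subspace_tan_of by blast+
      then show "L = M" using eq by (rule projectivization_inject)
    qed
    then show "card (tangent_spaces_through X p) = k" unfolding through[OF u(1)] using T(2) by (simp only: card_image)
    show "finite (tangent_spaces_through X p)" unfolding through[OF u(1)] using T(1) by (rule finite_imageI)
  qed
  \<comment> \<open>Two nonempty open sets share a point, whose tangent spaces have only one
    cardinality.\<close>
  moreover have "l = k" if "?Q l" for l
  proof -
    from that obtain U where U: "openin zariski U \<and> U \<noteq> {} \<and>
      (\<forall>p\<in>U. finite (tangent_spaces_through X p) \<and> card (tangent_spaces_through X p) = l)" by (rule exE)
    from \<open>?Q k\<close> obtain V where V: "openin zariski V \<and> V \<noteq> {} \<and>
      (\<forall>p\<in>V. finite (tangent_spaces_through X p) \<and> card (tangent_spaces_through X p) = k)" by (rule exE)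
    obtain p where "p \<in> U" "p \<in> V" using nonempty_open_zariski_meet[of U V] U V by blast
    then show ?thesis using bspec[OF U[THEN conjunct2, THEN conjunct2], of p]
        bspec[OF V[THEN conjunct2, THEN conjunct2], of p] by simp
  qed
  ultimately have "(THE k. ?Q k) = k" by (rule the_equality)
  \<comment> \<open>With \<open>2 * n + 1\<close> homogeneous coordinates the ambient dimension is
    \<open>2 * n\<close>, so the first branch of \<open>tangent_degree\<close> applies.\<close>
  moreover have "proj_dim (Tan X) = 2 * proj_dim X"
    unfolding assms(4,5) proj_dim_UNIV assms(2) by (simp add: numeral_eq_enat)
  ultimately show ?thesis using k unfolding tangent_degree_def assms(5) subtopology_UNIV by simp
qed

end
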